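(* Let $\mathrm{char}(\mathbb F)=p>0$ and $0\ne h\in R=\mathbb F[x]$. Let $a_n=\pi_hh^{n-1}y^n$ for all $n\ge0$ and $a_{-1}=0$, and let $\delta_0(r)=(r\pi_hh^{-1})'h$ for $r\in R$. The Lie brackets in $\mathrm{Der}_{\mathbb F}(A_h)$ satisfy the following. (a) $[D_f,D_g]=0$ for all $f,g\in R$. (b) For all $g,r\in R$ and $n\ge0$, $[D_g,\mathrm{ad}_{ra_n}]=n\,\mathrm{ad}_{gra_{n-1}}=n\,\mathrm{ad}_{ca_{n-1}}$ in $\mathsf{HH}^1(A_h)$, where $c$ is the remainder of the division of $gr$ by $\frac{h}{\pi_h}$ in $R$. (c) $[\mathrm{ad}_{ra_m},\mathrm{ad}_{sa_n}]=\mathrm{ad}_{qa_{m+n-1}}=\mathrm{ad}_{da_{m+n-1}}$ in $\mathsf{HH}^1(A_h)$ for all $r,s\in R$ and all $m,n\ge0$, where $q=mr\delta_0(s)-ns\delta_0(r)$ and $d$ is the remainder of the division in $R$ of $q$ by $\frac{h}{\pi_h}$. (d) Assume $r\in R$ and $m=kp+n$, where $k\ge0$ and $0\le n<p$. Then in $\mathsf{HH}^1(A_h)$, $$[\breve E_x,\mathrm{ad}_{ra_m}]=\mathsf z_h^k[\breve E_x,\mathrm{ad}_{ra_n}]=\begin{cases}\mathsf z_h^{k+1}\,\mathrm{ad}_{\zeta_na_{n-1}}&\text{if }1\le n<p,\\ \mathsf z_h^k\,[D_{\delta_0(r)},\breve E_x]&\text{if }n=0,\end{cases}$$ where $\zeta_n=\frac{h}{\pi_h\varrho_h}\delta_0(r)+nr\frac{h'}{\varrho_h}$.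 (e) For $g\in R$, $[D_g,\breve E_x]=D_e+\mathrm{ad}_b$, where $b=b_1+b_2$ with $$b_1=\frac{gh^{p-1}}{\varrho_h}y^{p-1}\in\mathsf N_{A_1}(A_h),\qquad b_2=\sum_{k=2}^{p-1}(-1)^k\frac{(gh^{-1})^{(k-1)}h^p}{\varrho_h}\frac{y^{p-k}}{p-k}\in A_h,$$ and $e=\big([D_g,\breve E_x]-\mathrm{ad}_b\big)(\hat y)\in\mathsf C_{A_h}(x)$.
   Context: $\mathbb F$ is a field of characteristic $p>0$, $R=\mathbb F[x]$, $0\ne h\in R$. The Weyl algebra $A_1$ is the unital associative $\mathbb F$-algebra with generators $x,y$ and relation $yx-xy=1$. $A_h$ is the unital associative $\mathbb F$-algebra with generators $x,\hat y$ and relation $\hat yx-x\hat y=h$; it is identified with the subalgebra of $A_1$ generated by $x$ and $\hat y=yh$. $\mathsf z_h=h^py^p$, a central element of $A_h$. $\mathsf{HH}^1(A_h)=\mathrm{Der}_{\mathbb F}(A_h)/\mathrm{Inder}_{\mathbb F}(A_h)$; derivations and their images there are denoted by the same symbol. $\mathsf C_{A_h}(x)=\{a\in A_h\mid ax=xa\}$; for $e\in\mathsf C_{A_h}(x)$, $D_e$ is the unique derivation of $A_h$ with $D_e(x)=0$, $D_e(\hat y)=e$. With $\mathrm{ad}_u(v)=[u,v]=uv-vu$, $\mathsf N_{A_1}(A_h)=\{u\in A_1\mid[u,A_h]\subseteq A_h\}$; for $u$ in it, $\mathrm{ad}_u$ is regarded as a derivation of $A_h$. $\pi_h\in R$ is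 the unique monic polynomial such that for all $r\in R$: $h\mid h'r\iff\pi_h\mid r$. For $n\ge1$, $ra_n\in\mathsf N_{A_1}(A_h)$ for all $r\in R$; $a_0=\pi_hh^{-1}$ lies in the localization $A_1\Sigma^{-1}$, $\Sigma=\{h^m\mid m\ge0\}$, and $\mathrm{ad}_{ra_0}$ maps $A_h$ to itself, so is regarded as a derivation of $A_h$. $\delta_0$ maps $R$ to $R$. $\varrho_h$ is the unique monic polynomial of maximal degree in $\mathbb F[x^p]$ dividing $h$ (it also divides $h'$). $E_x\in\mathrm{Der}_{\mathbb F}(A_1)$ is given by $E_x(x)=y^{p-1}$, $E_x(y)=0$, and $\breve E_x=\frac{h^p}{\varrho_h}E_x$, which restricts to a derivation of $A_h$. Primes and superscripts $(k)$ denote $\frac{d}{dx}$ and its $k$-th iterate, on $R$ and on $R[h^{-1}]$. *)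

theory Defs
  imports "HOL-Computational_Algebra.Computational_Algebra" "HOL-Library.Function_Algebras"
begin

section \<open>Differentiation on the rational function field\<close>

definition fract_deriv :: "'a::field poly fract \<Rightarrow> 'a poly fract" where
  "fract_deriv u = (case SOME (a, b). b \<noteq> 0 \<and> u = Fract a b of
     (a, b) \<Rightarrow> Fract (pderiv a * b - a * pderiv b) (b * b))"

lemma fract_deriv_Fract:
  assumes "b \<noteq> 0"
  shows "fract_deriv (Fract a b) = Fract (pderiv a * b - a * pderiv b) (b * b)"
proof -
  obtain c d where cd: "(SOME (c, d). d \<noteq> 0 \<and> Fract a b = Fract c d) = (c, d)"
    by fastforce
  have "case (SOME (c, d). d \<noteq> 0 \<and> Fract a b = Fract c d) of (c, d) \<Rightarrow> d \<noteq> 0 \<and> Fract a b = Fract c d"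
    by (rule someI[of _ "(a, b)"]) (use assms in simp)
  then have d: "d \<noteq> 0" and "Fract a b = Fract c d"
    unfolding cd by simp_all
  then have eq: "a * d = c * b"
    using assms by (simp add: eq_fract)
  have "pderiv a * d + a * pderiv d = pderiv c * b + c * pderiv b"
    using arg_cong[OF eq, of pderiv] by (simp add: pderiv_mult algebra_simps)
  then have "pderiv a * d = pderiv c * b + c * pderiv b - a * pderiv d"
    by (simp add: algebra_simps)
  note deriv = this
  have "(pderiv a * b - a * pderiv b) * (d * d)
      = (pderiv a * d) * (b * d) - (a * d) * (pderiv b * d)"
    by (simp add: algebra_simps)
  also have "\<dots> = C * (b * b * d) + (c * b) * (pderiv b * d) - (a * d) * (pderiv d * b)
      - (a * d) * (pderiv b * d)" if "C = pderiv c" for C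
    unfolding deriv that by (simp add: algebra_simps)
  finally have "(pderiv a * b - a * pderiv b) * (d * d) = (pderiv c * d - c * pderiv d) * (b * b)"
    unfolding eq by (simp add: algebra_simps)
  then show ?thesis
    using assms d by (simp add: fract_deriv_def cd eq_fract)
qed

lemma fract_deriv_to_fract [simp]: "fract_deriv (to_fract r) = to_fract (pderiv r)"
  by (simp add: to_fract_def fract_deriv_Fract)

lemma fract_deriv_add: "fract_deriv (u + v) = fract_deriv u + fract_deriv v"
  by (cases u; cases v)
    (simp add: fract_deriv_Fract eq_fract pderiv_mult pderiv_add algebra_simps)

lemma fract_deriv_mult: "fract_deriv (u * v) = fract_deriv u * v + u * fract_deriv v"
  by (cases u; cases v)
    (simp add: fract_deriv_Fract eq_fract pderiv_mult pderiv_add algebra_simps)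

section \<open>Ore extensions $K[y;\delta]$ with $y f = f y + \delta(f)$\<close>

text \<open>An element $\sum_i f_i y^i$ is stored as the list of its left coefficients $f_i$; \<open>ore_shift\<close> is
  left multiplication by $y$.\<close>

definition ore_shift :: "('k \<Rightarrow> 'k) \<Rightarrow> 'k::comm_ring_1 poly \<Rightarrow> 'k poly" where
  "ore_shift \<delta> Q = pCons 0 Q + map_poly \<delta> Q"

definition ore_mult :: "('k \<Rightarrow> 'k) \<Rightarrow> 'k::comm_ring_1 poly \<Rightarrow> 'k poly \<Rightarrow> 'k poly" where
  "ore_mult \<delta> P Q = (\<Sum>i\<le>degree P. smult (coeff P i) ((ore_shift \<delta> ^^ i) Q))"

lemma ore_mult_eq:
  assumes "degree P \<le> n"
  shows "ore_mult \<delta> P Q = (\<Sum>i\<le>n. smult (coeff P i) ((ore_shift \<delta> ^^ i) Q))"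
  unfolding ore_mult_def
  using assms by (intro sum.mono_neutral_left) (auto simp: coeff_eq_0)

lemma ore_mult_0 [simp]: "ore_mult \<delta> 0 Q = 0"
  by (simp add: ore_mult_def)

lemma ore_mult_pCons [simp]:
  "ore_mult \<delta> (pCons f P) Q = smult f Q + ore_mult \<delta> P (ore_shift \<delta> Q)"
proof -
  have "ore_mult \<delta> (pCons f P) Q
      = (\<Sum>i\<le>Suc (degree P). smult (coeff (pCons f P) i) ((ore_shift \<delta> ^^ i) Q))"
    by (rule ore_mult_eq) (rule degree_pCons_le)
  also have "\<dots> = smult f Q + (\<Sum>i\<le>degree P. smult (coeff P i) ((ore_shift \<delta> ^^ i) (ore_shift \<delta> Q)))"
    by (subst sum.atMost_Suc_shift) (simp add: funpow_swap1)
  finally show ?thesis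
    by (simp add: ore_mult_def)
qed

lemma ore_mult_add_left: "ore_mult \<delta> (P + P') Q = ore_mult \<delta> P Q + ore_mult \<delta> P' Q"
proof -
  define n where "n = max (degree P) (degree P')"
  have "degree (P + P') \<le> n" "degree P \<le> n" "degree P' \<le> n"
    by (auto simp: n_def degree_add_le)
  then show ?thesis
    by (simp add: ore_mult_eq[where n = n] smult_add_left sum.distrib)
qed

lemma ore_mult_smult_left: "ore_mult \<delta> (smult f P) Q = smult f (ore_mult \<delta> P Q)"
  by (induction P arbitrary: Q) (simp_all add: smult_add_right)

locale ore_deriv =
  fixes \<delta> :: "'k::comm_ring_1 \<Rightarrow> 'k"
  assumes add: "\<delta> (f + g) = \<delta> f + \<delta> g"
    and mult: "\<delta> (f * g) = \<delta> f * g + f * \<delta> g"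
begin

lemma zero [simp]: "\<delta> 0 = 0"
  using add[of 0 0] by simp

lemma one [simp]: "\<delta> 1 = 0"
  using mult[of 1 1] by simp

lemma map_add: "map_poly \<delta> (P + Q) = map_poly \<delta> P + map_poly \<delta> Q"
  by (intro poly_eqI) (simp add: coeff_map_poly add)

lemma map_smult: "map_poly \<delta> (smult f P) = smult (\<delta> f) P + smult f (map_poly \<delta> P)"
  by (intro poly_eqI) (simp add: coeff_map_poly mult)

lemma shift_0 [simp]: "ore_shift \<delta> 0 = 0"
  by (simp add: ore_shift_def)

lemma shift_add: "ore_shift \<delta> (P + Q) = ore_shift \<delta> P + ore_shift \<delta> Q"
proof -
  have "pCons 0 (P + Q) = pCons 0 P + pCons 0 Q"
    by simp
  then show ?thesis
    unfolding ore_shift_def map_add by (simp only: ac_simps)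
qed

lemma shift_smult: "ore_shift \<delta> (smult f P) = smult (\<delta> f) P + smult f (ore_shift \<delta> P)"
proof -
  have "pCons 0 (smult f P) = smult f (pCons 0 P)"
    by simp
  then show ?thesis
    unfolding ore_shift_def map_smult smult_add_right by (simp del: smult_pCons)
qed

lemma shift_pCons: "ore_shift \<delta> (pCons f P) = pCons (\<delta> f) (smult f 1 + ore_shift \<delta> P)"
  by (simp add: ore_shift_def map_poly_pCons)

lemma mult_0_right [simp]: "ore_mult \<delta> P 0 = 0"
  by (induction P) simp_all

lemma mult_1_left [simp]: "ore_mult \<delta> 1 P = P"
  by (simp add: one_pCons)

lemma mult_add_right: "ore_mult \<delta> P (Q + R) = ore_mult \<delta> P Q + ore_mult \<delta> P R"
  by (induction P arbitrary: Q R) (simp_all add: smult_add_right shift_add)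

lemma mult_smult_right: "\<delta> c = 0 \<Longrightarrow> ore_mult \<delta> P (smult c Q) = smult c (ore_mult \<delta> P Q)"
  by (induction P arbitrary: Q) (simp_all add: shift_smult smult_add_right mult.commute)

lemma shift_mult: "ore_mult \<delta> (ore_shift \<delta> P) Q = ore_shift \<delta> (ore_mult \<delta> P Q)"
proof (induction P arbitrary: Q)
  case (pCons f P)
  then show ?case
    by (simp add: shift_pCons ore_mult_add_left ore_mult_smult_left shift_add shift_smult)
qed simp

lemma mult_assoc: "ore_mult \<delta> (ore_mult \<delta> P Q) R = ore_mult \<delta> P (ore_mult \<delta> Q R)"
  by (induction P arbitrary: Q) (simp_all add: ore_mult_add_left ore_mult_smult_left shift_mult)

lemma shift_power_1: "(ore_shift \<delta> ^^ n) 1 = monom 1 n"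
proof (induction n)
  case (Suc n)
  have "map_poly \<delta> (monom 1 n) = 0"
    by (intro poly_eqI) (simp add: coeff_map_poly)
  with Suc show ?case
    by (simp add: ore_shift_def monom_Suc)
qed simp

lemma mult_1_right [simp]: "ore_mult \<delta> P 1 = P"
proof -
  have "ore_mult \<delta> P 1 = (\<Sum>i\<le>degree P. monom (coeff P i) i)"
    by (simp add: ore_mult_def shift_power_1 smult_monom)
  then show ?thesis
    by (simp add: poly_as_sum_of_monoms)
qed

end

section \<open>The ambient algebra $\mathbb F(x)[y; d/dx]$\<close>

text \<open>This ring contains \<open>A\<^sub>1\<close> and its localization at the powers of \<open>h\<close>, namely
  $R[h^{-1}][y; d/dx]$, for all \<open>h \<noteq> 0\<close> at once.\<close>

typedef (overloaded) 'a rat_weyl = "UNIV :: 'a::field poly fract poly set"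
  morphisms rep_rw abs_rw ..

setup_lifting type_definition_rat_weyl

interpretation frac: ore_deriv "fract_deriv :: 'a::field poly fract \<Rightarrow> _"
  by standard (rule fract_deriv_add fract_deriv_mult)+

instantiation rat_weyl :: (field) ring_1
begin

lift_definition zero_rat_weyl :: "'a rat_weyl" is 0 .
lift_definition one_rat_weyl :: "'a rat_weyl" is 1 .
lift_definition plus_rat_weyl :: "'a rat_weyl \<Rightarrow> 'a rat_weyl \<Rightarrow> 'a rat_weyl" is "(+)" .
lift_definition minus_rat_weyl :: "'a rat_weyl \<Rightarrow> 'a rat_weyl \<Rightarrow> 'a rat_weyl" is "(-)" .
lift_definition uminus_rat_weyl :: "'a rat_weyl \<Rightarrow> 'a rat_weyl" is uminus .
lift_definition times_rat_weyl :: "'a rat_weyl \<Rightarrow> 'a rat_weyl \<Rightarrow> 'a rat_weyl"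
  is "ore_mult fract_deriv" .

instance
  by standard (transfer; simp add: algebra_simps frac.mult_assoc ore_mult_add_left frac.mult_add_right)+

end

definition cf :: "'a::field poly fract \<Rightarrow> 'a rat_weyl" where
  "cf f = abs_rw [:f:]"

definition pol :: "'a::field poly \<Rightarrow> 'a rat_weyl" where
  "pol r = cf (to_fract r)"

definition scal :: "'a::field \<Rightarrow> 'a rat_weyl" where
  "scal c = pol [:c:]"

definition xx :: "'a::field rat_weyl" where
  "xx = pol [:0, 1:]"

definition yy :: "'a::field rat_weyl" where
  "yy = abs_rw [:0, 1:]"

lemma cf_add: "cf (f + g) = cf f + cf g"
  by (simp add: cf_def plus_rat_weyl.abs_eq)

lemma cf_mult: "cf (f * g) = cf f * cf g"
  by (simp add: cf_def times_rat_weyl.abs_eq)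

lemma cf_1: "cf 1 = 1"
  by (simp add: cf_def one_rat_weyl.abs_eq one_pCons)

lemma yy_cf: "yy * cf f = cf f * yy + cf (fract_deriv f)"
  by (simp add: cf_def yy_def times_rat_weyl.abs_eq plus_rat_weyl.abs_eq ore_shift_def map_poly_pCons)

lemma pol_1: "pol 1 = 1"
  by (simp add: pol_def cf_1)

lemma weyl_relation: "yy * xx - xx * yy = (1 :: 'a::field rat_weyl)"
  by (simp add: xx_def pol_def yy_cf pderiv_pCons cf_1 flip: one_pCons)

section \<open>The algebras $A_1$ and $A_h$\<close>

inductive_set subalg :: "'a::field rat_weyl set \<Rightarrow> 'a rat_weyl set" for S where
  gen: "a \<in> S \<Longrightarrow> a \<in> subalg S"
| scal: "scal c \<in> subalg S"
| add: "a \<in> subalg S \<Longrightarrow> b \<in> subalg S \<Longrightarrow> a + b \<in> subalg S"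
| mult: "a \<in> subalg S \<Longrightarrow> b \<in> subalg S \<Longrightarrow> a * b \<in> subalg S"

definition Weyl1 :: "'a::field rat_weyl set" where
  "Weyl1 = subalg {xx, yy}"

definition yhat :: "'a::field poly \<Rightarrow> 'a rat_weyl" where
  "yhat h = yy * pol h"

definition Weyl :: "'a::field poly \<Rightarrow> 'a rat_weyl set" where
  "Weyl h = subalg {xx, yhat h}"

subsection \<open>Presentation by generators and relations\<close>

text \<open>\<open>Weyl_universal\<close> below shows that \<open>Weyl h\<close> is the algebra presented by generators
  $x, \hat y$ and the relation $\hat y x - x \hat y = h$; \<open>Weyl1_eq\<close> gives the case \<open>h = 1\<close>, i.e.
  \<open>A\<^sub>1\<close>. The algebra structure of the target ring is given by the central homomorphism \<open>\<iota>\<close>.\<close>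

lemma Weyl1_eq: "Weyl1 = Weyl 1"
  by (simp add: Weyl1_def Weyl_def yhat_def pol_1)

locale weyl_rel =
  fixes \<iota> :: "'a::field \<Rightarrow> 'b::ring_1" and X Y :: 'b and h :: "'a poly"
  assumes i_1: "\<iota> 1 = 1"
    and i_add: "\<iota> (c + d) = \<iota> c + \<iota> d"
    and i_mult: "\<iota> (c * d) = \<iota> c * \<iota> d"
    and i_central: "\<iota> c * b = b * \<iota> c"
    and rel: "Y * X - X * Y = (\<Sum>i\<le>degree h. \<iota> (coeff h i) * X ^ i)"
begin

definition evx :: "'a poly \<Rightarrow> 'b" where
  "evx f = (\<Sum>i\<le>degree f. \<iota> (coeff f i) * X ^ i)"

definition ev :: "'a poly poly \<Rightarrow> 'b" where
  "ev Q = (\<Sum>i\<le>degree Q. evx (coeff Q i) * Y ^ i)"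

definition \<delta> :: "'a poly \<Rightarrow> 'a poly" where
  "\<delta> f = h * pderiv f"

sublocale ore_deriv \<delta>
  by standard (simp_all add: \<delta>_def pderiv_add pderiv_mult algebra_simps)

lemma i_0 [simp]: "\<iota> 0 = 0"
  using i_add[of 0 0] by simp

lemma evx_eq: "degree f \<le> n \<Longrightarrow> evx f = (\<Sum>i\<le>n. \<iota> (coeff f i) * X ^ i)"
  unfolding evx_def by (intro sum.mono_neutral_left) (auto simp: coeff_eq_0)

lemma evx_0 [simp]: "evx 0 = 0"
  by (simp add: evx_def)

lemma evx_pCons: "evx (pCons a f) = \<iota> a + X * evx f"
proof -
  have "evx (pCons a f) = (\<Sum>i\<le>Suc (degree f). \<iota> (coeff (pCons a f) i) * X ^ i)"
    by (rule evx_eq) (rule degree_pCons_le)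
  also have "\<dots> = \<iota> a + (\<Sum>i\<le>degree f. \<iota> (coeff f i) * X * X ^ i)"
    by (subst sum.atMost_Suc_shift) (simp add: mult.assoc)
  also have "(\<Sum>i\<le>degree f. \<iota> (coeff f i) * X * X ^ i) = X * evx f"
    by (simp add: evx_def i_central sum_distrib_left mult.assoc)
  finally show ?thesis .
qed

lemma evx_const: "evx [:c:] = \<iota> c"
  by (simp add: evx_pCons)

lemma evx_add: "evx (f + g) = evx f + evx g"
proof -
  define n where "n = max (degree f) (degree g)"
  have "degree (f + g) \<le> n" "degree f \<le> n" "degree g \<le> n"
    by (auto simp: n_def degree_add_le)
  then show ?thesis
    by (simp add: evx_eq[where n = n] i_add distrib_right sum.distrib)
qed

lemma evx_smult: "evx (smult c f) = \<iota> c * evx f"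
proof (induction f)
  case (pCons a f)
  have "\<iota> c * (X * evx f) = X * (\<iota> c * evx f)"
    by (metis i_central mult.assoc)
  with pCons show ?case
    by (simp add: evx_pCons i_mult distrib_left)
qed simp

lemma evx_mult: "evx (f * g) = evx f * evx g"
  by (induction f) (simp_all add: evx_add evx_smult evx_pCons distrib_right mult.assoc)

lemma evx_h: "Y * X = X * Y + evx h"
  using rel unfolding evx_def by (metis add.commute diff_add_cancel)

lemma Y_evx: "Y * evx f = evx f * Y + evx (\<delta> f)"
proof (induction f)
  case (pCons a f)
  have "\<delta> (pCons a f) = h * f + pCons 0 (\<delta> f)"
    by (simp add: \<delta>_def pderiv_pCons distrib_left)
  then have "evx (\<delta> (pCons a f)) = evx h * evx f + X * evx (\<delta> f)"
    by (simp add: evx_add evx_mult evx_pCons)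
  moreover have "Y * evx (pCons a f) = \<iota> a * Y + (Y * X) * evx f"
    by (simp add: evx_pCons distrib_left i_central mult.assoc)
  ultimately show ?case
    by (simp add: evx_h pCons evx_pCons distrib_left distrib_right mult.assoc)
qed simp

lemma ev_eq: "degree Q \<le> n \<Longrightarrow> ev Q = (\<Sum>i\<le>n. evx (coeff Q i) * Y ^ i)"
  unfolding ev_def by (intro sum.mono_neutral_left) (auto simp: coeff_eq_0)

lemma ev_0 [simp]: "ev 0 = 0"
  by (simp add: ev_def)

lemma ev_pCons: "ev (pCons f Q) = evx f + ev Q * Y"
proof -
  have "ev (pCons f Q) = (\<Sum>i\<le>Suc (degree Q). evx (coeff (pCons f Q) i) * Y ^ i)"
    by (rule ev_eq) (rule degree_pCons_le)
  also have "\<dots> = evx f + (\<Sum>i\<le>degree Q. evx (coeff Q i) * Y ^ i * Y)"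
    by (subst sum.atMost_Suc_shift) (simp add: mult.assoc power_commutes)
  finally show ?thesis
    by (simp add: ev_def sum_distrib_right)
qed

lemma ev_add: "ev (P + Q) = ev P + ev Q"
proof -
  define n where "n = max (degree P) (degree Q)"
  have "degree (P + Q) \<le> n" "degree P \<le> n" "degree Q \<le> n"
    by (auto simp: n_def degree_add_le)
  then show ?thesis
    by (simp add: ev_eq[where n = n] evx_add distrib_right sum.distrib)
qed

lemma ev_smult: "ev (smult f Q) = evx f * ev Q"
  by (induction Q) (simp_all add: ev_pCons evx_mult distrib_left mult.assoc)

lemma ev_shift: "ev (ore_shift \<delta> Q) = Y * ev Q"
  by (induction Q)
    (simp_all add: shift_pCons ev_pCons ev_add Y_evx distrib_left distrib_right mult.assoc)

lemma ev_mult: "ev (ore_mult \<delta> P Q) = ev P * ev Q"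
  by (induction P arbitrary: Q)
    (simp_all add: ev_add ev_smult ev_pCons ev_shift distrib_right mult.assoc)

lemma ev_X: "ev [:[:0, 1:]:] = X"
  by (simp add: ev_pCons evx_pCons i_1)

lemma ev_Y: "ev [:0, 1:] = Y"
  by (simp add: ev_pCons evx_pCons i_1 one_pCons)

lemma ev_const: "ev [:[:c:]:] = \<iota> c"
  by (simp add: ev_pCons evx_pCons)

end

lemma pol_add: "pol (f + g) = pol f + pol g"
  by (simp add: pol_def cf_add)

lemma pol_mult: "pol (f * g) = pol f * pol g"
  by (simp add: pol_def cf_mult)

lemma pol_eq: "pol f = (\<Sum>i\<le>degree f. scal (coeff f i) * xx ^ i)"
proof -
  have x: "xx ^ i = pol (monom 1 i)" for i
    by (induction i) (simp_all add: pol_1 xx_def monom_Suc flip: pol_mult)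
  have "scal (coeff f i) * xx ^ i = pol (monom (coeff f i) i)" for i
    by (simp add: x scal_def smult_monom flip: pol_mult)
  moreover have "(\<Sum>i\<in>A. pol (g i)) = pol (\<Sum>i\<in>A. g i)" for A and g :: "nat \<Rightarrow> 'a poly"
    by (induction A rule: infinite_finite_induct)
      (simp_all add: pol_add, simp_all add: pol_def cf_def zero_rat_weyl.abs_eq)
  ultimately show ?thesis
    by (simp add: poly_as_sum_of_monoms)
qed

interpretation Wh: weyl_rel scal xx "yhat h" h for h :: "'a::field poly"
proof
  fix c d :: 'a and b :: "'a rat_weyl"
  show "scal 1 = 1"
    by (simp add: scal_def pol_1 flip: one_pCons)
  show "scal (c + d) = scal c + scal d"
    by (simp add: scal_def flip: pol_add)
  have "[:c * d:] = [:c:] * [:d:]"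
    by simp
  then show "scal (c * d) = scal c * scal d"
    by (simp only: scal_def pol_mult)
  show "scal c * b = b * scal c"
  proof (cases b)
    case (abs_rw P)
    have "ore_mult fract_deriv P [:to_fract [:c:]:] = smult (to_fract [:c:]) P"
      using frac.mult_smult_right[of "to_fract [:c:]" P 1] by (simp add: pderiv_pCons)
    then show ?thesis
      by (simp add: abs_rw scal_def pol_def cf_def times_rat_weyl.abs_eq)
  qed
  have "xx * pol h = pol h * xx" for h :: "'a poly"
    by (simp add: xx_def mult.commute flip: pol_mult)
  then have "yhat h * xx - xx * yhat h = (yy * xx - xx * yy) * pol h"
    by (simp add: yhat_def left_diff_distrib mult.assoc)
  then show "yhat h * xx - xx * yhat h = (\<Sum>i\<le>degree h. scal (coeff h i) * xx ^ i)"
    by (simp add: weyl_relation pol_eq)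
qed

lemma Wh_evx: "Wh.evx f = pol f"
  by (simp add: Wh.evx_def pol_eq)

lemma (in ore_deriv) coeff_mult_top:
  assumes "degree P \<le> m" "degree R \<le> k"
  shows "degree (ore_mult \<delta> P R) \<le> m + k \<and> coeff (ore_mult \<delta> P R) (m + k) = coeff P m * coeff R k"
  using assms
proof (induction P arbitrary: R m k)
  case (pCons f P)
  show ?case
  proof (cases m)
    case 0
    with pCons have "P = 0"
      by (auto split: if_splits)
    with 0 pCons show ?thesis
      by (auto intro: order_trans[OF degree_smult_le])
  next
    case (Suc m')
    have d: "degree (ore_shift \<delta> R) \<le> Suc k"
      unfolding ore_shift_def using pCons.prems(2)
      by (intro degree_add_le order_trans[OF degree_pCons_le] order_trans[OF map_poly_degree_leq]) auto
    have c: "coeff (ore_shift \<delta> R) (Suc k) = coeff R k"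
      using pCons.prems(2) by (simp add: ore_shift_def coeff_map_poly coeff_eq_0)
    have "degree P \<le> m'"
      using pCons.prems(1) Suc by (auto split: if_splits)
    note IH = pCons.IH[OF this d]
    have "degree (smult f R) \<le> m + k"
      using pCons.prems(2) by (intro order_trans[OF degree_smult_le]) auto
    with IH c show ?thesis
      using pCons.prems(2) by (auto simp: Suc coeff_eq_0 intro!: degree_add_le)
  qed
qed simp

lemma Wh_ev_top:
  "degree (rep_rw (Wh.ev h Q)) \<le> degree Q \<and>
   coeff (rep_rw (Wh.ev h Q)) (degree Q) = to_fract (lead_coeff Q * h ^ degree Q)"
proof (induction Q)
  case (pCons f Q)
  have yh: "rep_rw (yhat h) = [:to_fract (pderiv h), to_fract h:]"
    by (simp add: yhat_def yy_def pol_def cf_def times_rat_weyl.abs_eq abs_rw_inverse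
        ore_shift_def map_poly_pCons)
  have pf: "rep_rw (pol f) = [:to_fract f:]"
    by (simp add: pol_def cf_def abs_rw_inverse)
  have eq: "rep_rw (Wh.ev h (pCons f Q))
      = [:to_fract f:] + ore_mult fract_deriv (rep_rw (Wh.ev h Q)) (rep_rw (yhat h))"
    by (simp add: Wh.ev_pCons Wh_evx plus_rat_weyl.rep_eq times_rat_weyl.rep_eq pf)
  show ?case
  proof (cases "Q = 0")
    case True
    then have "Wh.ev h (pCons f Q) = pol f"
      by (simp add: Wh.ev_pCons Wh_evx)
    with True show ?thesis
      by (simp add: pf)
  next
    case False
    have "degree (rep_rw (yhat h)) \<le> 1"
      by (simp add: yh)
    note top = frac.coeff_mult_top[OF conjunct1[OF pCons.IH] this]
    with False pCons.IH show ?thesis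
      by (auto simp: eq yh intro!: degree_add_le)
  qed
qed (simp add: zero_rat_weyl.rep_eq)

lemma Wh_ev_inj:
  assumes "h \<noteq> 0" "Wh.ev h P = Wh.ev h Q"
  shows "P = Q"
proof -
  have "Wh.ev h (P - Q) + Wh.ev h Q = Wh.ev h P"
    by (simp flip: Wh.ev_add)
  with assms(2) have "Wh.ev h (P - Q) = 0"
    by simp
  with Wh_ev_top[of h "P - Q"] have "to_fract (lead_coeff (P - Q) * h ^ degree (P - Q)) = 0"
    by (simp only: zero_rat_weyl.rep_eq coeff_0)
  with assms(1) have "lead_coeff (P - Q) = 0"
    by (simp only: to_fract_eq_0_iff mult_eq_0_iff power_eq_0_iff) blast
  then have "P - Q = 0"
    by (simp only: leading_coeff_0_iff)
  then show ?thesis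
    by simp
qed

lemma Weyl_eq_range: "Weyl h = range (Wh.ev h)"
proof (intro equalityI subsetI)
  fix a assume "a \<in> Weyl h"
  then show "a \<in> range (Wh.ev h)"
    unfolding Weyl_def
  proof induction
    case (gen a)
    then show ?case
      using Wh.ev_X[of h] Wh.ev_Y[of h] by (metis insertE rangeI singletonD)
  next
    case (scal c)
    then show ?case
      by (metis Wh.ev_const rangeI)
  next
    case (add a b)
    then show ?case
      by (auto simp flip: Wh.ev_add)
  next
    case (mult a b)
    then show ?case
      by (auto simp flip: Wh.ev_mult)
  qed
next
  fix a assume "a \<in> range (Wh.ev h)"
  then obtain Q where Q: "a = Wh.ev h Q"
    by blast
  have 0: "0 \<in> subalg S" for S :: "'a rat_weyl set"
    using subalg.scal[of 0 S] by simp
  have "pol f \<in> subalg {xx, yhat h}" for f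
    unfolding Wh_evx[of f, symmetric]
    by (induction f) (auto simp: Wh.evx_pCons 0 intro: subalg.intros)
  then show "a \<in> Weyl h"
    unfolding Q Weyl_def
    by (induction Q) (auto simp: Wh.ev_pCons Wh_evx 0 intro: subalg.intros)
qed

theorem Weyl_universal:
  fixes \<iota> :: "'a::field \<Rightarrow> 'b::ring_1"
  assumes h: "h \<noteq> 0"
    and i: "\<iota> 1 = 1" "\<And>c d. \<iota> (c + d) = \<iota> c + \<iota> d" "\<And>c d. \<iota> (c * d) = \<iota> c * \<iota> d"
      "\<And>c b. \<iota> c * b = b * \<iota> c"
    and rel: "Y * X - X * Y = (\<Sum>i\<le>degree h. \<iota> (coeff h i) * X ^ i)"
  defines "hom \<equiv> \<lambda>\<phi>. (\<forall>c. \<phi> (scal c) = \<iota> c)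
      \<and> (\<forall>a\<in>Weyl h. \<forall>b\<in>Weyl h. \<phi> (a + b) = \<phi> a + \<phi> b \<and> \<phi> (a * b) = \<phi> a * \<phi> b)
      \<and> \<phi> xx = X \<and> \<phi> (yhat h) = Y"
  shows "\<exists>\<phi>. hom \<phi>"
    and "hom \<phi> \<Longrightarrow> hom \<psi> \<Longrightarrow> a \<in> Weyl h \<Longrightarrow> \<phi> a = \<psi> a"
proof -
  interpret T: weyl_rel \<iota> X Y h
    by standard (use i rel in blast)+
  define \<phi> where "\<phi> a = T.ev (inv (Wh.ev h) a)" for a
  have "inj (Wh.ev h)"
    by (intro injI) (rule Wh_ev_inj[OF h])
  then have \<phi>: "\<phi> (Wh.ev h Q) = T.ev Q" for Q
    by (simp add: \<phi>_def)
  have "\<phi> (scal c) = \<iota> c" for c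
    using \<phi>[of "[:[:c:]:]"] by (simp add: Wh.ev_const T.ev_const)
  moreover have "\<phi> xx = X" "\<phi> (yhat h) = Y"
    using \<phi>[of "[:[:0, 1:]:]"] \<phi>[of "[:0, 1:]"] by (simp_all add: Wh.ev_X T.ev_X Wh.ev_Y T.ev_Y)
  moreover have "\<phi> (a + b) = \<phi> a + \<phi> b \<and> \<phi> (a * b) = \<phi> a * \<phi> b"
    if ab: "a \<in> Weyl h" "b \<in> Weyl h" for a b
  proof -
    obtain P Q where PQ: "a = Wh.ev h P" "b = Wh.ev h Q"
      using ab unfolding Weyl_eq_range by blast
    have "\<phi> (a + b) = T.ev (P + Q)" "\<phi> (a * b) = T.ev (ore_mult T.\<delta> P Q)"
      unfolding PQ by (simp_all only: \<phi> flip: Wh.ev_add Wh.ev_mult)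
    then show ?thesis
      by (simp add: T.ev_add T.ev_mult PQ \<phi>)
  qed
  ultimately show "\<exists>\<phi>. hom \<phi>"
    unfolding hom_def by blast
next
  assume \<phi>: "hom \<phi>" and \<psi>: "hom \<psi>" and "a \<in> Weyl h"
  from \<open>a \<in> Weyl h\<close> show "\<phi> a = \<psi> a"
    unfolding Weyl_def
  proof induction
    case (gen a)
    with \<phi> \<psi> show ?case
      unfolding hom_def by auto
  next
    case (scal c)
    with \<phi> \<psi> show ?case
      unfolding hom_def by auto
  next
    case (add a b)
    with \<phi> \<psi> show ?case
      unfolding hom_def Weyl_def by simp
  next
    case (mult a b)
    with \<phi> \<psi> show ?case
      unfolding hom_def Weyl_def by simp
  qed
qed

section \<open>Derivations and the first Hochschild cohomology\<close>

text \<open>Maps on a subalgebra \<open>A\<close> are represented by functions on the ambient algebra vanishing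
  outside \<open>A\<close>, so that equality of derivations of \<open>A\<close> is equality of functions.\<close>

definition Der :: "'a::field rat_weyl set \<Rightarrow> ('a rat_weyl \<Rightarrow> 'a rat_weyl) set" where
  "Der A = {D. (\<forall>a\<in>A. D a \<in> A) \<and> (\<forall>a. a \<notin> A \<longrightarrow> D a = 0)
     \<and> (\<forall>a\<in>A. \<forall>b\<in>A. D (a + b) = D a + D b)
     \<and> (\<forall>c. \<forall>a\<in>A. D (scal c * a) = scal c * D a)
     \<and> (\<forall>a\<in>A. \<forall>b\<in>A. D (a * b) = D a * b + a * D b)}"

definition lie :: "('a::field rat_weyl \<Rightarrow> 'a rat_weyl) \<Rightarrow> ('a rat_weyl \<Rightarrow> 'a rat_weyl) \<Rightarrow> 'a rat_weyl \<Rightarrow> 'a rat_weyl" where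
  "lie D E = (\<lambda>a. D (E a) - E (D a))"

definition ad :: "'a::field rat_weyl set \<Rightarrow> 'a rat_weyl \<Rightarrow> 'a rat_weyl \<Rightarrow> 'a rat_weyl" where
  "ad A u = (\<lambda>a. if a \<in> A then u * a - a * u else 0)"

definition Inder :: "'a::field rat_weyl set \<Rightarrow> ('a rat_weyl \<Rightarrow> 'a rat_weyl) set" where
  "Inder A = ad A ` A"

text \<open>Equality in $\mathsf{HH}^1(A)$: both maps are derivations of \<open>A\<close> and have the same coset
  modulo the inner derivations.\<close>

definition HH1_class :: "'a::field rat_weyl set \<Rightarrow> ('a rat_weyl \<Rightarrow> 'a rat_weyl) \<Rightarrow> ('a rat_weyl \<Rightarrow> 'a rat_weyl) set" where
  "HH1_class A D = {D + I | I. I \<in> Inder A}"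

definition HH1_eq :: "'a::field rat_weyl set \<Rightarrow> ('a rat_weyl \<Rightarrow> 'a rat_weyl) \<Rightarrow> ('a rat_weyl \<Rightarrow> 'a rat_weyl) \<Rightarrow> bool" where
  "HH1_eq A D E \<longleftrightarrow> D \<in> Der A \<and> E \<in> Der A \<and> HH1_class A D = HH1_class A E"

text \<open>\<open>lmul u D\<close> is the product $u D$ for central \<open>u\<close>.\<close>

definition lmul :: "'a::field rat_weyl \<Rightarrow> ('a rat_weyl \<Rightarrow> 'a rat_weyl) \<Rightarrow> 'a rat_weyl \<Rightarrow> 'a rat_weyl" where
  "lmul u D = (\<lambda>a. u * D a)"

definition centralizer_x :: "'a::field poly \<Rightarrow> 'a rat_weyl set" where
  "centralizer_x h = {a \<in> Weyl h. a * xx = xx * a}"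

definition normalizer :: "'a::field poly \<Rightarrow> 'a rat_weyl set" where
  "normalizer h = {u \<in> Weyl1. \<forall>a\<in>Weyl h. u * a - a * u \<in> Weyl h}"

section \<open>The specific polynomials, elements and derivations\<close>

definition pi_poly :: "'a::field poly \<Rightarrow> 'a poly" where
  "pi_poly h = (THE q. lead_coeff q = 1 \<and> (\<forall>r. h dvd pderiv h * r \<longleftrightarrow> q dvd r))"

text \<open>\<open>xp_polys\<close> is the subring $\mathbb F[x^p]$.\<close>

definition xp_polys :: "'a::field poly set" where
  "xp_polys = range (\<lambda>q. pcompose q (monom 1 CHAR('a)))"

definition rho_poly :: "'a::field poly \<Rightarrow> 'a poly" where
  "rho_poly h = (THE q. lead_coeff q = 1 \<and> q \<in> xp_polys \<and> q dvd h
     \<and> (\<forall>q'\<in>xp_polys. q' dvd h \<longrightarrow> degree q' \<le> degree q))"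

definition delta0 :: "'a::field poly \<Rightarrow> 'a poly \<Rightarrow> 'a poly" where
  "delta0 h r = (THE s. to_fract s
     = fract_deriv (to_fract r * to_fract (pi_poly h) * inverse (to_fract h)) * to_fract h)"

definition z_elt :: "'a::field poly \<Rightarrow> 'a rat_weyl" where
  "z_elt h = pol (h ^ CHAR('a)) * yy ^ CHAR('a)"

text \<open>The index is an integer because \<open>a\<^sub>n\<close> also occurs with \<open>n = -1\<close>.\<close>

definition a_elt :: "'a::field poly \<Rightarrow> int \<Rightarrow> 'a rat_weyl" where
  "a_elt h n = (if n < 0 then 0
     else cf (to_fract (pi_poly h) * to_fract h powi (n - 1)) * yy ^ nat n)"

definition D_der :: "'a::field poly \<Rightarrow> 'a rat_weyl \<Rightarrow> 'a rat_weyl \<Rightarrow> 'a rat_weyl" where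
  "D_der h e = (THE D. D \<in> Der (Weyl h) \<and> D xx = 0 \<and> D (yhat h) = e)"

definition E_x :: "'a::field rat_weyl \<Rightarrow> 'a rat_weyl" where
  "E_x = (THE E. E \<in> Der Weyl1 \<and> E xx = yy ^ (CHAR('a) - 1) \<and> E yy = 0)"

definition E_breve :: "'a::field poly \<Rightarrow> 'a rat_weyl \<Rightarrow> 'a rat_weyl" where
  "E_breve h = (\<lambda>a. if a \<in> Weyl h
     then cf (to_fract (h ^ CHAR('a)) / to_fract (rho_poly h)) * E_x a else 0)"

end

theory Submission
  imports Defs
begin

text \<open>
  Write \<open>\<eta>\<close> for the generator $\hat y$ of \<open>A\<^sub>h\<close>. Put \<open>gam = h / \<pi>\<^sub>h\<close>, which is \<open>gcd(h, h')\<close> up to a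
  unit, and \<open>w = 1 / gam = a\<^sub>0\<close>. Two observations reduce most of the statement to the power rule of
  commutative algebra. First, \<open>a\<^sub>n = w h\<^sup>n y\<^sup>n\<close> with \<open>h\<^sup>n y\<^sup>n \<in> A\<^sub>h\<close>, so that every \<open>r a\<^sub>n\<close> lies in
  \<open>w A\<^sub>h\<close>. Secondly, \<open>J = gam A\<^sub>h\<close> is a two-sided ideal with commutative quotient (lemma
  \<open>commutator_in_J\<close>), because \<open>[\<eta>, x] = h\<close> is a multiple of \<open>gam\<close>; moreover \<open>w J = A\<^sub>h\<close>. Hence \<open>w A\<^sub>h\<close>
  normalizes \<open>A\<^sub>h\<close>, and two elements \<open>w a\<close> and \<open>w b\<close> give the same class in cohomology as soon as
  \<open>a \<approx> b\<close> modulo \<open>J\<close>. Since \<open>gam\<close> divides \<open>h'\<close>, also \<open>h\<^sup>n y\<^sup>n \<approx> \<eta>\<^sup>n\<close>, and any derivation \<open>D\<close> of \<open>A\<^sub>h\<close>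
  satisfies \<open>D(\<eta>\<^sup>n) \<approx> n D(\<eta>) \<eta>\<^sup>n\<^sup>-\<^sup>1\<close> (lemma \<open>Der_power_eqJ\<close>).

  Part (a) is checked on the generators. For (b), \<open>D\<^sub>g\<close> annihilates \<open>w\<close>, so the bracket with
  the adjoint map of \<open>w a\<close> is the adjoint map of \<open>w D\<^sub>g(a)\<close>, and the power rule applies with
  \<open>D\<^sub>g(\<eta>) = g\<close>. For (c), it applies to the commutator with \<open>r w\<close>, which maps \<open>\<eta>\<close> to \<open>-\<delta>\<^sub>0(r)\<close>.
  Reducing \<open>q\<close> modulo \<open>gam\<close> changes \<open>q h\<^sup>n y\<^sup>n\<close> by an element of \<open>J\<close>.

  For (d), \<open>E\<^sub>x\<close> on polynomials is computed explicitly (lemma \<open>E_pol\<close>): its leading term is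
  \<open>f' y\<^sup>p\<^sup>-\<^sup>1\<close>, followed by terms with higher derivatives of \<open>f\<close> and a polynomial in \<open>x\<close>. With
  \<open>f = r \<pi>\<^sub>h h\<^sup>n\<^sup>-\<^sup>1\<close>, the leading term of the image of \<open>r a\<^sub>n = f y\<^sup>n\<close> is exactly the asserted element.
  The other terms lie in \<open>A\<^sub>h\<close>: from the second derivative onwards a factor \<open>\<rho>\<^sub>h\<close> is gained (lemma
  \<open>dvd_pderiv_gain\<close>), which cancels the denominator of \<open>h\<^sup>p / \<rho>\<^sub>h\<close>, and for the last term it suffices
  that \<open>h\<^sup>p / \<rho>\<^sub>h\<close> is a multiple of \<open>h\<^sup>p\<^sup>-\<^sup>1\<close>. The powers of \<open>z\<^sub>h\<close> can be pulled out of the bracket up to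
  inner derivations: \<open>E\<^sub>x(h\<^sup>p)\<close> is a multiple of \<open>(h')\<^sup>p\<close>, and this puts the product of \<open>w\<close> with
  the image of \<open>z\<^sub>h\<close> into \<open>A\<^sub>h\<close> (lemma \<open>Eb_z\<close>). For \<open>n = 0\<close>, the adjoint map of \<open>r a\<^sub>0\<close> is the negative
  of \<open>D\<^sub>e\<close> with \<open>e = \<delta>\<^sub>0(r)\<close>.

  For (e), the bracket and the adjoint map of \<open>b\<close> are derivations of \<open>A\<^sub>h\<close> that agree at \<open>x\<close>: the value
  of the bracket is given by a Leibniz formula for \<open>D\<^sub>g(h\<^sup>p\<^sup>-\<^sup>1 y\<^sup>p\<^sup>-\<^sup>1)\<close>, whose binomial coefficients
  \<open>(p-1 choose j)\<close> are \<open>(-1)\<^sup>j\<close> in characteristic \<open>p\<close>. A derivation that annihilates \<open>x\<close> is a \<open>D\<^sub>e\<close>.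
\<close>

section \<open>The polynomials $\pi_h$ and $\varrho_h$\<close>

text \<open>Division with remainder by an element of least degree. The ideal \<open>I\<close> is used below for the annihilator
  condition defining $\pi_h$ and for a Bezout identity behind the uniqueness of $\varrho_h$.\<close>
lemma poly_ideal_principal:
  fixes I :: "'a::field poly set"
  assumes ex: "a \<in> I" "a \<noteq> 0"
    and diff: "\<And>u v. u \<in> I \<Longrightarrow> v \<in> I \<Longrightarrow> u - v \<in> I"
    and mult: "\<And>u v. v \<in> I \<Longrightarrow> u * v \<in> I"
  shows "\<exists>q\<in>I. lead_coeff q = 1 \<and> (\<forall>r\<in>I. q dvd r)"
proof -
  obtain b where b: "b \<in> I" "b \<noteq> 0" and min: "\<And>c. c \<in> I \<Longrightarrow> c \<noteq> 0 \<Longrightarrow> degree b \<le> degree c"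
    using ex_has_least_nat[of "\<lambda>b. b \<in> I \<and> b \<noteq> 0" a degree] ex by blast
  have dvd: "b dvd r" if r: "r \<in> I" for r
  proof -
    have "r - r div b * b \<in> I"
      using r b by (intro diff mult)
    then have "r mod b \<in> I"
      by (simp add: minus_div_mult_eq_mod)
    moreover have "degree (r mod b) < degree b" if "r mod b \<noteq> 0"
      using that b(2) degree_mod_less by blast
    ultimately have "r mod b = 0"
      using min by (meson not_less)
    then show ?thesis
      by (simp add: dvd_eq_mod_eq_0)
  qed
  let ?q = "[:inverse (lead_coeff b):] * b"
  have "?q \<in> I"
    using b(1) by (rule mult)
  moreover have "lead_coeff ?q = 1"
    using b(2) by simp
  moreover have "?q dvd r" if "r \<in> I" for r
    using dvd[OF that] b(2) by (simp add: smult_dvd_iff)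
  ultimately show ?thesis
    by blast
qed

lemma monic_dvd_antisym:
  fixes q s :: "'a::field poly"
  assumes "q dvd s" "s dvd q" "lead_coeff q = 1" "lead_coeff s = 1"
  shows "q = s"
proof -
  obtain u where u: "s = q * u"
    using assms(1) by blast
  have "q \<noteq> 0" "s \<noteq> 0"
    using assms by auto
  then have "degree s = degree q"
    using assms by (metis dvd_imp_degree_le le_antisym)
  then have "degree u = 0"
    using u \<open>q \<noteq> 0\<close> \<open>s \<noteq> 0\<close> by (auto simp: degree_mult_eq)
  then obtain c where "u = [:c:]"
    by (rule degree_eq_zeroE)
  then show ?thesis
    using assms(3,4) u by (cases "c = 0") auto
qed

text \<open>The polynomials \<open>r\<close> with \<open>h dvd pderiv h * r\<close> form an ideal containing \<open>h\<close>, and \<open>pi_poly h\<close> is its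
  monic generator.\<close>
lemma pi_poly_spec:
  fixes h :: "'a::field poly"
  assumes "h \<noteq> 0"
  shows "lead_coeff (pi_poly h) = 1" "h dvd pderiv h * r \<longleftrightarrow> pi_poly h dvd r"
proof -
  let ?P = "\<lambda>q. lead_coeff q = 1 \<and> (\<forall>r. h dvd pderiv h * r \<longleftrightarrow> q dvd r)"
  obtain q where q: "h dvd pderiv h * q" "lead_coeff q = 1"
      "\<And>r. h dvd pderiv h * r \<Longrightarrow> q dvd r"
    using poly_ideal_principal[of h "{r. h dvd pderiv h * r}"] assms
    by (auto simp: right_diff_distrib mult.left_commute)
  have "h dvd pderiv h * r" if "q dvd r" for r
    using dvd_trans[OF q(1) mult_dvd_mono[OF dvd_refl that]] .
  then have "(h dvd pderiv h * r) = (q dvd r)" for r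
    using q(3) by (rule iffI[rotated])
  then have P: "?P q"
    using q(2) by (simp only: simp_thms)
  have uniq: "s = q" if s: "?P s" for s
  proof -
    have "s dvd q"
      using conjunct2[OF s, THEN spec, of q] q(1) by (rule iffD1)
    moreover have "h dvd pderiv h * s"
      using conjunct2[OF s, THEN spec, of s] dvd_refl by (rule iffD2)
    ultimately show ?thesis
      using q(2,3) s by (intro monic_dvd_antisym) simp_all
  qed
  have "?P (pi_poly h)"
    unfolding pi_poly_def by (rule theI[of ?P q, OF P uniq])
  then show "lead_coeff (pi_poly h) = 1" "h dvd pderiv h * r \<longleftrightarrow> pi_poly h dvd r"
    by blast+
qed

lemma xp_polys_pderiv:
  assumes "q \<in> (xp_polys :: 'a::field poly set)"
  shows "pderiv q = 0"
proof -
  have "pderiv (monom (1::'a) CHAR('a)) = 0"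
    by (simp add: pderiv_monom)
  with assms show ?thesis
    by (auto simp: xp_polys_def pderiv_pcompose)
qed

text \<open>Existence is clear, since degrees of divisors of \<open>h\<close> are bounded. For uniqueness, a Bezout identity in
  $\mathbb F[x]$ is transported along $x \mapsto x^p$: the least common multiple, formed in
  $\mathbb F[x^p]$, of two maximal divisors divides \<open>h\<close> as well, so it has no larger degree and
  the two divisors are associated.\<close>
lemma rho_poly_spec:
  fixes h :: "'a::field poly"
  assumes "CHAR('a) > 0" "h \<noteq> 0"
  shows "rho_poly h \<in> xp_polys" "rho_poly h dvd h" "rho_poly h \<noteq> 0"
proof -
  let ?X = "monom (1::'a) CHAR('a)"
  let ?S = "xp_polys :: 'a poly set"
  let ?P = "\<lambda>q. lead_coeff q = 1 \<and> q \<in> ?S \<and> q dvd h \<and> (\<forall>q'\<in>?S. q' dvd h \<longrightarrow> degree q' \<le> degree q)"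
  have X: "degree ?X = CHAR('a)"
    by (simp add: degree_monom_eq)
  have "1 \<in> ?S"
    unfolding xp_polys_def by (metis pcompose_1 rangeI)
  obtain q0 where q0: "q0 \<in> ?S" "q0 dvd h" and max: "\<And>q'. q' \<in> ?S \<Longrightarrow> q' dvd h \<Longrightarrow> degree q' \<le> degree q0"
    using ex_has_greatest_nat[of "\<lambda>q. q \<in> ?S \<and> q dvd h" 1 degree "Suc (degree h)"] \<open>1 \<in> ?S\<close> assms(2)
    by (auto intro: dvd_imp_degree_le le_imp_less_Suc)
  then have "q0 \<noteq> 0"
    using assms(2) by auto
  define q where "q = smult (inverse (lead_coeff q0)) q0"
  have "q \<in> ?S"
    using q0(1) unfolding q_def xp_polys_def by (auto simp flip: pcompose_smult)
  then have P: "?P q"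
    using q0 max \<open>q0 \<noteq> 0\<close> by (auto simp: q_def smult_dvd_iff)
  have uniq: "s = q" if s: "?P s" for s
  proof -
    obtain a b where a: "q = pcompose a ?X" and b: "s = pcompose b ?X"
      using \<open>q \<in> ?S\<close> s unfolding xp_polys_def by auto
    have "q \<noteq> 0" "s \<noteq> 0"
      using P s by auto
    then have "a \<noteq> 0" "b \<noteq> 0"
      using a b by auto
    let ?I = "{u * a + v * b | u v. True}"
    have Ia: "a \<in> ?I" and Ib: "b \<in> ?I"
      using mult_1[of a] mult_1[of b] by (metis (mono_tags, lifting) add_0_left add_0_right mem_Collect_eq mult_zero_left)+
    have "\<exists>g\<in>?I. lead_coeff g = 1 \<and> (\<forall>r\<in>?I. g dvd r)"
    proof (rule poly_ideal_principal[OF Ia \<open>a \<noteq> 0\<close>])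
      fix x y assume "x \<in> ?I" "y \<in> ?I"
      then obtain u v u' v' where "x = u * a + v * b" "y = u' * a + v' * b"
        by blast
      then have "x - y = (u - u') * a + (v - v') * b"
        by (simp add: algebra_simps)
      then show "x - y \<in> ?I"
        by blast
    next
      fix x y assume "y \<in> ?I"
      then obtain u v where "y = u * a + v * b"
        by blast
      then have "x * y = (x * u) * a + (x * v) * b"
        by (simp add: algebra_simps)
      then show "x * y \<in> ?I"
        by blast
    qed
    then obtain g where "g \<in> ?I" "lead_coeff g = 1" and gr: "\<forall>r\<in>?I. g dvd r"
      by blast
    from \<open>g \<in> ?I\<close> obtain u v where "g = u * a + v * b"
      by blast
    moreover have "g \<noteq> 0"
      using \<open>lead_coeff g = 1\<close> by auto
    ultimately have g: "g = u * a + v * b" "g dvd a" "g dvd b" "g \<noteq> 0"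
      using gr Ia Ib by blast+
    then obtain a' b' where ab: "a = g * a'" "b = g * b'"
      unfolding dvd_def by blast
    have "g * (u * a' + v * b') = g * 1"
      using g(1) ab by (simp add: algebra_simps)
    then have one: "u * a' + v * b' = 1"
      using g(4) mult_cancel_left by blast
    let ?c = "\<lambda>t. pcompose t ?X"
    obtain h0 where h0: "h = ?c a * h0"
      using P a unfolding dvd_def by blast
    obtain h1 where h1: "h = ?c b * h1"
      using s b unfolding dvd_def by blast
    have gX: "?c g \<noteq> 0"
      using \<open>q \<noteq> 0\<close> a ab by (auto simp: pcompose_mult)
    have "?c g * (?c a' * h0) = ?c g * (?c b' * h1)"
    proof -
      have "?c g * (?c a' * h0) = h"
        using h0 ab by (simp add: pcompose_mult mult.assoc)
      also have "h = ?c g * (?c b' * h1)"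
        using h1 ab by (simp add: pcompose_mult mult.assoc)
      finally show ?thesis .
    qed
    then have eq: "?c a' * h0 = ?c b' * h1"
      using gX by simp
    \<comment> \<open>the Bezout identity for the cofactors, after substituting $x^p$\<close>
    have "?c u * ?c a' + ?c v * ?c b' = 1"
      using arg_cong[OF one, of ?c] by (simp add: pcompose_add pcompose_mult pcompose_1)
    then have "h0 = (?c u * ?c a' + ?c v * ?c b') * h0"
      by simp
    also have "\<dots> = ?c u * (?c a' * h0) + ?c v * ?c b' * h0"
      by (simp only: distrib_right mult.assoc)
    also have "\<dots> = ?c b' * (?c u * h1 + ?c v * h0)"
      unfolding eq by (simp add: algebra_simps)
    finally obtain h2 where h2: "h0 = ?c b' * h2"
      by blast
    have "?c (g * a' * b') dvd h"
      unfolding h0 h2 ab pcompose_mult by (simp only: mult.assoc) simp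
    moreover have "?c (g * a' * b') \<in> ?S"
      by (simp add: xp_polys_def)
    ultimately have "degree (?c (g * a' * b')) \<le> degree q" "degree (?c (g * a' * b')) \<le> degree s"
      using P s by blast+
    moreover have "a' \<noteq> 0" "b' \<noteq> 0"
      using ab \<open>a \<noteq> 0\<close> \<open>b \<noteq> 0\<close> by auto
    ultimately have "degree a' = 0" "degree b' = 0"
      using assms(1) g(4) by (auto simp: a b ab degree_pcompose X degree_mult_eq)
    then obtain ca cb where "a' = [:ca:]" "b' = [:cb:]" "ca \<noteq> 0" "cb \<noteq> 0"
      using \<open>a' \<noteq> 0\<close> \<open>b' \<noteq> 0\<close> by (metis degree_eq_zeroE pCons_0_0)
    then have "q dvd s" "s dvd q"
      by (simp_all add: a b ab pcompose_smult smult_dvd_iff dvd_smult_iff)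
    then show "s = q"
      using P s by (intro monic_dvd_antisym) auto
  qed
  have "?P (rho_poly h)"
    unfolding rho_poly_def by (rule theI[of ?P q, OF P uniq])
  then show "rho_poly h \<in> xp_polys" "rho_poly h dvd h" "rho_poly h \<noteq> 0"
    by auto
qed

locale weyl_poly =
  fixes h :: "'a::field poly"
  assumes h_nz: "h \<noteq> 0"
begin

text \<open>The greatest common divisor of \<open>h\<close> and its derivative, up to a unit. It is the modulus in
  the reductions \<open>c\<close> and \<open>d\<close> of the statement.\<close>
definition gam :: "'a poly" where
  "gam = h div pi_poly h"

lemma pi_dvd: "pi_poly h dvd h"
  using pi_poly_spec(2)[OF h_nz, of h] by simp

lemma gam_pi: "gam * pi_poly h = h"
  by (simp add: gam_def pi_dvd)

lemma gam_nz: "gam \<noteq> 0" and pi_nz: "pi_poly h \<noteq> 0"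
  using gam_pi h_nz by auto

lemma h_dvd_pderiv_pi: "h dvd pderiv h * pi_poly h"
  by (simp add: pi_poly_spec(2)[OF h_nz])

lemma gam_dvd_pderiv: "gam dvd pderiv h"
proof -
  have "gam * pi_poly h dvd pderiv h * pi_poly h"
    using h_dvd_pderiv_pi by (simp add: gam_pi)
  then show ?thesis
    using pi_nz by simp
qed

end

locale weyl_char_p = weyl_poly h for h :: "'a::field poly" +
  fixes p :: nat
  assumes char: "CHAR('a) = p" and p_pos: "p > 0"
begin

lemma prime_p: "prime p"
  using prime_CHAR_semidom[where ?'a = 'a] char p_pos by simp

lemma p_ge_2: "p \<ge> 2"
  using prime_p by (rule prime_ge_2_nat)

abbreviation rho :: "'a poly" where
  "rho \<equiv> rho_poly h"

lemma rho_nz: "rho \<noteq> 0" and pderiv_rho: "pderiv rho = 0" and rho_dvd: "rho dvd h"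
  using rho_poly_spec[OF _ h_nz] xp_polys_pderiv char p_pos by auto

text \<open>Write \<open>h = rho * t\<close>. As \<open>rho\<close> has derivative zero, \<open>pderiv h * t = h * pderiv t\<close>, so that $\pi_h$
  divides \<open>t\<close>; cancelling $\pi_h$ gives the claim.\<close>
lemma rho_gam: "rho dvd gam"
proof -
  obtain t where t: "h = rho * t"
    using rho_dvd by (rule dvdE)
  have "pderiv h = pderiv (rho * t)"
    using t by (rule arg_cong)
  also have "\<dots> = rho * pderiv t"
    by (simp add: pderiv_mult pderiv_rho)
  finally have "pderiv h = rho * pderiv t" .
  then have "pderiv h * t = (rho * t) * pderiv t"
    by (simp only: ac_simps)
  then have "pderiv h * t = h * pderiv t"
    by (simp only: t[symmetric])
  then have "pi_poly h dvd t"
    by (simp add: pi_poly_spec(2)[OF h_nz, symmetric])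
  then have "rho * pi_poly h dvd gam * pi_poly h"
    using gam_pi t by (metis mult_dvd_mono dvd_refl)
  then show ?thesis
    using pi_nz by simp
qed

end

section \<open>The coefficient embeddings\<close>

lemma scal_commute: "scal c * b = b * scal c"
  by (rule Wh.i_central)

lemma scal_minus_1: "scal (- 1) = - 1"
  using Wh.i_add[of "- 1" 1] by (simp add: Wh.i_1 eq_neg_iff_add_eq_0)

lemma cf_0 [simp]: "cf 0 = 0"
  using cf_add[of 0 0] by simp

lemma cf_minus: "cf (- f) = - cf f"
  using cf_add[of f "- f"] by (simp add: eq_neg_iff_add_eq_0 add.commute)

lemma cf_diff: "cf (f - g) = cf f - cf g"
  using cf_add[of f "- g"] by (simp add: cf_minus)

lemma cf_commute: "cf f * cf g = cf g * cf f"
  by (simp add: mult.commute flip: cf_mult)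

lemma pol_0 [simp]: "pol 0 = 0"
  by (simp add: pol_def)

lemma pol_minus: "pol (- f) = - pol f"
  by (simp add: pol_def cf_minus)

lemma pol_diff: "pol (f - g) = pol f - pol g"
  by (simp add: pol_def cf_diff)

lemma pol_commute: "pol f * pol g = pol g * pol f"
  by (simp add: mult.commute flip: pol_mult)

lemma pol_of_nat: "pol (of_nat n) = of_nat n"
  by (induction n) (simp_all add: pol_add pol_1)

lemma pol_power: "pol (f ^ n) = pol f ^ n"
  by (induction n) (simp_all add: pol_mult pol_1)

lemma cf_pol_commute: "cf f * pol g = pol g * cf f"
  by (simp add: pol_def cf_commute)

lemma pol_xx_commute: "pol f * xx = xx * pol f"
  by (simp add: xx_def pol_commute)

lemma cf_xx_commute: "cf f * xx = xx * cf f"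
  by (simp add: xx_def cf_pol_commute)

lemma pol_pCons: "pol (pCons c f) = scal c + xx * pol f"
proof -
  have "pCons c f = [:c:] + [:0, 1:] * f"
    by simp
  then show ?thesis
    by (simp only: pol_add pol_mult xx_def scal_def)
qed

lemma yy_pol: "yy * pol f = pol f * yy + pol (pderiv f)"
  by (simp add: pol_def yy_cf)

lemma yhat_eq: "yhat h = pol h * yy + pol (pderiv h)"
  by (simp add: yhat_def yy_pol)

lemma of_nat_commute: "of_nat n * a = a * (of_nat n :: 'b::ring_1)"
  by (metis mult_of_nat_commute)

section \<open>Subalgebras\<close>

lemma subalg_0: "0 \<in> subalg S"
  using subalg.scal[of 0 S] by simp

lemma subalg_1: "1 \<in> subalg S"
  using subalg.scal[of 1 S] by (simp add: Wh.i_1)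

lemma subalg_minus: "a \<in> subalg S \<Longrightarrow> - a \<in> subalg S"
  using subalg.mult[OF subalg.scal[of "- 1"]] by (fastforce simp: scal_minus_1)

lemma subalg_diff: "a \<in> subalg S \<Longrightarrow> b \<in> subalg S \<Longrightarrow> a - b \<in> subalg S"
  using subalg.add[OF _ subalg_minus] by fastforce

lemma subalg_power: "a \<in> subalg S \<Longrightarrow> a ^ n \<in> subalg S"
  by (induction n) (auto intro: subalg_1 subalg.mult)

lemma subalg_of_nat: "of_nat n \<in> subalg S"
  by (induction n) (auto intro: subalg_0 subalg_1 subalg.add)

lemma subalg_sum: "(\<And>i. i \<in> I \<Longrightarrow> f i \<in> subalg S) \<Longrightarrow> sum f I \<in> subalg S"
  by (induction I rule: infinite_finite_induct) (auto intro: subalg_0 subalg.add)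

lemmas subalg_closed =
  subalg_0 subalg_1 subalg_minus subalg_diff subalg_power subalg_of_nat subalg_sum
  subalg.scal subalg.add subalg.mult

lemmas Weyl_closed = subalg_closed[where S = "{xx, yhat h}" for h, folded Weyl_def]

lemma xx_in_Weyl: "xx \<in> Weyl h" and yhat_in_Weyl: "yhat h \<in> Weyl h"
  by (auto simp: Weyl_def intro: subalg.gen)

lemma pol_in_Weyl: "pol f \<in> Weyl h"
  by (induction f) (auto simp: pol_pCons intro: Weyl_closed xx_in_Weyl)

text \<open>Most facts about \<open>Weyl h\<close> below say that a set containing the generators is closed under
  the algebra operations.\<close>
lemma Weyl_induct [consumes 1, case_names xx yhat scal add mult]:
  assumes "a \<in> Weyl h" "P xx" "P (yhat h)" "\<And>c. P (scal c)"
    "\<And>a b. a \<in> Weyl h \<Longrightarrow> b \<in> Weyl h \<Longrightarrow> P a \<Longrightarrow> P b \<Longrightarrow> P (a + b)"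
    "\<And>a b. a \<in> Weyl h \<Longrightarrow> b \<in> Weyl h \<Longrightarrow> P a \<Longrightarrow> P b \<Longrightarrow> P (a * b)"
  shows "P a"
  using assms(1) unfolding Weyl_def
  by induction (use assms in \<open>auto simp: Weyl_def\<close>)

lemma yy_in_Weyl1: "yy \<in> Weyl1" and pol_in_Weyl1: "pol f \<in> Weyl1"
  using yhat_in_Weyl[of 1] pol_in_Weyl[of f 1] by (simp_all add: Weyl1_eq yhat_def pol_1)

lemmas Weyl1_closed = Weyl_closed[where h = 1, folded Weyl1_eq]

lemma Weyl_sub_Weyl1: "a \<in> Weyl h \<Longrightarrow> a \<in> Weyl1"
  by (induction rule: Weyl_induct)
    (auto simp: yhat_def intro: Weyl1_closed(8-10) yy_in_Weyl1 pol_in_Weyl1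
      xx_in_Weyl[of 1, folded Weyl1_eq])

section \<open>Derivations\<close>

context
  fixes A :: "'a::field rat_weyl set" and S
  assumes A: "A = subalg S"
begin

lemma Der_I:
  assumes "\<And>a. a \<in> A \<Longrightarrow> D a \<in> A" "\<And>a. a \<notin> A \<Longrightarrow> D a = 0"
    "\<And>a b. a \<in> A \<Longrightarrow> b \<in> A \<Longrightarrow> D (a + b) = D a + D b"
    "\<And>c a. a \<in> A \<Longrightarrow> D (scal c * a) = scal c * D a"
    "\<And>a b. a \<in> A \<Longrightarrow> b \<in> A \<Longrightarrow> D (a * b) = D a * b + a * D b"
  shows "D \<in> Der A"
  using assms by (simp add: Der_def)

lemma Der_D:
  assumes "D \<in> Der A"
  shows "a \<in> A \<Longrightarrow> D a \<in> A" "a \<notin> A \<Longrightarrow> D a = 0"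
    "a \<in> A \<Longrightarrow> b \<in> A \<Longrightarrow> D (a + b) = D a + D b"
    "a \<in> A \<Longrightarrow> D (scal c * a) = scal c * D a"
    "a \<in> A \<Longrightarrow> b \<in> A \<Longrightarrow> D (a * b) = D a * b + a * D b"
  using assms by (simp_all add: Der_def)

lemma Der_0: "D \<in> Der A \<Longrightarrow> D 0 = 0"
  using Der_D(3)[of D 0 0] by (simp add: A subalg_0)

lemma Der_1: "D \<in> Der A \<Longrightarrow> D 1 = 0"
  using Der_D(5)[of D 1 1] by (simp add: A subalg_1)

lemma Der_scal: "D \<in> Der A \<Longrightarrow> D (scal c) = 0"
  using Der_D(4)[of D 1 c] by (simp add: A subalg_1 Der_1[unfolded A])

lemma Der_minus: "D \<in> Der A \<Longrightarrow> a \<in> A \<Longrightarrow> D (- a) = - D a"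
  using Der_D(4)[of D a "- 1"] by (simp add: scal_minus_1)

lemma Der_diff: "D \<in> Der A \<Longrightarrow> a \<in> A \<Longrightarrow> b \<in> A \<Longrightarrow> D (a - b) = D a - D b"
  using Der_D(3)[of D a "- b"] by (simp add: Der_minus A subalg_minus)

lemma Der_lie:
  assumes D: "D \<in> Der A" and E: "E \<in> Der A"
  shows "lie D E \<in> Der A"
proof (rule Der_I)
  fix a b assume "a \<in> A" "b \<in> A"
  then have m: "D a \<in> A" "D b \<in> A" "E a \<in> A" "E b \<in> A" "D a * b \<in> A" "E a * b \<in> A" "a * D b \<in> A" "a * E b \<in> A"
    using D E by (auto simp: A intro: Der_D(1)[unfolded A] subalg.mult)
  show "lie D E (a * b) = lie D E a * b + a * lie D E b"
    using \<open>a \<in> A\<close> \<open>b \<in> A\<close> m D E by (simp add: lie_def Der_D algebra_simps)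
  show "lie D E (a + b) = lie D E a + lie D E b"
    using \<open>a \<in> A\<close> \<open>b \<in> A\<close> m D E by (simp add: lie_def Der_D)
next
  fix c a assume "a \<in> A"
  then show "lie D E (scal c * a) = scal c * lie D E a"
    using D E by (simp add: lie_def Der_D right_diff_distrib)
next
  fix a assume "a \<in> A"
  then show "lie D E a \<in> A"
    unfolding lie_def using D E by (simp add: A subalg_diff Der_D[unfolded A])
next
  fix a assume "a \<notin> A"
  then show "lie D E a = 0"
    using D E by (simp add: lie_def Der_D(2) Der_0)
qed

lemma Der_ad:
  assumes u: "\<And>a. a \<in> A \<Longrightarrow> u * a - a * u \<in> A"
  shows "ad A u \<in> Der A"
proof (rule Der_I)
  fix c a assume a: "a \<in> A"
  then have "scal c * a \<in> A"
    by (simp add: A subalg.intros)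
  moreover have "u * (scal c * a) = scal c * (u * a)"
    by (metis scal_commute mult.assoc)
  ultimately show "ad A u (scal c * a) = scal c * ad A u a"
    using a by (simp add: ad_def right_diff_distrib mult.assoc)
qed (use u in \<open>auto simp: ad_def A subalg.intros algebra_simps\<close>)

lemma Der_lmul:
  assumes D: "D \<in> Der A" and z: "z \<in> A" "\<And>a. a \<in> A \<Longrightarrow> z * a = a * z"
  shows "lmul z D \<in> Der A"
proof (rule Der_I)
  fix a b assume ab: "a \<in> A" "b \<in> A"
  then show "lmul z D (a * b) = lmul z D a * b + a * lmul z D b"
  proof -
    have "z * (a * D b) = a * (z * D b)"
      using z(2)[OF ab(1)] by (simp flip: mult.assoc)
    then show ?thesis
      using D ab by (simp add: lmul_def Der_D distrib_left mult.assoc)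
  qed
next
  fix c a assume "a \<in> A"
  then show "lmul z D (scal c * a) = scal c * lmul z D a"
    using D scal_commute[of c z] by (simp add: lmul_def Der_D flip: mult.assoc)
qed (use D z in \<open>auto simp: lmul_def Der_D distrib_left A Der_D[unfolded A] subalg.mult\<close>)

text \<open>Inner derivations form a group under addition, so a single inner difference identifies the cosets.\<close>
lemma HH1_eq_I:
  assumes D: "D \<in> Der A" and E: "E \<in> Der A" and u: "u \<in> A"
    and eq: "\<And>a. a \<in> A \<Longrightarrow> D a = E a + (u * a - a * u)"
  shows "HH1_eq A D E"
proof -
  have eq': "D = E + ad A u"
    using D E eq by (auto simp: fun_eq_iff ad_def Der_D)
  have ad_add: "ad A v + ad A w = ad A (v + w)" for v w
    by (auto simp: fun_eq_iff ad_def algebra_simps)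
  have "HH1_class A D \<subseteq> HH1_class A E"
  proof
    fix F assume "F \<in> HH1_class A D"
    then obtain v where "v \<in> A" "F = E + (ad A u + ad A v)"
      unfolding HH1_class_def Inder_def eq' by (auto simp: add.assoc)
    with u show "F \<in> HH1_class A E"
      unfolding HH1_class_def Inder_def ad_add by (auto simp: A subalg.add)
  qed
  moreover have "HH1_class A E \<subseteq> HH1_class A D"
  proof
    fix F assume "F \<in> HH1_class A E"
    then obtain v where v: "v \<in> A" "F = E + ad A v"
      unfolding HH1_class_def Inder_def by auto
    have "F = D + ad A (v - u)"
      unfolding v eq' by (simp add: add.assoc ad_add)
    moreover have "v - u \<in> A"
      using v u by (simp add: A subalg_diff)
    ultimately show "F \<in> HH1_class A D"
      unfolding HH1_class_def Inder_def by blast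
  qed
  ultimately show ?thesis
    using D E by (auto simp: HH1_eq_def)
qed

end

lemmas W_Der_I = Der_I[OF Weyl_def] and W_Der_D = Der_D[OF Weyl_def] and W_Der_0 = Der_0[OF Weyl_def]
  and W_Der_1 = Der_1[OF Weyl_def] and W_Der_scal = Der_scal[OF Weyl_def]
  and W_Der_minus = Der_minus[OF Weyl_def] and W_Der_diff = Der_diff[OF Weyl_def]
  and W_Der_lie = Der_lie[OF Weyl_def]
  and W_Der_ad = Der_ad[OF Weyl_def] and W_Der_lmul = Der_lmul[OF Weyl_def]
  and W_HH1_eq_I = HH1_eq_I[OF Weyl_def]

lemma Der_eq_on_generators:
  assumes D: "D \<in> Der (Weyl h)" and E: "E \<in> Der (Weyl h)"
    and gen: "D xx = E xx" "D (yhat h) = E (yhat h)"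
  shows "D = E"
proof
  fix a show "D a = E a"
  proof (cases "a \<in> Weyl h")
    case True
    then show ?thesis
      by (induction rule: Weyl_induct) (use D E gen in \<open>simp_all add: W_Der_D W_Der_scal\<close>)
  qed (use D E in \<open>simp add: W_Der_D\<close>)
qed

lemma Der_pol_0:
  assumes D: "D \<in> Der (Weyl h)" and "D xx = 0"
  shows "D (pol f) = 0"
  by (induction f)
    (use assms in \<open>simp_all add: W_Der_0 pol_pCons W_Der_D W_Der_scal Weyl_closed xx_in_Weyl pol_in_Weyl\<close>)

section \<open>Derivations with prescribed values on generators\<close>

text \<open>The dual numbers $B[\epsilon]$ with $\epsilon^2 = 0$. A linear map \<open>D\<close> is a derivation exactly if
  $a \mapsto a + D(a)\epsilon$ is a ring homomorphism, so the universal property of \<open>Weyl h\<close>, applied to maps into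
  dual numbers, yields derivations from their values on the two generators.\<close>
datatype 'b dual = Dual (re: 'b) (ep: 'b)

instantiation dual :: (ring_1) ring_1
begin

definition "0 = Dual 0 0"
definition "1 = Dual 1 0"
definition "u + v = Dual (re u + re v) (ep u + ep v)"
definition "u - v = Dual (re u - re v) (ep u - ep v)"
definition "- u = Dual (- re u) (- ep u)"
definition "u * v = Dual (re u * re v) (re u * ep v + ep u * re v)"

instance
  by standard
    (auto simp: zero_dual_def one_dual_def plus_dual_def minus_dual_def uminus_dual_def times_dual_def
      algebra_simps dual.expand)

end

lemma Dual_arith:
  "Dual a b + Dual c d = Dual (a + c) (b + d)" "Dual a b - Dual c d = Dual (a - c) (b - d)"
  "Dual a b * Dual c d = Dual (a * c) (a * d + b * c)"
  by (simp_all add: plus_dual_def minus_dual_def times_dual_def)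

text \<open>The hypothesis \<open>rel\<close> is the defining relation of \<open>Weyl h\<close> for the images of the generators in the dual
  numbers.\<close>
lemma derivation_exists:
  fixes h :: "'a::field poly"
  assumes h: "h \<noteq> 0" and XY: "X \<in> Weyl h" "Y \<in> Weyl h"
    and rel: "Dual (yhat h) Y * Dual xx X - Dual xx X * Dual (yhat h) Y
      = (\<Sum>i\<le>degree h. Dual (scal (coeff h i)) 0 * Dual xx X ^ i)"
  obtains D where "D \<in> Der (Weyl h)" "D xx = X" "D (yhat h) = Y"
proof -
  have i1: "Dual (scal 1) 0 = (1 :: 'a rat_weyl dual)"
    by (simp add: Wh.i_1 one_dual_def)
  have i2: "Dual (scal (c + d)) 0 = Dual (scal c) 0 + Dual (scal d) 0"
    "Dual (scal (c * d)) 0 = Dual (scal c) 0 * Dual (scal d) 0" for c d :: 'a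
    by (simp_all add: Wh.i_add Wh.i_mult Dual_arith)
  have i3: "Dual (scal c) 0 * b = b * Dual (scal c) 0" for c :: 'a and b
    by (cases b) (simp add: Dual_arith scal_commute[of c])
  obtain \<phi> where \<phi>: "\<And>c. \<phi> (scal c) = Dual (scal c) 0"
    "\<And>a b. a \<in> Weyl h \<Longrightarrow> b \<in> Weyl h \<Longrightarrow> \<phi> (a + b) = \<phi> a + \<phi> b \<and> \<phi> (a * b) = \<phi> a * \<phi> b"
    "\<phi> xx = Dual xx X" "\<phi> (yhat h) = Dual (yhat h) Y"
    using Weyl_universal(1)[of h "\<lambda>c. Dual (scal c) 0", OF h i1 i2 i3 rel] by blast
  have re: "re (\<phi> a) = a \<and> ep (\<phi> a) \<in> Weyl h" if "a \<in> Weyl h" for a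
    using that
    by (induction rule: Weyl_induct)
      (auto simp: \<phi> XY plus_dual_def times_dual_def intro: Weyl_closed)
  define D where "D a = (if a \<in> Weyl h then ep (\<phi> a) else 0)" for a
  have "D \<in> Der (Weyl h)"
    by (rule W_Der_I)
      (auto simp: D_def re \<phi> plus_dual_def times_dual_def Weyl_closed)
  moreover have "D xx = X" "D (yhat h) = Y"
    by (simp_all add: D_def xx_in_Weyl yhat_in_Weyl \<phi>)
  ultimately show ?thesis
    using that by blast
qed

lemma derivation_exists_centralizer:
  fixes h :: "'a::field poly"
  assumes h: "h \<noteq> 0" and e: "e \<in> centralizer_x h"
  obtains D where "D \<in> Der (Weyl h)" "D xx = 0" "D (yhat h) = e"
proof (rule derivation_exists[OF h, of 0 e])
  have pow: "Dual xx 0 ^ i = Dual (xx ^ i) (0 :: 'a rat_weyl)" for i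
    by (induction i) (simp_all add: one_dual_def Dual_arith)
  have sum: "(\<Sum>i\<in>I. Dual (f i) 0) = Dual (sum f I) (0 :: 'a rat_weyl)" for I :: "nat set" and f
    by (induction I rule: infinite_finite_induct) (simp_all add: zero_dual_def Dual_arith)
  show "Dual (yhat h) e * Dual xx 0 - Dual xx 0 * Dual (yhat h) e
      = (\<Sum>i\<le>degree h. Dual (scal (coeff h i)) 0 * Dual xx 0 ^ i)"
    using e Wh.rel[of h] by (simp add: pow sum Dual_arith centralizer_x_def)
qed (use e that in \<open>auto simp: centralizer_x_def Weyl_closed\<close>)

lemma D_der_unique:
  assumes "D \<in> Der (Weyl h)" "D xx = 0" "D (yhat h) = e"
  shows "D_der h e = D"
  unfolding D_der_def using assms by (intro the_equality) (auto intro: Der_eq_on_generators)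

lemma D_der_spec:
  assumes "h \<noteq> 0" "e \<in> centralizer_x h"
  shows "D_der h e \<in> Der (Weyl h)" "D_der h e xx = 0" "D_der h e (yhat h) = e"
  using derivation_exists_centralizer[OF assms] D_der_unique by metis+

lemma pol_in_centralizer: "pol g \<in> centralizer_x h"
  by (simp add: centralizer_x_def pol_in_Weyl pol_xx_commute)

text \<open>For \<open>h = 1\<close> the relation to be checked is $[y, y^{p-1}] = 0$.\<close>
lemma E_x_spec:
  fixes x :: "'a::field itself"
  shows "(E_x :: 'a rat_weyl \<Rightarrow> _) \<in> Der Weyl1" "E_x (xx :: 'a rat_weyl) = yy ^ (CHAR('a) - 1)"
    "E_x (yy :: 'a rat_weyl) = 0"
proof -
  have y: "yhat 1 = (yy :: 'a rat_weyl)"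
    by (simp add: yhat_def pol_1)
  let ?q = "yy ^ (CHAR('a) - 1) :: 'a rat_weyl"
  let ?P = "\<lambda>E. E \<in> Der Weyl1 \<and> E xx = ?q \<and> E yy = 0"
  have "Dual yy 0 * Dual xx ?q - Dual xx ?q * Dual yy 0 = Dual 1 0"
    using weyl_relation by (simp add: Dual_arith power_commutes)
  then obtain E where E: "?P E"
    using derivation_exists[of 1 ?q 0] unfolding y Weyl1_eq[symmetric]
    by (auto simp: Wh.i_1 one_dual_def Dual_arith Weyl1_closed yy_in_Weyl1)
  have "?P E_x"
    unfolding E_x_def
  proof (rule theI[of ?P E])
    show "F = E" if "?P F" for F
      using that E Der_eq_on_generators[of F 1 E] unfolding y Weyl1_eq[symmetric] by simp
  qed (rule E)
  then show "(E_x :: 'a rat_weyl \<Rightarrow> _) \<in> Der Weyl1" "E_x (xx :: 'a rat_weyl) = ?q"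
    "E_x (yy :: 'a rat_weyl) = 0"
    by auto
qed

section \<open>The ideal $\mathsf{gam}\,A_h$ and its commutative quotient\<close>

lemma mult_pderiv_power: "h * pderiv (h ^ n) = of_nat n * pderiv h * h ^ n" for h :: "'a::field poly"
proof (cases n)
  case (Suc m)
  then show ?thesis
    by (simp only: pderiv_power_Suc) (simp add: of_nat_poly algebra_simps)
qed simp

lemma to_fract_power: "to_fract (f ^ n) = to_fract f ^ n"
  by (induction n) simp_all

context weyl_poly
begin

abbreviation A :: "'a rat_weyl set" where
  "A \<equiv> Weyl h"

text \<open>The element $a_0$, which is the inverse of \<open>gam\<close>.\<close>
definition w :: "'a rat_weyl" where
  "w = cf (to_fract (pi_poly h) / to_fract h)"

definition Y :: "nat \<Rightarrow> 'a rat_weyl" where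
  "Y n = pol (h ^ n) * yy ^ n"

lemma w_alt: "to_fract (pi_poly h) / to_fract h = 1 / to_fract gam"
proof -
  have "to_fract h = to_fract gam * to_fract (pi_poly h)"
    by (simp add: gam_pi flip: to_fract_mult)
  then show ?thesis
    using gam_nz pi_nz by simp
qed

lemma w_gam: "w * pol gam = 1" and gam_w: "pol gam * w = 1"
  using gam_nz by (simp_all add: w_def w_alt pol_def cf_1 flip: cf_mult)

lemma pol_w: "pol f * w = w * pol f"
  by (simp add: w_def cf_pol_commute)

text \<open>Multiplication by \<open>w\<close> maps \<open>J\<close> onto \<open>A\<close>. For this reason congruences modulo \<open>J\<close> turn into equalities
  modulo inner derivations after multiplication by \<open>w\<close>.\<close>
definition J :: "'a rat_weyl set" where
  "J = (*) (pol gam) ` A"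

lemma J_I: "a \<in> A \<Longrightarrow> pol gam * a \<in> J"
  by (simp add: J_def)

lemma J_E: assumes "j \<in> J" obtains a where "a \<in> A" "j = pol gam * a"
  using assms by (auto simp: J_def)

lemma w_J: "j \<in> J \<Longrightarrow> w * j \<in> A"
  by (auto simp: J_def w_gam simp flip: mult.assoc)

lemma J_0: "0 \<in> J"
  using J_I[of 0] by (simp add: Weyl_closed)

lemma J_add: "i \<in> J \<Longrightarrow> j \<in> J \<Longrightarrow> i + j \<in> J"
  by (auto elim!: J_E simp flip: distrib_left intro!: J_I Weyl_closed)

lemma J_minus: "i \<in> J \<Longrightarrow> - i \<in> J"
  by (auto elim!: J_E simp flip: mult_minus_right intro!: J_I Weyl_closed)

lemma J_diff: "i \<in> J \<Longrightarrow> j \<in> J \<Longrightarrow> i - j \<in> J"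
  by (auto elim!: J_E simp flip: right_diff_distrib intro!: J_I Weyl_closed)

lemma J_mult_right: "i \<in> J \<Longrightarrow> a \<in> A \<Longrightarrow> i * a \<in> J"
  by (auto elim!: J_E simp: mult.assoc intro!: J_I Weyl_closed)

lemma J_pol: "gam dvd f \<Longrightarrow> pol f \<in> J"
  by (auto simp: pol_mult intro!: J_I pol_in_Weyl)

text \<open>This makes the right ideal \<open>J\<close> two-sided. The only generator that does not commute with \<open>gam\<close> is $\hat y$, and
  $[\hat y, \mathsf{gam}] = h\,\mathsf{gam}'$ is a multiple of \<open>gam\<close> because \<open>h\<close> is.\<close>
lemma mult_gam_in_J:
  assumes "a \<in> A"
  shows "a * pol gam \<in> J"
  using assms
proof (induction rule: Weyl_induct)
  case xx
  then show ?case
    by (auto simp flip: pol_xx_commute intro!: J_I xx_in_Weyl)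
next
  case yhat
  have "yhat h * pol gam = pol gam * yhat h + pol (h * pderiv gam)"
    by (simp add: yhat_eq distrib_right distrib_left mult.assoc yy_pol pol_mult)
      (simp add: pol_commute[of h gam] pol_commute[of "pderiv h" gam] flip: mult.assoc)
  also have "\<dots> \<in> J"
    by (intro J_add J_I J_pol yhat_in_Weyl dvd_mult2) (metis gam_pi dvd_triv_left)
  finally show ?case .
next
  case (scal c)
  show ?case
    by (simp add: scal_commute J_I Weyl_closed)
next
  case (add a b)
  then show ?case
    by (simp add: distrib_right J_add)
next
  case (mult a b)
  obtain c where c: "c \<in> A" "b * pol gam = pol gam * c"
    using mult.IH(2) by (rule J_E)
  show ?case
    using J_mult_right[OF mult.IH(1) c(1)] by (simp add: mult.assoc c(2))
qed

lemma J_mult_left: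
  assumes "i \<in> J" "a \<in> A"
  shows "a * i \<in> J"
proof -
  obtain b where "b \<in> A" "i = pol gam * b"
    using assms(1) by (rule J_E)
  then show ?thesis
    using J_mult_right[OF mult_gam_in_J[OF assms(2)], of b] by (simp add: mult.assoc)
qed

lemma pol_h_in_J: "pol h \<in> J"
  by (rule J_pol) (metis gam_pi dvd_triv_left)

lemma commutator_mult: "a * b * c - c * (a * b) = a * (b * c - c * b) + (a * c - c * a) * (b :: 'b::ring_1)"
  by (simp add: algebra_simps)

text \<open>Modulo the two-sided ideal \<open>J\<close> the generators commute, since $[\hat y, x] = h$.\<close>
lemma commutator_in_J:
  assumes "a \<in> A" "b \<in> A"
  shows "a * b - b * a \<in> J"
proof -
  have yx: "yhat h * xx - xx * yhat h = pol h"
    using Wh.rel[of h] by (simp add: pol_eq)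
  \<comment> \<open>the elements commuting with \<open>g\<close> modulo \<open>J\<close> form a subalgebra\<close>
  have step: "a * g - g * a \<in> J" if "a \<in> A" "xx * g - g * xx \<in> J" "yhat h * g - g * yhat h \<in> J" for a g
    using that(1)
  proof (induction rule: Weyl_induct)
    case (add a b)
    have "(a + b) * g - g * (a + b) = (a * g - g * a) + (b * g - g * b)"
      by (simp add: algebra_simps)
    then show ?case
      using add by (simp only: J_add)
  next
    case (mult a b)
    then show ?case
      by (simp only: commutator_mult J_add J_mult_left J_mult_right)
  qed (simp_all add: that scal_commute J_0)
  have flip: "u * v - v * u \<in> J" if "v * u - u * v \<in> J" for u v
    using J_minus[OF that] by simp
  have xy: "xx * yhat h - yhat h * xx \<in> J"
    by (rule flip) (simp add: yx pol_h_in_J)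
  have "c * xx - xx * c \<in> J" if "c \<in> A" for c
    using that by (rule step) (simp_all add: yx pol_h_in_J J_0)
  moreover have "c * yhat h - yhat h * c \<in> J" if "c \<in> A" for c
    using that xy by (rule step) (simp add: J_0)
  ultimately show ?thesis
    using assms by (intro step[OF assms(1)]) (simp_all add: flip)
qed

definition eqJ :: "'a rat_weyl \<Rightarrow> 'a rat_weyl \<Rightarrow> bool" (infix "\<approx>" 50) where
  "a \<approx> b \<longleftrightarrow> a - b \<in> J"

lemma eqJ_refl [simp]: "a \<approx> a"
  by (simp add: eqJ_def J_0)

lemma eqJ_sym: "a \<approx> b \<Longrightarrow> b \<approx> a"
  using J_minus[of "a - b"] by (simp add: eqJ_def)

lemma eqJ_trans [trans]: "a \<approx> b \<Longrightarrow> b \<approx> c \<Longrightarrow> a \<approx> c"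
  using J_add[of "a - b" "b - c"] by (simp add: eqJ_def)

lemma eqJ_add: "a \<approx> b \<Longrightarrow> c \<approx> d \<Longrightarrow> a + c \<approx> b + d"
  using J_add[of "a - b" "c - d"] by (simp add: eqJ_def algebra_simps)

lemma eqJ_diff: "a \<approx> b \<Longrightarrow> c \<approx> d \<Longrightarrow> a - c \<approx> b - d"
  using J_diff[of "a - b" "c - d"] by (simp add: eqJ_def algebra_simps)

lemma eqJ_mult_left: "a \<approx> b \<Longrightarrow> c \<in> A \<Longrightarrow> c * a \<approx> c * b"
  using J_mult_left[of "a - b" c] by (simp add: eqJ_def right_diff_distrib)

lemma eqJ_mult_right: "a \<approx> b \<Longrightarrow> c \<in> A \<Longrightarrow> a * c \<approx> b * c"
  using J_mult_right[of "a - b" c] by (simp add: eqJ_def left_diff_distrib)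

lemma eqJ_commute: "a \<in> A \<Longrightarrow> b \<in> A \<Longrightarrow> a * b \<approx> b * a"
  by (simp add: eqJ_def commutator_in_J)

lemma eqJ_drop: "j \<in> J \<Longrightarrow> a - j \<approx> a"
  by (simp add: eqJ_def J_minus)

lemma w_eqJ: "a \<approx> b \<Longrightarrow> w * a - w * b \<in> A"
  unfolding eqJ_def by (drule w_J) (simp add: right_diff_distrib)

lemma Y_0: "Y 0 = 1"
  by (simp add: Y_def pol_1)

text \<open>Moving $\hat y = hy + h'$ past $h^n$ produces $n h' h^n$. Since \<open>gam\<close> divides the
  derivative of \<open>h\<close>, the correction term lies in \<open>J\<close>.\<close>
lemma Y_Suc: "Y (Suc n) = yhat h * Y n - pol (of_nat (Suc n) * pderiv h) * Y n"
proof -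
  have "pol h * (yy * pol (h ^ n)) = pol (h * h ^ n) * yy + pol (h * pderiv (h ^ n))"
    by (simp add: yy_pol distrib_left pol_mult mult.assoc)
  then have 1: "pol h * yy * pol (h ^ n) = pol (h * h ^ n) * yy + pol (of_nat n * pderiv h) * pol (h ^ n)"
    unfolding mult_pderiv_power by (simp only: pol_mult mult.assoc)
  have 2: "pol (of_nat (Suc n) * pderiv h) = pol (of_nat n * pderiv h) + pol (pderiv h)"
    by (simp add: algebra_simps flip: pol_add)
  have "yhat h * Y n = (pol h * yy * pol (h ^ n)) * yy ^ n + pol (pderiv h) * Y n"
    by (simp add: Y_def yhat_eq distrib_right mult.assoc)
  also have "\<dots> = Y (Suc n) + pol (of_nat (Suc n) * pderiv h) * Y n"
    unfolding 1 2 by (simp add: Y_def distrib_right mult.assoc)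
  finally show ?thesis
    by simp
qed

lemma Y_in: "Y n \<in> A"
  by (induction n) (auto simp: Y_0 Y_Suc intro!: Weyl_closed pol_in_Weyl yhat_in_Weyl)

lemma Y_eqJ_yhat: "Y n \<approx> yhat h ^ n"
proof (induction n)
  case (Suc n)
  have "pol (of_nat (Suc n) * pderiv h) * Y n \<in> J"
    by (intro J_mult_right Y_in J_pol dvd_mult gam_dvd_pderiv)
  then have "Y (Suc n) \<approx> yhat h * Y n"
    unfolding Y_Suc by (rule eqJ_drop)
  also have "\<dots> \<approx> yhat h * yhat h ^ n"
    by (intro eqJ_mult_left Suc yhat_in_Weyl)
  finally show ?case
    by simp
qed (simp add: Y_0)

lemma monom_in_Weyl:
  assumes "h ^ n dvd f"
  shows "pol f * yy ^ n \<in> A"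
proof -
  obtain g where g: "f = h ^ n * g"
    using assms by (rule dvdE)
  have "pol f * yy ^ n = pol g * Y n"
    by (simp add: g Y_def pol_mult pol_commute[of "h ^ n"] mult.assoc)
  then show ?thesis
    by (simp add: Weyl_closed pol_in_Weyl Y_in)
qed

lemma a_elt_nat: "a_elt h (int n) = w * Y n"
proof -
  have "to_fract h \<noteq> 0"
    using h_nz by simp
  then have "to_fract h powi (int n - 1) = to_fract (h ^ n) / to_fract h"
    by (simp add: power_int_diff to_fract_power)
  then have "cf (to_fract (pi_poly h) * to_fract h powi (int n - 1)) = w * pol (h ^ n)"
    by (simp add: w_def pol_def flip: cf_mult)
  then show ?thesis
    by (simp add: a_elt_def Y_def mult.assoc)
qed

lemma pol_a_elt_nat: "pol r * a_elt h (int n) = w * (pol r * Y n)"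
  by (simp add: a_elt_nat pol_w flip: mult.assoc)

text \<open>The right hand side is $(r/\mathsf{gam})' h = (r' - r\,\mathsf{gam}'/\mathsf{gam})\,\pi_h$, a polynomial because \<open>gam\<close> divides
  $h' = \mathsf{gam}\,\pi_h' + \pi_h\,\mathsf{gam}'$ and therefore $\pi_h\,\mathsf{gam}'$.\<close>
lemma to_fract_delta0: "to_fract (delta0 h r)
  = fract_deriv (to_fract r * to_fract (pi_poly h) * inverse (to_fract h)) * to_fract h"
proof -
  obtain k where k: "pderiv h = gam * k"
    using gam_dvd_pderiv by (rule dvdE)
  have "pderiv h = gam * pderiv (pi_poly h) + pi_poly h * pderiv gam"
    using arg_cong[OF gam_pi, of pderiv] by (simp add: pderiv_mult)
  then have d: "pi_poly h * pderiv gam = gam * (k - pderiv (pi_poly h))"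
    by (simp add: k right_diff_distrib)
  let ?s = "pderiv r * pi_poly h - r * (k - pderiv (pi_poly h))"
  have "to_fract r * to_fract (pi_poly h) * inverse (to_fract h) = Fract r gam"
    using w_alt by (simp add: Fract_conv_to_fract field_simps)
  then have "fract_deriv (to_fract r * to_fract (pi_poly h) * inverse (to_fract h)) * to_fract h
      = Fract ((pderiv r * gam - r * pderiv gam) * h) (gam * gam)"
    using gam_nz by (simp add: fract_deriv_Fract to_fract_def)
  also have "(pderiv r * gam - r * pderiv gam) * h = (pderiv r * gam - r * pderiv gam) * (gam * pi_poly h)"
    by (simp only: gam_pi)
  also have "\<dots> = gam * (gam * (pderiv r * pi_poly h) - r * (pi_poly h * pderiv gam))"
    by (simp add: algebra_simps)
  also have "\<dots> = ?s * (gam * gam)"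
    unfolding d by (simp add: algebra_simps)
  also have "Fract (?s * (gam * gam)) (gam * gam) = to_fract ?s"
    using gam_nz by (simp add: to_fract_def eq_fract)
  finally have "to_fract ?s
    = fract_deriv (to_fract r * to_fract (pi_poly h) * inverse (to_fract h)) * to_fract h" by simp
  from theI[of "\<lambda>s. to_fract s = _", OF this] this show ?thesis
    unfolding delta0_def by (metis to_fract_eq_iff)
qed

text \<open>Up to sign, \<open>delta0\<close> is the derivation \<open>ad (pol r * w)\<close> at $\hat y$.\<close>
lemma yhat_w_commutator: "yhat h * (pol r * w) - pol r * w * yhat h = pol (delta0 h r)"
proof -
  let ?f = "to_fract r * to_fract (pi_poly h) * inverse (to_fract h)"
  have f: "pol r * w = cf ?f"
    by (simp add: pol_def w_def divide_inverse mult.assoc flip: cf_mult)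
  have "pol (delta0 h r) = pol h * cf (fract_deriv ?f)"
    unfolding pol_def[of "delta0 h r"] to_fract_delta0 by (simp add: pol_def mult.commute flip: cf_mult)
  moreover have "yhat h * cf ?f = cf ?f * yhat h + pol h * cf (fract_deriv ?f)"
    by (simp add: yhat_eq distrib_right mult.assoc yy_cf)
       (simp add: distrib_left cf_pol_commute flip: mult.assoc)
  ultimately show ?thesis
    by (simp add: f)
qed

lemma w_normalizes: "a \<in> A \<Longrightarrow> pol r * w * a - a * (pol r * w) \<in> A"
proof (induction rule: Weyl_induct)
  case xx
  have "pol r * w * xx = xx * (pol r * w)"
    by (simp add: w_def mult.assoc cf_xx_commute) (simp add: pol_xx_commute flip: mult.assoc)
  then show ?case
    by (simp add: Weyl_closed)
next
  case yhat
  have "pol r * w * yhat h - yhat h * (pol r * w) = - pol (delta0 h r)"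
    by (simp flip: yhat_w_commutator)
  then show ?case
    by (simp add: Weyl_closed pol_in_Weyl)
next
  case (scal c)
  then show ?case
    by (simp add: scal_commute Weyl_closed)
next
  case (add a b)
  let ?u = "pol r * w"
  have "?u * (a + b) - (a + b) * ?u = (?u * a - a * ?u) + (?u * b - b * ?u)"
    by (simp add: algebra_simps)
  then show ?case
    using add by (simp only: Weyl_closed)
next
  case (mult a b)
  let ?u = "pol r * w"
  have "?u * (a * b) - (a * b) * ?u = (?u * a - a * ?u) * b + a * (?u * b - b * ?u)"
    by (simp add: algebra_simps)
  then show ?case
    using mult by (simp only: Weyl_closed)
qed

text \<open>From $[wa, b] = w[a, b] + [w, b]a$, where $[a, b] \in J$ and $wJ = A_h$.\<close>
lemma wA_normalizes: "a \<in> A \<Longrightarrow> b \<in> A \<Longrightarrow> w * a * b - b * (w * a) \<in> A"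
proof -
  assume a: "a \<in> A" and b: "b \<in> A"
  have "w * a * b - b * (w * a) = w * (a * b - b * a) + (w * b - b * w) * a"
    by (simp add: algebra_simps)
  also have "\<dots> \<in> A"
    using w_J[OF commutator_in_J[OF a b]] w_normalizes[OF b, of 1] a by (simp add: pol_1 Weyl_closed)
  finally show ?thesis .
qed

lemma ad_wA_Der: "a \<in> A \<Longrightarrow> ad A (w * a) \<in> Der A"
  by (rule W_Der_ad) (rule wA_normalizes)

lemma HH1_eq_ad_w:
  assumes "a \<in> A" "b \<in> A" "a \<approx> b"
  shows "HH1_eq A (ad A (w * a)) (ad A (w * b))"
proof (rule W_HH1_eq_I[OF ad_wA_Der ad_wA_Der])
  show "w * a - w * b \<in> A"
    using assms(3) by (rule w_eqJ)
qed (use assms in \<open>auto simp: ad_def algebra_simps\<close>)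

lemma pol_mod_gam_eqJ: "a \<in> A \<Longrightarrow> pol q * a \<approx> pol (q mod gam) * a"
proof -
  assume a: "a \<in> A"
  have "pol q * a - pol (q mod gam) * a = pol (q - q mod gam) * a"
    by (simp add: pol_diff left_diff_distrib)
  also have "\<dots> \<in> J"
    using a by (intro J_mult_right J_pol) (simp_all add: minus_mod_eq_mult_div)
  finally show ?thesis
    by (simp add: eqJ_def)
qed

text \<open>Modulo \<open>J\<close> the power rule of commutative algebra holds for every derivation.\<close>
lemma Der_power_eqJ:
  assumes D: "D \<in> Der A" and a: "a \<in> A"
  shows "D (a ^ n) \<approx> of_nat n * D a * a ^ (n - 1)"
proof (induction n)
  case 0
  then show ?case
    using D by (simp add: W_Der_1)
next
  case (Suc n)
  have Da: "D a \<in> A"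
    using D a by (simp add: W_Der_D)
  have "D (a ^ Suc n) = D a * a ^ n + a * D (a ^ n)"
    using D a by (simp add: W_Der_D Weyl_closed)
  also have "\<dots> \<approx> D a * a ^ n + a * (of_nat n * D a * a ^ (n - 1))"
    using Suc a Da by (intro eqJ_add eqJ_mult_left) simp_all
  also have "\<dots> = D a * a ^ n + of_nat n * (a * D a) * a ^ (n - 1)"
    by (simp add: of_nat_commute[of n a] flip: mult.assoc)
  also have "\<dots> \<approx> D a * a ^ n + of_nat n * (D a * a) * a ^ (n - 1)"
    using a Da by (intro eqJ_add eqJ_mult_right eqJ_mult_left eqJ_commute Weyl_closed) simp_all
  also have "of_nat n * (D a * a) * a ^ (n - 1) = of_nat n * D a * a ^ n"
    by (cases n) (simp_all add: mult.assoc)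
  also have "D a * a ^ n + of_nat n * D a * a ^ n = of_nat (Suc n) * D a * a ^ (Suc n - 1)"
    by (simp add: algebra_simps)
  finally show ?case .
qed

text \<open>Derivations with this property induce derivations of the commutative quotient.\<close>
lemma Der_J:
  assumes "D \<in> Der A" "D (pol gam) \<in> J" "j \<in> J"
  shows "D j \<in> J"
  using assms by (auto elim!: J_E simp: W_Der_D pol_in_Weyl intro!: J_add J_mult_right J_I)

end

section \<open>Brackets of $D_g$ and $\mathrm{ad}_{ra_n}$\<close>

lemma of_nat_left: "a * (of_nat n * b) = of_nat n * (a * b :: 'b::ring_1)"
  by (metis mult.assoc mult_of_nat_commute)

lemma commuting_pairs:
  fixes u v a b :: "'b::ring_1"
  assumes "u * v = v * u" "a * b = b * a"
  shows "u * (a * v - v * a) * b - v * (b * u - u * b) * a = u * a * (v * b) - v * b * (u * a)"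
proof -
  have "u * (v * a) * b = (u * v) * (a * b)"
    by (simp add: mult.assoc)
  also have "\<dots> = v * (u * b) * a"
    by (simp only: assms mult.assoc)
  finally show ?thesis
    by (simp add: right_diff_distrib left_diff_distrib mult.assoc)
qed

lemma commutator_split:
  fixes a b c d :: "'b::ring_1"
  shows "a * b - b * a = ((a - c) * (b - d) - (b - d) * (a - c))
    + ((a * d - d * a) - (b * c - c * b) - (c * d - d * c))"
  by (simp add: algebra_simps)

context weyl_poly
begin

lemma D_der_Der: "D_der h (pol g) \<in> Der A" and D_der_xx: "D_der h (pol g) xx = 0"
  and D_der_yhat: "D_der h (pol g) (yhat h) = pol g"
  using D_der_spec[OF h_nz pol_in_centralizer] by auto

lemma D_der_pol: "D_der h (pol g) (pol f) = 0"
  by (rule Der_pol_0[OF D_der_Der D_der_xx])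

lemma lie_D_D: "lie (D_der h (pol f)) (D_der h (pol g)) = 0"
proof (rule Der_eq_on_generators)
  show "lie (D_der h (pol f)) (D_der h (pol g)) \<in> Der A"
    by (intro W_Der_lie D_der_Der)
  show "0 \<in> Der A"
    by (rule W_Der_I) (simp_all add: Weyl_closed)
qed (simp_all add: lie_def D_der_xx D_der_yhat D_der_pol W_Der_0[OF D_der_Der])

text \<open>Both sides annihilate \<open>x\<close> and have the value \<open>- delta0 h r\<close> at $\hat y$.\<close>
lemma ad_w_eq: "ad A (pol r * w) = - D_der h (pol (delta0 h r))"
proof (rule Der_eq_on_generators)
  show "ad A (pol r * w) \<in> Der A"
    by (rule W_Der_ad) (rule w_normalizes)
  have "pol r * w * xx = xx * (pol r * w)"
    by (simp add: w_def mult.assoc cf_xx_commute) (simp add: pol_xx_commute flip: mult.assoc)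
  then show "ad A (pol r * w) xx = (- D_der h (pol (delta0 h r))) xx"
    by (simp add: ad_def xx_in_Weyl D_der_xx)
  have "pol r * w * yhat h - yhat h * (pol r * w) = - pol (delta0 h r)"
    by (simp flip: yhat_w_commutator)
  then show "ad A (pol r * w) (yhat h) = (- D_der h (pol (delta0 h r))) (yhat h)"
    by (simp add: ad_def yhat_in_Weyl D_der_yhat)
  show "- D_der h (pol (delta0 h r)) \<in> Der A"
    by (rule W_Der_I) (simp_all add: W_Der_D[OF D_der_Der] W_Der_scal[OF D_der_Der] Weyl_closed)
qed

text \<open>Formally this is $D_g(w) = 0$. As \<open>w\<close> lies outside \<open>A\<close> in general, the element $w[a, b]$ of \<open>A\<close> is
  differentiated after multiplication by \<open>gam\<close>, and $[w, b]$ is differentiated by means of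
  \<open>ad_w_eq\<close>, since derivations $D_f$ and $D_g$ commute.\<close>
lemma lie_D_ad_w: "a \<in> A \<Longrightarrow> lie (D_der h (pol g)) (ad A (w * a)) = ad A (w * D_der h (pol g) a)"
proof
  fix b
  let ?D = "D_der h (pol g)"
  assume a: "a \<in> A"
  note D = D_der_Der[of g]
  show "lie ?D (ad A (w * a)) b = ad A (w * ?D a) b"
  proof (cases "b \<in> A")
    case b: True
    let ?c = "w * (a * b - b * a)"
    have c: "?c \<in> A" "pol gam * ?c = a * b - b * a"
      using w_J commutator_in_J a b by (auto simp: gam_w simp flip: mult.assoc)
    have "pol gam * ?D ?c = ?D (pol gam * ?c)"
      using c(1) by (simp add: W_Der_D[OF D] pol_in_Weyl D_der_pol)
    also have "\<dots> = ?D a * b + a * ?D b - (?D b * a + b * ?D a)"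
      unfolding c(2) using a b by (simp add: W_Der_D[OF D] W_Der_diff[OF D] Weyl_closed)
    finally have "w * (pol gam * ?D ?c) = w * (?D a * b + a * ?D b - (?D b * a + b * ?D a))"
      by simp
    then have Dc: "?D ?c = w * (?D a * b + a * ?D b - (?D b * a + b * ?D a))"
      by (simp add: w_gam flip: mult.assoc)
    have wb: "w * b - b * w \<in> A"
      using w_normalizes[OF b, of 1] by (simp add: pol_1)
    have "lie ?D (ad A (pol 1 * w)) b = (0 :: 'a rat_weyl)"
      unfolding ad_w_eq using lie_D_D[of g "delta0 h 1"] b
      by (auto simp: lie_def fun_eq_iff W_Der_minus[OF D] W_Der_D[OF D_der_Der])
    \<comment> \<open>this is \<open>lie_D_D\<close>, read through \<open>ad_w_eq\<close> with \<open>r = 1\<close>\<close>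
    then have Dw: "?D (w * b - b * w) = w * ?D b - ?D b * w"
      using b by (simp add: lie_def ad_def pol_1 W_Der_D[OF D])
    have "w * a * b - b * (w * a) = ?c + (w * b - b * w) * a"
      by (simp add: algebra_simps)
    then have "?D (w * a * b - b * (w * a)) = ?D ?c + ?D (w * b - b * w) * a + (w * b - b * w) * ?D a"
      using c(1) wb a by (simp add: W_Der_D[OF D] Weyl_closed add.assoc)
    then show ?thesis
      using b unfolding Dc Dw by (simp add: lie_def ad_def W_Der_D[OF D] algebra_simps)
  qed (simp add: lie_def ad_def W_Der_D[OF D] W_Der_0[OF D])
qed

text \<open>Replace $h^ny^n$ by $\hat y^n$ and apply the power rule with $D_g(\hat y) = g$.\<close>
lemma D_der_Y_eqJ: "D_der h (pol g) (pol r * Y n) \<approx> of_nat n * pol (g * r) * Y (n - 1)"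
proof -
  let ?D = "D_der h (pol g)"
  note D = D_der_Der[of g]
  have "pol r * Y n - pol r * yhat h ^ n \<in> J"
    using eqJ_mult_left[OF Y_eqJ_yhat pol_in_Weyl] by (simp add: eqJ_def)
  then have "?D (pol r * Y n - pol r * yhat h ^ n) \<in> J"
    by (rule Der_J[OF D, rotated]) (simp add: D_der_pol J_0)
  then have "?D (pol r * Y n) \<approx> pol r * ?D (yhat h ^ n)"
    by (simp add: eqJ_def W_Der_D[OF D] W_Der_diff[OF D] Weyl_closed pol_in_Weyl Y_in yhat_in_Weyl D_der_pol)
  also have "\<dots> \<approx> pol r * (of_nat n * pol g * yhat h ^ (n - 1))"
    using Der_power_eqJ[OF D yhat_in_Weyl, of n] by (intro eqJ_mult_left pol_in_Weyl) (simp add: D_der_yhat)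
  also have "\<dots> = of_nat n * pol (g * r) * yhat h ^ (n - 1)"
    by (simp add: pol_mult pol_commute[of g] of_nat_commute[of n "pol r"] flip: mult.assoc)
  also have "\<dots> \<approx> of_nat n * pol (g * r) * Y (n - 1)"
    by (intro eqJ_mult_left eqJ_sym[OF Y_eqJ_yhat] Weyl_closed pol_in_Weyl)
  finally show ?thesis .
qed

lemma lmul_of_nat_ad: "lmul (of_nat n) (ad A u) = ad A (of_nat n * u)"
  by (auto simp: lmul_def ad_def fun_eq_iff right_diff_distrib mult.assoc of_nat_left)

lemma a_elt_pred: "of_nat n * (pol r * a_elt h (int n - 1)) = w * (of_nat n * pol r * Y (n - 1))"
proof (cases n)
  case (Suc m)
  have "of_nat n * (pol r * a_elt h (int m)) = w * (of_nat n * (pol r * Y m))"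
    unfolding pol_a_elt_nat using of_nat_commute[of n w] by (simp flip: mult.assoc)
  with Suc show ?thesis
    by (simp add: mult.assoc)
qed simp

lemma lie_D_ad_a:
  fixes g r :: "'a poly"
  defines "c \<equiv> (g * r) mod (h div pi_poly h)"
  shows "HH1_eq A (lie (D_der h (pol g)) (ad A (pol r * a_elt h (int n))))
           (lmul (of_nat n) (ad A (pol (g * r) * a_elt h (int n - 1))))"
    and "HH1_eq A (lmul (of_nat n) (ad A (pol (g * r) * a_elt h (int n - 1))))
           (lmul (of_nat n) (ad A (pol c * a_elt h (int n - 1))))"
proof -
  have in_A: "pol r * Y n \<in> A" "of_nat n * pol s * Y (n - 1) \<in> A" for s
    by (intro Weyl_closed pol_in_Weyl Y_in)+
  show "HH1_eq A (lie (D_der h (pol g)) (ad A (pol r * a_elt h (int n))))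
           (lmul (of_nat n) (ad A (pol (g * r) * a_elt h (int n - 1))))"
    unfolding lmul_of_nat_ad a_elt_pred pol_a_elt_nat lie_D_ad_w[OF in_A(1)]
    by (intro HH1_eq_ad_w D_der_Y_eqJ in_A W_Der_D[OF D_der_Der])
  show "HH1_eq A (lmul (of_nat n) (ad A (pol (g * r) * a_elt h (int n - 1))))
           (lmul (of_nat n) (ad A (pol c * a_elt h (int n - 1))))"
    unfolding lmul_of_nat_ad a_elt_pred
    using eqJ_mult_left[OF pol_mod_gam_eqJ[OF Y_in[of "n - 1"], of "g * r"], of "of_nat n"]
    by (intro HH1_eq_ad_w in_A) (simp_all add: c_def gam_def mult.assoc Weyl_closed)
qed

lemma lie_ad_ad:
  assumes "\<And>a. a \<in> A \<Longrightarrow> u * a - a * u \<in> A" "\<And>a. a \<in> A \<Longrightarrow> v * a - a * v \<in> A"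
  shows "lie (ad A u) (ad A v) = ad A (u * v - v * u)"
  using assms by (auto simp: lie_def ad_def fun_eq_iff Weyl_closed algebra_simps)

lemma commutator_w_yhat_power:
  "pol r * w * yhat h ^ n - yhat h ^ n * (pol r * w) \<approx> - (of_nat n * pol (delta0 h r) * yhat h ^ (n - 1))"
proof -
  let ?D = "ad A (pol r * w)"
  have D: "?D \<in> Der A"
    by (rule W_Der_ad) (rule w_normalizes)
  have "?D (yhat h) = - pol (delta0 h r)"
    by (simp add: ad_w_eq D_der_yhat)
  then show ?thesis
    using Der_power_eqJ[OF D yhat_in_Weyl, of n] by (simp add: ad_def Weyl_closed yhat_in_Weyl)
qed

text \<open>Up to elements of \<open>A\<close>, the two factors are $rw\hat y^m$ and $sw\hat y^n$; as $rw$ and $sw$ commute,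
  only $[\hat y^m, sw]$ and $[\hat y^n, rw]$ contribute, and these are known modulo \<open>J\<close>.\<close>
lemma commutator_a_a:
  fixes r s :: "'a poly" and m n :: nat
  defines "q \<equiv> of_nat m * r * delta0 h s - of_nat n * s * delta0 h r"
  shows "(w * (pol r * Y m)) * (w * (pol s * Y n)) - (w * (pol s * Y n)) * (w * (pol r * Y m))
    - w * (pol q * Y (m + n - 1)) \<in> A"
proof -
  let ?y = "yhat h"
  let ?u = "pol r * w" and ?v = "pol s * w"
  note in_A = Weyl_closed pol_in_Weyl Y_in yhat_in_Weyl
  define c where "c = w * (pol r * Y m) - ?u * ?y ^ m"
  define d where "d = w * (pol s * Y n) - ?v * ?y ^ n"
  have cd: "c \<in> A" "d \<in> A"
    using w_eqJ[OF eqJ_mult_left[OF Y_eqJ_yhat pol_in_Weyl]] by (simp_all add: c_def d_def pol_w mult.assoc)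
  let ?a = "w * (pol r * Y m)" and ?b = "w * (pol s * Y n)"
  let ?S = "?y ^ m * ?v - ?v * ?y ^ m" and ?R = "?y ^ n * ?u - ?u * ?y ^ n"
  have S: "?S \<approx> of_nat m * pol (delta0 h s) * ?y ^ (m - 1)"
    using eqJ_diff[OF eqJ_refl[of 0] commutator_w_yhat_power[of s m]] by simp
  have R: "?R \<approx> of_nat n * pol (delta0 h r) * ?y ^ (n - 1)"
    using eqJ_diff[OF eqJ_refl[of 0] commutator_w_yhat_power[of r n]] by simp
  have "pol r * ?S * ?y ^ n - pol s * ?R * ?y ^ m
      \<approx> pol r * (of_nat m * pol (delta0 h s) * ?y ^ (m - 1)) * ?y ^ n
        - pol s * (of_nat n * pol (delta0 h r) * ?y ^ (n - 1)) * ?y ^ m"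
    by (intro eqJ_diff eqJ_mult_right eqJ_mult_left S R in_A)
  also have "\<dots> = pol (of_nat m * r * delta0 h s) * (?y ^ (m - 1) * ?y ^ n)
        - pol (of_nat n * s * delta0 h r) * (?y ^ (n - 1) * ?y ^ m)"
    by (simp add: pol_mult pol_of_nat of_nat_left mult.assoc)
  also have "\<dots> = pol q * ?y ^ (m + n - 1)"
  proof -
    have "pol (of_nat i * r * f) * (?y ^ (i - 1) * ?y ^ j) = pol (of_nat i * r * f) * ?y ^ (i + j - 1)"
      for i j :: nat and r f :: "'a poly"
      by (cases i) (simp_all only: power_add[symmetric], simp_all)
    then show ?thesis
      by (simp only: q_def pol_diff left_diff_distrib add.commute[of n m])
  qed
  also have "\<dots> \<approx> pol q * Y (m + n - 1)"
    by (intro eqJ_mult_left eqJ_sym[OF Y_eqJ_yhat] in_A)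
  finally have 1: "w * (pol r * ?S * ?y ^ n - pol s * ?R * ?y ^ m) - w * (pol q * Y (m + n - 1)) \<in> A"
    by (rule w_eqJ)
  have 2: "w * (pol r * ?S * ?y ^ n - pol s * ?R * ?y ^ m)
      = (?u * ?y ^ m) * (?v * ?y ^ n) - (?v * ?y ^ n) * (?u * ?y ^ m)"
  proof -
    have "?u * ?v = ?v * ?u"
      unfolding w_def pol_def cf_mult[symmetric] by (simp only: ac_simps)
    moreover have "?y ^ m * ?y ^ n = ?y ^ n * ?y ^ m"
      by (simp add: add.commute flip: power_add)
    ultimately have "?u * ?S * ?y ^ n - ?v * ?R * ?y ^ m
        = (?u * ?y ^ m) * (?v * ?y ^ n) - (?v * ?y ^ n) * (?u * ?y ^ m)"
      by (rule commuting_pairs)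
    moreover have "w * (pol r * S * a - pol s * R * b) = ?u * S * a - ?v * R * b" for S R a b
      by (simp add: right_diff_distrib pol_w mult.assoc)
    ultimately show ?thesis
      by simp
  qed
  have 3: "?a * ?b - ?b * ?a = ((?u * ?y ^ m) * (?v * ?y ^ n) - (?v * ?y ^ n) * (?u * ?y ^ m))
      + ((?a * d - d * ?a) - (?b * c - c * ?b) - (c * d - d * c))"
  proof -
    have "?u * ?y ^ m = ?a - c" "?v * ?y ^ n = ?b - d"
      by (simp_all add: c_def d_def)
    then show ?thesis
      by (simp only: commutator_split[of ?a ?b c d])
  qed
  have 4: "(?a * d - d * ?a) - (?b * c - c * ?b) - (c * d - d * c) \<in> A"
  proof -
    have ab: "pol r * Y m \<in> A" "pol s * Y n \<in> A"
      by (intro in_A)+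
    have "?a * d - d * ?a \<in> A" "?b * c - c * ?b \<in> A" "c * d - d * c \<in> A"
      using ab cd by (simp_all add: wA_normalizes Weyl_closed)
    then show ?thesis
      by (simp only: Weyl_closed(4))
  qed
  have add_diff_swap: "x + y - z = (x - z) + y" for x y z :: "'a rat_weyl"
    by simp
  show ?thesis
    unfolding 3 2[symmetric] by (subst add_diff_swap) (rule Weyl_closed(9)[OF 1 4])
qed

lemma lie_ad_a_ad_a:
  fixes r s :: "'a poly" and m n :: nat
  defines "q \<equiv> of_nat m * r * delta0 h s - of_nat n * s * delta0 h r"
  defines "d \<equiv> q mod (h div pi_poly h)"
  shows "HH1_eq A (lie (ad A (pol r * a_elt h (int m))) (ad A (pol s * a_elt h (int n))))
            (ad A (pol q * a_elt h (int m + int n - 1)))"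
    and "HH1_eq A (ad A (pol q * a_elt h (int m + int n - 1)))
            (ad A (pol d * a_elt h (int m + int n - 1)))"
proof -
  let ?a = "w * (pol r * Y m)" and ?b = "w * (pol s * Y n)"
  have in_A: "pol f * Y k \<in> A" for f k
    by (intro Weyl_closed pol_in_Weyl Y_in)+
  have a: "pol f * a_elt h (int m + int n - 1) = w * (pol f * Y (m + n - 1))"
    if "f = q \<or> f = d" for f
  proof (cases "m + n = 0")
    case True
    then show ?thesis
      using that by (auto simp: q_def d_def a_elt_def)
  next
    case False
    then have "int m + int n - 1 = int (m + n - 1)"
      by linarith
    then show ?thesis
      by (simp only: pol_a_elt_nat)
  qed
  have lie: "lie (ad A ?a) (ad A ?b) = ad A (?a * ?b - ?b * ?a)"
    by (intro lie_ad_ad wA_normalizes in_A)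
  show "HH1_eq A (lie (ad A (pol r * a_elt h (int m))) (ad A (pol s * a_elt h (int n))))
            (ad A (pol q * a_elt h (int m + int n - 1)))"
    unfolding a[OF disjI1[OF refl]] pol_a_elt_nat
  proof (rule W_HH1_eq_I)
    show "lie (ad A ?a) (ad A ?b) \<in> Der A"
      by (intro W_Der_lie ad_wA_Der in_A)
    show "ad A (w * (pol q * Y (m + n - 1))) \<in> Der A"
      by (intro ad_wA_Der in_A)
    show "?a * ?b - ?b * ?a - w * (pol q * Y (m + n - 1)) \<in> A"
      unfolding q_def by (rule commutator_a_a)
  qed (simp only: lie, simp add: ad_def algebra_simps)
  show "HH1_eq A (ad A (pol q * a_elt h (int m + int n - 1)))
            (ad A (pol d * a_elt h (int m + int n - 1)))"
    unfolding a[OF disjI1[OF refl]] a[OF disjI2[OF refl]] unfolding d_def gam_def[symmetric]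
    by (intro HH1_eq_ad_w in_A pol_mod_gam_eqJ Y_in)
qed

end

section \<open>Powers of $y$\<close>

lemma of_nat_scal: "of_nat n = scal (of_nat n)"
  by (induction n) (simp_all add: Wh.i_add Wh.i_1)

lemma scal_cf_commute: "cf f * (scal c * a) = scal c * (cf f * a)"
  by (simp add: scal_commute[of c "cf f"] flip: mult.assoc)

lemma scal_left: "a * (scal c * b) = scal c * (a * b)"
  by (simp add: scal_commute[of c a] flip: mult.assoc)

lemma scal_minus_1_power: "scal ((- 1) ^ j) = (- 1) ^ j"
  by (induction j) (simp_all only: power_Suc power_0 Wh.i_1 Wh.i_mult scal_minus_1)

lemma commute_mult: "c * a = a * c \<Longrightarrow> c * b = b * c \<Longrightarrow> c * (a * b) = a * b * (c :: 'b::ring_1)"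
  by (metis mult.assoc)

lemma yy_power_xx: "yy ^ n * xx = xx * yy ^ n + of_nat n * (yy ^ (n - 1) :: 'a::field rat_weyl)"
proof (induction n)
  case (Suc n)
  have yx: "yy * xx = xx * yy + (1 :: 'a rat_weyl)"
    using weyl_relation by (simp add: algebra_simps)
  have "yy ^ Suc n * xx = yy * (xx * yy ^ n + of_nat n * (yy ^ (n - 1) :: 'a rat_weyl))"
    by (simp only: power_Suc mult.assoc Suc)
  also have "\<dots> = yy * xx * yy ^ n + of_nat n * (yy * yy ^ (n - 1))"
    by (simp add: distrib_left mult.assoc of_nat_left)
  also have "of_nat n * (yy * yy ^ (n - 1)) = of_nat n * (yy ^ n :: 'a rat_weyl)"
    by (cases n) simp_all
  finally show ?case
    by (simp add: yx distrib_right add.assoc mult.assoc add.commute)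
qed simp

text \<open>The value at $y^n$ of the derivation of $\mathbb F(x)[y; d/dx]$ that annihilates $\mathbb F(x)$ and maps \<open>y\<close> to \<open>u\<close>.
  For $u = f'$ this is the commutator with \<open>- f\<close>.\<close>
primrec y_power_der :: "'a::field poly fract \<Rightarrow> nat \<Rightarrow> 'a rat_weyl" where
  "y_power_der u 0 = 0"
| "y_power_der u (Suc n) = cf u * yy ^ n + yy * y_power_der u n"

lemma y_power_der_commutator: "yy ^ n * cf f - cf f * yy ^ n = y_power_der (fract_deriv f) n"
proof (induction n)
  case (Suc n)
  have "yy ^ Suc n * cf f - cf f * yy ^ Suc n
      = yy * (yy ^ n * cf f - cf f * yy ^ n) + (yy * cf f - cf f * yy) * yy ^ n"
    by (simp add: algebra_simps)
  also have "yy * cf f - cf f * yy = cf (fract_deriv f)"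
    by (simp add: yy_cf)
  finally show ?case
    by (simp add: Suc add.commute)
qed simp

text \<open>Pascal's rule, after moving \<open>y\<close> to the right in every summand.\<close>
lemma y_power_der_formula:
  "y_power_der u n = (\<Sum>j<n. of_nat (n choose Suc j) * (cf ((fract_deriv ^^ j) u) * yy ^ (n - Suc j)))"
proof (induction n)
  case (Suc n)
  let ?u = "\<lambda>j. cf ((fract_deriv ^^ j) u)"
  let ?t = "\<lambda>c j. of_nat (n choose c) * (?u j * yy ^ (n - j)) :: 'a rat_weyl"
  have "yy * (of_nat c * (?u j * yy ^ (n - Suc j))) = of_nat c * (?u j * yy ^ (n - j)) + of_nat c * (?u (Suc j) * yy ^ (n - Suc j))"
    if "j < n" for c j
  proof -
    have "yy * (of_nat c * (?u j * yy ^ (n - Suc j))) = of_nat c * ((yy * ?u j) * yy ^ (n - Suc j))"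
      by (simp add: of_nat_left mult.assoc)
    also have "\<dots> = of_nat c * (?u j * yy ^ Suc (n - Suc j)) + of_nat c * (?u (Suc j) * yy ^ (n - Suc j))"
      by (simp add: yy_cf distrib_right distrib_left mult.assoc)
    finally show ?thesis
      using that by (simp add: Suc_diff_Suc del: power_Suc)
  qed
  then have "y_power_der u (Suc n) = ?t 0 0 + ((\<Sum>j<n. ?t (Suc j) j) + (\<Sum>j<n. ?t (Suc j) (Suc j)))"
    by (simp add: Suc sum_distrib_left sum.distrib)
  also have "\<dots> = (\<Sum>j<Suc n. ?t j j) + (\<Sum>j<Suc n. ?t (Suc j) j)"
    by (subst sum.lessThan_Suc_shift) (simp add: binomial_eq_0 algebra_simps)
  also have "\<dots> = (\<Sum>j<Suc n. of_nat (Suc n choose Suc j) * (?u j * yy ^ (Suc n - Suc j)))"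
    by (simp add: distrib_right flip: sum.distrib)
  finally show ?case .
qed simp

lemma iterate_fract_deriv_to_fract: "(fract_deriv ^^ j) (to_fract f) = to_fract ((pderiv ^^ j) f)"
  by (induction j) simp_all

lemma iterate_pderiv_mult_const:
  assumes "pderiv q = 0"
  shows "(pderiv ^^ j) (q * t) = q * (pderiv ^^ j) (t :: 'a::field poly)"
  by (induction j) (simp_all add: pderiv_mult assms)

lemma iterate_pderiv_0: "(pderiv ^^ j) (0 :: 'a::field poly) = 0"
  by (induction j) simp_all

lemma iterate_pderiv_pCons:
  "(pderiv ^^ Suc j) (pCons a f) = [:0, 1:] * (pderiv ^^ Suc j) f + of_nat (Suc j) * (pderiv ^^ j) (f :: 'a::field poly)"
proof (induction j)
  case 0
  then show ?case
    by (simp add: pderiv_pCons)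
next
  case (Suc j)
  have "(pderiv ^^ Suc (Suc j)) (pCons a f) = pderiv ([:0, 1:] * (pderiv ^^ Suc j) f + of_nat (Suc j) * (pderiv ^^ j) f)"
    using Suc by simp
  also have "\<dots> = [:0, 1:] * (pderiv ^^ Suc (Suc j)) f + of_nat (Suc (Suc j)) * (pderiv ^^ Suc j) f"
    by (simp only: pderiv_add pderiv_mult pderiv_of_nat) (simp add: pderiv_pCons algebra_simps)
  finally show ?case .
qed

lemma pol_iterate_pCons:
  "pol ((pderiv ^^ Suc j) (pCons a f)) = xx * pol ((pderiv ^^ Suc j) f) + of_nat (Suc j) * pol ((pderiv ^^ j) f)"
  unfolding iterate_pderiv_pCons by (simp only: pol_add pol_mult pol_of_nat xx_def)

context weyl_poly
begin

text \<open>An element commuting with a unit commutes with its inverse.\<close>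
lemma commutes_with_w:
  assumes "a * pol gam = pol gam * a"
  shows "a * w = w * a"
proof -
  have "a * w = w * (pol gam * a) * w"
    by (simp add: w_gam flip: mult.assoc)
  also have "\<dots> = w * a"
    unfolding assms[symmetric] by (simp add: gam_w mult.assoc)
  finally show ?thesis .
qed

end

context weyl_char_p
begin

lemma of_nat_p: "of_nat p = (0 :: 'a)"
  using char of_nat_CHAR by metis

lemma of_nat_p_rw: "of_nat p = (0 :: 'a rat_weyl)"
  by (simp add: of_nat_scal of_nat_p)

lemma of_nat_nonzero: "0 < i \<Longrightarrow> i < p \<Longrightarrow> of_nat i \<noteq> (0 :: 'a)"
  using of_nat_eq_0_iff_char_dvd[of i, where ?'a = 'a] char by (auto dest: dvd_imp_le)

text \<open>Neighbouring entries of row \<open>p - 1\<close> of Pascal's triangle add up to an entry of row \<open>p\<close>, which is divisible by \<open>p\<close>.\<close>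
lemma of_nat_choose: "j < p \<Longrightarrow> of_nat ((p - 1) choose j) = ((- 1) ^ j :: 'a rat_weyl)"
proof (induction j)
  case (Suc j)
  have "p dvd (p choose Suc j)"
    using Suc.prems prime_p by (intro dvd_choose_prime) auto
  then have "of_nat (p choose Suc j) = (0 :: 'a rat_weyl)"
    by (auto simp: of_nat_p_rw elim!: dvdE)
  moreover have "(p choose Suc j) = ((p - 1) choose j) + ((p - 1) choose Suc j)"
    using p_pos by (metis Suc_diff_1 binomial_Suc_Suc)
  ultimately have "((- 1) ^ j :: 'a rat_weyl) + of_nat ((p - 1) choose Suc j) = 0"
    using Suc by simp
  then show ?case
    by (simp add: add_eq_0_iff)
qed simp

lemma y_power_der_p_minus_1:
  "y_power_der (u :: 'a poly fract) (p - 1) = (\<Sum>j<p - 1. (- 1) ^ Suc j * (cf ((fract_deriv ^^ j) u) * yy ^ (p - 1 - Suc j)))"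
  unfolding y_power_der_formula by (intro sum.cong refl) (subst of_nat_choose, auto)

lemma pderiv_power_p: "pderiv (f ^ p) = (0 :: 'a poly)"
  by (simp add: pderiv_power of_nat_p)

section \<open>Central elements\<close>

lemma yy_pol_const: "pderiv f = 0 \<Longrightarrow> yy * pol f = pol (f :: 'a poly) * yy"
  by (simp add: yy_pol)

text \<open>Derivative zero means commuting with \<open>y\<close>.\<close>
lemma pol_const_central:
  assumes "pderiv (f :: 'a poly) = 0" "a \<in> Weyl1"
  shows "pol f * a = a * pol f"
  using assms(2) unfolding Weyl1_def
proof induction
  case (gen a)
  then show ?case
    using assms(1) by (auto simp: yy_pol_const pol_xx_commute)
next
  case (mult a b)
  then show ?case
    by (intro commute_mult)
qed (simp_all add: scal_commute distrib_left distrib_right)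

lemma yy_power_p_pol: "yy ^ p * pol f = pol (f :: 'a poly) * yy ^ p"
proof (induction f)
  case (pCons a f)
  have "yy ^ p * xx = xx * (yy ^ p :: 'a rat_weyl)"
    by (simp add: yy_power_xx of_nat_p_rw)
  then have "yy ^ p * (xx * pol f) = xx * pol f * yy ^ p"
    using pCons(2) by (rule commute_mult)
  then show ?case
    by (simp add: pol_pCons distrib_left distrib_right scal_commute[of a])
qed simp

abbreviation z :: "'a rat_weyl" where
  "z \<equiv> z_elt h"

lemma z_eq: "z = pol (h ^ p) * yy ^ p"
  by (simp add: z_elt_def char)

lemma central_I:
  assumes "pderiv f = 0" "a \<in> A"
  shows "pol f * yy ^ p * a = a * (pol f * yy ^ p)"
proof -
  have "yy ^ p * a = a * yy ^ p"
    using assms(2)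
  proof (induction rule: Weyl_induct)
    case xx
    then show ?case
      using yy_power_p_pol[of "[:0, 1:]"] by (simp add: xx_def)
  next
    case yhat
    have "yy ^ p * (yy * pol h) = yy * (yy ^ p * pol h)"
      by (simp add: power_commutes flip: mult.assoc)
    then show ?case
      by (simp add: yhat_def yy_power_p_pol mult.assoc)
  next
    case (mult a b)
    then show ?case
      by (intro commute_mult)
  qed (simp_all add: scal_commute distrib_left distrib_right)
  then show ?thesis
    using pol_const_central[OF assms(1) Weyl_sub_Weyl1[OF assms(2)]]
    by (intro commute_mult[symmetric]) simp_all
qed

lemma z_in: "z \<in> A" and z_central: "a \<in> A \<Longrightarrow> z * a = a * z"
  unfolding z_eq by (auto intro: monom_in_Weyl central_I pderiv_power_p)

lemma z_power_central: "a \<in> A \<Longrightarrow> z ^ k * a = a * z ^ k"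
  by (induction k) (simp_all add: mult.assoc z_central, simp flip: mult.assoc add: z_central)

lemma z_w: "z * w = w * z"
  by (intro commutes_with_w z_central pol_in_Weyl)

lemma z_power_w: "z ^ k * w = w * z ^ k"
  by (intro commutes_with_w z_power_central pol_in_Weyl)

lemma z_power_Y: "z ^ k * Y n = Y (k * p + n)"
proof (induction k)
  case (Suc k)
  have "z * Y m = Y (p + m)" for m
    by (simp add: z_eq Y_def power_add pol_mult mult.assoc)
      (simp add: yy_power_p_pol flip: mult.assoc)
  with Suc show ?case
    by (simp add: mult.assoc add.assoc)
qed simp

section \<open>The derivation $E_x$\<close>

abbreviation E :: "'a rat_weyl \<Rightarrow> 'a rat_weyl" where
  "E \<equiv> E_x"

lemmas E_Der = E_x_spec(1)[where ?'a = 'a]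

lemma E_xx: "E xx = yy ^ (p - 1)" and E_yy: "E yy = 0"
  using E_x_spec(2,3)[where ?'a = 'a] by (simp_all add: char)

lemmas E_D = Der_D[OF Weyl1_def E_Der] and E_scal = Der_scal[OF Weyl1_def E_Der]
  and E_diff = Der_diff[OF Weyl1_def E_Der]

lemma E_yy_power: "E (yy ^ n) = 0"
proof (induction n)
  case 0
  then show ?case
    using Der_1[OF Weyl1_def E_Der] by simp
next
  case (Suc n)
  then show ?case
    by (simp add: E_D yy_in_Weyl1 Weyl1_closed E_yy)
qed

text \<open>This is $\frac1p\binom pj$ in $\mathbb F$, the integer being reduced modulo \<open>p\<close> after the division. These numbers
  occur because $E_x$ behaves like $\frac1p\,\mathrm{ad}_{y^p}$.\<close>
definition coef :: "nat \<Rightarrow> 'a rat_weyl" where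
  "coef j = scal ((- 1) ^ j / of_nat (p - j))"

lemma coef_1: "coef 1 = 1"
proof -
  have "of_nat (p - 1) = (- 1 :: 'a)"
    using p_pos of_nat_p by (simp add: of_nat_diff)
  then show ?thesis
    by (simp add: coef_def Wh.i_1)
qed

lemma coef_of_nat:
  assumes "Suc j < p"
  shows "coef (Suc j) * of_nat (Suc j) = (- 1) ^ j"
proof -
  have "of_nat (p - Suc j) = (- of_nat (Suc j) :: 'a)"
    using assms of_nat_p by (simp add: of_nat_diff)
  moreover have "of_nat (Suc j) \<noteq> (0 :: 'a)"
    using assms by (intro of_nat_nonzero) auto
  ultimately have "(- 1) ^ Suc j / of_nat (p - Suc j) * of_nat (Suc j) = ((- 1) ^ j :: 'a)"
    by (simp add: field_simps del: of_nat_Suc)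
  then show ?thesis
    unfolding coef_def of_nat_scal Wh.i_mult[symmetric] by (simp only: scal_minus_1_power)
qed

lemma yy_power_pol:
  "yy ^ (p - 1) * pol (f :: 'a poly)
    = (\<Sum>j<p - 1. (- 1) ^ j * (pol ((pderiv ^^ j) f) * yy ^ (p - Suc j))) + (- 1) ^ (p - 1) * pol ((pderiv ^^ (p - 1)) f)"
proof -
  let ?t = "\<lambda>j. (- 1) ^ j * (pol ((pderiv ^^ j) f) * yy ^ (p - Suc j)) :: 'a rat_weyl"
  have "yy ^ (p - 1) * pol f - pol f * yy ^ (p - 1) = y_power_der (to_fract (pderiv f)) (p - 1)"
    using y_power_der_commutator[of "p - 1" "to_fract f"] by (simp add: pol_def)
  also have "\<dots> = (\<Sum>j<p - 1. ?t (Suc j))"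
    unfolding y_power_der_p_minus_1 iterate_fract_deriv_to_fract
    by (intro sum.cong refl) (simp add: pol_def funpow_swap1)
  finally have "yy ^ (p - 1) * pol f = ?t 0 + (\<Sum>j<p - 1. ?t (Suc j))"
    by (simp add: algebra_simps)
  also have "\<dots> = (\<Sum>j<p - 1. ?t j) + ?t (p - 1)"
    by (rule trans[OF sum.lessThan_Suc_shift[symmetric] sum.lessThan_Suc])
  finally show ?thesis
    using p_pos by simp
qed

text \<open>Induction on \<open>f\<close> by means of $E_x(xf) = y^{p-1}f + xE_x(f)$. Only the terms of positive degree in \<open>y\<close> have a
  simple form; the constant term \<open>s\<close> involves a divided derivative of order \<open>p\<close> and is left implicit.\<close>
lemma E_pol: "\<exists>s. E (pol f) = (\<Sum>j<p - 1. coef (Suc j) * (pol ((pderiv ^^ Suc j) f) * yy ^ (p - Suc j))) + pol s"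
proof (induction f)
  case 0
  have "E 0 = 0"
    using E_scal[of 0] by simp
  then show ?case
    by (auto simp: iterate_pderiv_0 simp del: funpow.simps intro!: exI[of _ 0])
next
  case (pCons a f)
  let ?y = "\<lambda>j. yy ^ (p - Suc j) :: 'a rat_weyl"
  obtain s where s: "E (pol f) = (\<Sum>j<p - 1. coef (Suc j) * (pol ((pderiv ^^ Suc j) f) * ?y j)) + pol s"
    using pCons by blast
  let ?s' = "(- 1) ^ (p - 1) * (pderiv ^^ (p - 1)) f + [:0, 1:] * s"
  have 1: "coef (Suc j) * (pol ((pderiv ^^ Suc j) (pCons a f)) * ?y j)
      = (- 1) ^ j * (pol ((pderiv ^^ j) f) * ?y j) + xx * (coef (Suc j) * (pol ((pderiv ^^ Suc j) f) * ?y j))"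
    if "j < p - 1" for j
  proof -
    have "coef (Suc j) * (xx * x) = xx * (coef (Suc j) * x)" for x
      by (simp add: coef_def scal_left)
    moreover have "coef (Suc j) * (of_nat (Suc j) * x) = (- 1) ^ j * x" for x
      using coef_of_nat[of j] that by (simp only: mult.assoc[symmetric])
    ultimately show ?thesis
      unfolding pol_iterate_pCons by (simp only: distrib_left distrib_right mult.assoc add.commute)
  qed
  have m1: "pol ((- 1) ^ j * g) = (- 1) ^ j * pol g" for j g
    by (simp add: pol_mult pol_power pol_minus pol_1)
  have "E (pol (pCons a f)) = yy ^ (p - 1) * pol f + xx * E (pol f)"
    by (simp add: pol_pCons E_D E_scal E_xx pol_in_Weyl1 xx_in_Weyl[of 1, folded Weyl1_eq] Weyl1_closed)
  also have "\<dots> = (\<Sum>j<p - 1. coef (Suc j) * (pol ((pderiv ^^ Suc j) (pCons a f)) * ?y j)) + pol ?s'"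
    unfolding yy_power_pol s
    by (simp add: 1 sum.distrib sum_distrib_left distrib_left pol_add m1 pol_pCons[of 0]
      del: funpow.simps)
  finally show ?case
    by blast
qed

end

section \<open>The derivation $\breve E_x$\<close>

lemma power_dvd_pderiv:
  assumes "h ^ Suc n dvd f"
  shows "h ^ n dvd pderiv (f :: 'a::field poly)"
proof -
  obtain g where g: "f = h ^ Suc n * g"
    using assms by (rule dvdE)
  have "pderiv f = h ^ n * (h * pderiv g + smult (of_nat (Suc n)) (g * pderiv h))"
    unfolding g by (simp only: pderiv_mult pderiv_power_Suc) (simp add: algebra_simps del: of_nat_Suc)
  then show ?thesis
    by (metis dvd_triv_left)
qed

text \<open>Expand $h\,(h^jg)' = h^{j+1}g' + j h' h^j g$ with $h^jg = h^nqs$.\<close>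
lemma dvd_pderiv_step:
  fixes h q g :: "'a::field poly"
  assumes "pderiv q = 0" "h ^ n * q dvd h ^ j * g"
  shows "h ^ n * q dvd h ^ Suc j * pderiv g"
proof -
  obtain s where s: "h ^ j * g = h ^ n * q * s"
    using assms(2) by (rule dvdE)
  have "h * pderiv (h ^ j * g) = h ^ Suc j * pderiv g + of_nat j * pderiv h * (h ^ j * g)"
    using mult_pderiv_power[of h j] by (simp add: pderiv_mult algebra_simps)
  moreover have "h * pderiv (h ^ n * q * s) = h ^ n * q * (of_nat n * pderiv h * s + h * pderiv s)"
    using mult_pderiv_power[of h n] assms(1) by (simp add: pderiv_mult algebra_simps)
  ultimately have "h ^ Suc j * pderiv g
      = h ^ n * q * (of_nat n * pderiv h * s + h * pderiv s) - of_nat j * pderiv h * (h ^ n * q * s)"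
    unfolding s by (simp add: eq_diff_eq)
  also have "\<dots> = h ^ n * q * (of_nat n * pderiv h * s + h * pderiv s - of_nat j * pderiv h * s)"
    by (simp add: algebra_simps)
  finally show ?thesis
    by (metis dvd_triv_left)
qed

text \<open>All terms of $h\,(h^ns)' - h'h^ns$ contain \<open>h\<close> or its derivative as an additional factor, and \<open>q\<close> divides both.\<close>
lemma dvd_pderiv_gain:
  fixes h q g :: "'a::field poly"
  assumes "q dvd h" "q dvd pderiv h" "h ^ n dvd h * g"
  shows "h ^ n * q dvd h ^ 2 * pderiv g"
proof -
  obtain s where s: "h * g = h ^ n * s"
    using assms(3) by (rule dvdE)
  have "h * pderiv (h * g) = h ^ 2 * pderiv g + pderiv h * (h * g)"
    by (simp add: pderiv_mult power2_eq_square algebra_simps)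
  moreover have "h * pderiv (h ^ n * s) = h ^ n * (of_nat n * pderiv h * s + h * pderiv s)"
    using mult_pderiv_power[of h n] by (simp add: pderiv_mult algebra_simps)
  ultimately have "h ^ 2 * pderiv g = h ^ n * (of_nat n * pderiv h * s + h * pderiv s) - pderiv h * (h ^ n * s)"
    unfolding s by (simp add: eq_diff_eq)
  also have "\<dots> = h ^ n * (pderiv h * (of_nat n * s - s) + h * pderiv s)"
    by (simp add: algebra_simps)
  also have "h ^ n * q dvd \<dots>"
    using assms(1,2) by (intro mult_dvd_mono dvd_add dvd_mult2 dvd_refl)
  finally show ?thesis .
qed

context weyl_poly
begin

lemma yy_monom_in_Weyl:
  assumes "h ^ Suc n dvd f"
  shows "yy * (pol f * yy ^ n) \<in> A"
proof -
  have "yy * (pol f * yy ^ n) = pol f * yy ^ Suc n + pol (pderiv f) * yy ^ n"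
    by (simp add: yy_pol distrib_right mult.assoc flip: mult.assoc[of yy])
  also have "\<dots> \<in> A"
    using assms by (intro Weyl_closed(9) monom_in_Weyl power_dvd_pderiv)
  finally show ?thesis .
qed

lemma gam_delta0: "gam * delta0 h r = pderiv r * h - r * pi_poly h * pderiv gam"
proof -
  have "to_fract r * to_fract (pi_poly h) * inverse (to_fract h) = Fract r gam"
    using w_alt by (simp add: Fract_conv_to_fract field_simps)
  then have "to_fract (delta0 h r) = fract_deriv (Fract r gam) * to_fract h"
    by (simp only: to_fract_delta0)
  then have "to_fract (gam * delta0 h r) = to_fract gam * (fract_deriv (Fract r gam) * to_fract (gam * pi_poly h))"
    by (simp only: to_fract_mult[of gam "delta0 h r"] gam_pi)
  also have "\<dots> = to_fract ((pderiv r * gam - r * pderiv gam) * pi_poly h)"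
    unfolding fract_deriv_Fract[OF gam_nz] using gam_nz by (simp add: Fract_conv_to_fract)
  finally have "gam * delta0 h r = (pderiv r * gam - r * pderiv gam) * pi_poly h"
    by (simp only: to_fract_eq_iff)
  also have "\<dots> = pderiv r * (gam * pi_poly h) - r * pi_poly h * pderiv gam"
    by (simp add: algebra_simps)
  finally show ?thesis
    by (simp only: gam_pi)
qed

end

context weyl_char_p
begin

text \<open>The central factor by which $\breve E_x$ and $E_x$ differ.\<close>
definition kappa :: "'a poly" where
  "kappa = h ^ p div rho"

lemma rho_kappa: "rho * kappa = h ^ p"
proof -
  have "rho dvd h ^ p"
    using rho_dvd dvd_power[of p h] p_pos by (blast intro: dvd_trans)
  then show ?thesis
    by (simp add: kappa_def)
qed

lemma pderiv_kappa: "pderiv kappa = 0"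
proof -
  have "rho * pderiv kappa = 0"
    using arg_cong[OF rho_kappa, of pderiv] by (simp add: pderiv_mult pderiv_rho pderiv_power_p)
  then show ?thesis
    using rho_nz by simp
qed

lemma rho_dvd_pderiv: "rho dvd pderiv h"
  using dvd_trans[OF rho_gam gam_dvd_pderiv] .

lemma kappa_eq: "kappa = h ^ (p - 1) * (h div rho)"
proof -
  have "rho * kappa = rho * (h ^ (p - 1) * (h div rho))"
    using rho_dvd p_pos by (simp add: rho_kappa mult.left_commute[of rho] power_eq_if mult.commute)
  then show ?thesis
    using rho_nz by simp
qed

lemma power_dvd_kappa: "n < p \<Longrightarrow> h ^ n dvd kappa"
  unfolding kappa_eq by (intro dvd_mult2 le_imp_power_dvd) simp

lemma power_dvd_kappa_mult:
  assumes "h ^ n * rho dvd h ^ j * f" "j \<le> p"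
  shows "h ^ (p - j + n) dvd kappa * f"
proof -
  have "h ^ (p - j) * (h ^ n * rho) dvd h ^ (p - j) * (h ^ j * f)"
    using assms(1) by simp
  also have "\<dots> = rho * (kappa * f)"
    using assms(2) rho_kappa by (simp flip: mult.assoc power_add)
  finally have "rho * h ^ (p - j + n) dvd rho * (kappa * f)"
    by (simp add: power_add ac_simps)
  then show ?thesis
    using rho_nz by simp
qed

lemma cf_kappa: "cf (to_fract (h ^ p) / to_fract rho) = pol kappa"
proof -
  have "to_fract (h ^ p) = to_fract rho * to_fract kappa"
    by (simp only: rho_kappa flip: to_fract_mult)
  then show ?thesis
    using rho_nz by (simp add: pol_def)
qed

lemma kappa_central: "a \<in> Weyl1 \<Longrightarrow> pol kappa * a = a * pol kappa"
  by (rule pol_const_central[OF pderiv_kappa])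

abbreviation Eb :: "'a rat_weyl \<Rightarrow> 'a rat_weyl" where
  "Eb \<equiv> E_breve h"

lemma Eb_eq: "a \<in> A \<Longrightarrow> Eb a = pol kappa * E a"
  by (simp add: E_breve_def char cf_kappa)

lemma Eb_outside: "a \<notin> A \<Longrightarrow> Eb a = 0"
  by (simp add: E_breve_def)

lemma kappa_E_pol: "\<exists>s. pol kappa * E (pol f)
  = (\<Sum>j<p - 1. coef (Suc j) * (pol (kappa * (pderiv ^^ Suc j) f) * yy ^ (p - Suc j))) + pol (kappa * s)"
proof -
  obtain s where s: "E (pol f) = (\<Sum>j<p - 1. coef (Suc j) * (pol ((pderiv ^^ Suc j) f) * yy ^ (p - Suc j))) + pol s"
    using E_pol by blast
  have "pol kappa * (coef j * (pol g * x)) = coef j * (pol (kappa * g) * x)" for j g x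
    by (simp add: coef_def scal_left pol_mult mult.assoc)
  then have "pol kappa * E (pol f)
      = (\<Sum>j<p - 1. coef (Suc j) * (pol (kappa * (pderiv ^^ Suc j) f) * yy ^ (p - Suc j))) + pol (kappa * s)"
    unfolding s by (simp add: distrib_left sum_distrib_left pol_mult del: funpow.simps)
  then show ?thesis
    by blast
qed

lemma coef_in: "coef j \<in> A"
  by (simp add: coef_def Weyl_closed)

text \<open>Here $\kappa h^{(j)} = h^p t^{(j)}$ for \<open>h = rho * t\<close>, which has enough factors \<open>h\<close> to compensate for
  $y^{p-j+1}$.\<close>
lemma kappa_E_yhat_in: "pol kappa * E (yhat h) \<in> A"
proof -
  obtain t where t: "h = rho * t"
    using rho_dvd by (rule dvdE)
  obtain s where s: "pol kappa * E (pol h)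
      = (\<Sum>j<p - 1. coef (Suc j) * (pol (kappa * (pderiv ^^ Suc j) h) * yy ^ (p - Suc j))) + pol (kappa * s)"
    using kappa_E_pol by blast
  have "pol kappa * E (yhat h) = yy * (pol kappa * E (pol h))"
    using kappa_central[OF yy_in_Weyl1] by (simp add: yhat_def E_D E_yy yy_in_Weyl1 pol_in_Weyl1 flip: mult.assoc)
  also have "\<dots> = (\<Sum>j<p - 1. coef (Suc j) * (yy * (pol (kappa * (pderiv ^^ Suc j) h) * yy ^ (p - Suc j))))
      + yy * (pol (kappa * s) * yy ^ 0)"
    unfolding s by (simp add: distrib_left sum_distrib_left coef_def scal_left del: funpow.simps)
  also have "\<dots> \<in> A"
  proof (rule Weyl_closed(9)[OF Weyl_closed(7)[OF Weyl_closed(10)[OF coef_in yy_monom_in_Weyl]] yy_monom_in_Weyl])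
    fix j assume "j \<in> {..<p - 1}"
    then have j: "Suc (p - Suc j) \<le> p"
      using p_pos by auto
    have "kappa * (pderiv ^^ Suc j) (rho * t) = rho * kappa * (pderiv ^^ Suc j) t"
      unfolding iterate_pderiv_mult_const[OF pderiv_rho] by (simp only: ac_simps)
    then have "kappa * (pderiv ^^ Suc j) h = h ^ p * (pderiv ^^ Suc j) t"
      by (simp only: t[symmetric] rho_kappa)
    then show "h ^ Suc (p - Suc j) dvd kappa * (pderiv ^^ Suc j) h"
      using j by (simp only:) (intro dvd_mult2 le_imp_power_dvd)
  next
    show "h ^ Suc 0 dvd kappa * s"
      using p_ge_2 by (intro dvd_mult2 power_dvd_kappa) auto
  qed
  finally show ?thesis .
qed

lemma Eb_Der: "Eb \<in> Der A"
proof (rule W_Der_I)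
  show "Eb a \<in> A" if "a \<in> A" for a
  proof -
    have "pol kappa * E a \<in> A"
      using that
    proof (induction rule: Weyl_induct)
      case xx
      show ?case
        unfolding E_xx using p_pos by (intro monom_in_Weyl power_dvd_kappa) simp
    next
      case yhat
      show ?case
        by (rule kappa_E_yhat_in)
    next
      case (scal c)
      show ?case
        by (simp add: E_scal Weyl_closed)
    next
      case (add a b)
      then show ?case
        by (simp add: E_D Weyl_sub_Weyl1 distrib_left Weyl_closed)
    next
      case (mult a b)
      have "pol kappa * E (a * b) = pol kappa * E a * b + a * (pol kappa * E b)"
        using mult.hyps kappa_central[of a]
        by (simp add: E_D Weyl_sub_Weyl1 distrib_left) (simp flip: mult.assoc)
      with mult show ?case
        by (simp add: Weyl_closed)
    qed
    then show ?thesis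
      using that by (simp add: Eb_eq)
  qed
  show "Eb (a + b) = Eb a + Eb b" if "a \<in> A" "b \<in> A" for a b
    using that by (simp add: Eb_eq E_D Weyl_sub_Weyl1 distrib_left Weyl_closed)
  show "Eb (scal c * a) = scal c * Eb a" if "a \<in> A" for c a
    using that by (simp add: Eb_eq E_D E_scal Weyl_sub_Weyl1 scal_left Weyl_closed)
  show "Eb (a * b) = Eb a * b + a * Eb b" if "a \<in> A" "b \<in> A" for a b
    using that kappa_central[of a]
    by (simp add: Eb_eq E_D Weyl_sub_Weyl1 distrib_left Weyl_closed) (simp flip: mult.assoc)
qed (simp add: Eb_outside)

text \<open>The restriction of $\kappa E_x$ to the subalgebra is $\breve E_x$, and the formula is the
  Leibniz rule in $A_1$, where \<open>u\<close> lives.\<close>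
lemma lie_Eb_ad:
  assumes u: "u \<in> Weyl1" "\<And>a. a \<in> A \<Longrightarrow> u * a - a * u \<in> A"
  shows "lie Eb (ad A u) = ad A (pol kappa * E u)"
proof
  fix a show "lie Eb (ad A u) a = ad A (pol kappa * E u) a"
  proof (cases "a \<in> A")
    case True
    have a: "a \<in> Weyl1"
      using True by (rule Weyl_sub_Weyl1)
    have "pol kappa * E (u * a - a * u) = pol kappa * (E u * a + u * E a - (E a * u + a * E u))"
      using u(1) a by (simp add: E_diff E_D Weyl1_closed)
    also have "\<dots> = (pol kappa * E u * a - a * (pol kappa * E u)) + (u * (pol kappa * E a) - (pol kappa * E a) * u)"
    proof -
      have "u * (pol kappa * x) = pol kappa * (u * x)" "a * (pol kappa * x) = pol kappa * (a * x)" for x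
        using kappa_central[OF u(1)] kappa_central[OF a] by (simp_all flip: mult.assoc)
      then show ?thesis
        by (simp add: algebra_simps)
    qed
    moreover have "pol kappa * E a \<in> A"
      using W_Der_D(1)[OF Eb_Der True] True by (simp add: Eb_eq)
    ultimately show ?thesis
      using True u(2)[OF True] by (simp add: lie_def ad_def Eb_eq W_Der_D[OF Eb_Der])
  qed (simp add: lie_def ad_def Eb_outside W_Der_0[OF Eb_Der])
qed

end

lemma to_fract_of_nat: "to_fract (of_nat n) = of_nat n"
  by (induction n) simp_all

context weyl_char_p
begin

section \<open>The bracket of $\breve E_x$ with the derivations $\mathrm{ad}_{ra_n}$\<close>

definition zeta :: "nat \<Rightarrow> 'a poly \<Rightarrow> 'a poly" where
  "zeta n r = (gam div rho) * delta0 h r + of_nat n * r * (pderiv h div rho)"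

lemma rho_zeta: "rho * zeta n r = gam * delta0 h r + of_nat n * r * pderiv h"
proof -
  have "rho * (gam div rho) = gam" "rho * (pderiv h div rho) = pderiv h"
    using rho_gam rho_dvd_pderiv by simp_all
  moreover have "rho * zeta n r = (rho * (gam div rho)) * delta0 h r + of_nat n * r * (rho * (pderiv h div rho))"
    unfolding zeta_def by (simp only: algebra_simps)
  ultimately show ?thesis
    by simp
qed

lemma cf_zeta:
  "cf (to_fract h / to_fract (pi_poly h * rho) * to_fract (delta0 h r)
      + of_nat n * to_fract r * (to_fract (pderiv h) / to_fract rho)) = pol (zeta n r)"
proof -
  have 1: "to_fract h = to_fract gam * to_fract (pi_poly h)"
    by (simp only: gam_pi flip: to_fract_mult)
  have 2: "to_fract rho * to_fract (zeta n r) = to_fract gam * to_fract (delta0 h r) + of_nat n * to_fract r * to_fract (pderiv h)"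
    using arg_cong[OF rho_zeta, of to_fract] by (simp add: to_fract_of_nat)
  have "to_fract h / to_fract (pi_poly h * rho) = to_fract gam / to_fract rho"
    unfolding 1 using pi_nz by simp
  then have "to_fract h / to_fract (pi_poly h * rho) * to_fract (delta0 h r)
      + of_nat n * to_fract r * (to_fract (pderiv h) / to_fract rho)
    = (to_fract gam * to_fract (delta0 h r) + of_nat n * to_fract r * to_fract (pderiv h)) / to_fract rho"
    by (simp add: add_divide_distrib)
  also have "\<dots> = to_fract (zeta n r)"
    unfolding 2[symmetric] using rho_nz by simp
  finally show ?thesis
    by (simp add: pol_def)
qed

text \<open>This identifies the leading coefficient of $E_x(ra_n)$. It follows by differentiating
  $\mathsf{gam}\cdot r\pi_hh^{n-1} = rh^n$.\<close>
lemma gam_pderiv_a: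
  assumes "n \<ge> 1"
  shows "gam * pderiv (r * pi_poly h * h ^ (n - 1)) = rho * zeta n r * h ^ (n - 1)"
proof -
  obtain m where n: "n = Suc m"
    using assms by (cases n) auto
  let ?f = "r * pi_poly h * h ^ m"
  have "gam * ?f = r * (gam * pi_poly h) * h ^ m"
    by (simp only: ac_simps)
  then have f: "gam * ?f = r * h ^ n"
    by (simp add: gam_pi n mult.assoc)
  have "gam * pderiv ?f + ?f * pderiv gam = pderiv r * h ^ n + of_nat n * r * h ^ m * pderiv h"
    using arg_cong[OF f, of pderiv] unfolding n pderiv_mult pderiv_power_Suc
    by (simp add: of_nat_poly algebra_simps del: power_Suc of_nat_Suc)
  then have "gam * pderiv ?f = (pderiv r * h - r * pi_poly h * pderiv gam) * h ^ m + of_nat n * r * pderiv h * h ^ m"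
    by (simp add: n algebra_simps del: of_nat_Suc)
  then show ?thesis
    unfolding rho_zeta gam_delta0 by (simp add: n distrib_right del: of_nat_Suc)
qed

lemma w_pol_gam: "w * pol (gam * f) = pol f"
  by (simp add: pol_mult w_gam flip: mult.assoc)

lemma w_Y_eq_monom:
  assumes "n \<ge> 1"
  shows "w * (pol r * Y n) = pol (r * pi_poly h * h ^ (n - 1)) * yy ^ n"
proof -
  obtain m where n: "n = Suc m"
    using assms by (cases n) auto
  have "r * h ^ n = (gam * pi_poly h) * (r * h ^ m)"
    by (simp add: gam_pi n)
  also have "\<dots> = gam * (r * pi_poly h * h ^ (n - 1))"
    by (simp add: n)
  finally have eq: "r * h ^ n = gam * (r * pi_poly h * h ^ (n - 1))" .
  have "w * (pol r * Y n) = w * pol (r * h ^ n) * yy ^ n"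
    by (simp add: Y_def pol_mult mult.assoc)
  then show ?thesis
    by (simp only: eq w_pol_gam)
qed

text \<open>Write $ra_n = fy^n$. The first summand of \<open>E_pol\<close> gives the element subtracted here. In the
  summands with a derivative of order at least two, \<open>gain\<close> provides the factor $\varrho_h$ that turns the denominator
  of $\kappa = h^p/\varrho_h$ into an extra divisibility; the constant term is
  multiplied by $\kappa$, a multiple of $h^{p-1}$ and hence of $h^n$.\<close>
lemma kappa_E_a:
  assumes n: "1 \<le> n" "n < p"
  shows "pol kappa * E (w * (pol r * Y n)) - z * (w * (pol (zeta n r) * Y (n - 1))) \<in> A"
proof -
  define f where "f = r * pi_poly h * h ^ (n - 1)"
  have f: "w * (pol r * Y n) = pol f * yy ^ n"
    unfolding f_def by (rule w_Y_eq_monom[OF n(1)])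
  have gf: "gam * pderiv f = rho * zeta n r * h ^ (n - 1)"
    unfolding f_def by (rule gam_pderiv_a[OF n(1)])
  have hn: "h ^ n = h * h ^ (n - 1)"
    using n by (cases n) auto
  obtain s where s: "pol kappa * E (pol f)
      = (\<Sum>j<p - 1. coef (Suc j) * (pol (kappa * (pderiv ^^ Suc j) f) * yy ^ (p - Suc j))) + pol (kappa * s)"
    using kappa_E_pol by blast
  let ?t = "\<lambda>j. coef (Suc j) * (pol (kappa * (pderiv ^^ Suc j) f) * yy ^ (p - Suc j + n))"
  have p1: "p - 1 = Suc (p - 2)"
    using p_ge_2 by simp
  have "pol kappa * E (w * (pol r * Y n)) = pol kappa * E (pol f) * yy ^ n"
    unfolding f by (simp add: E_D pol_in_Weyl1 yy_in_Weyl1 Weyl1_closed E_yy_power mult.assoc)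
  also have "\<dots> = (\<Sum>j<p - 1. ?t j) + pol (kappa * s) * yy ^ n"
    unfolding s by (simp only: distrib_right sum_distrib_right mult.assoc power_add)
  also have "(\<Sum>j<p - 1. ?t j) = ?t 0 + (\<Sum>j<p - 2. ?t (Suc j))"
    unfolding p1 by (rule sum.lessThan_Suc_shift)
  finally have split: "pol kappa * E (w * (pol r * Y n)) = ?t 0 + ((\<Sum>j<p - 2. ?t (Suc j)) + pol (kappa * s) * yy ^ n)"
    by (simp only: add.assoc)
  have kf: "w * pol (zeta n r * h ^ p * h ^ (n - 1)) = pol (kappa * pderiv f)"
  proof -
    have "gam * (kappa * pderiv f) = kappa * (gam * pderiv f)"
      by (simp only: ac_simps)
    also have "\<dots> = (rho * kappa) * zeta n r * h ^ (n - 1)"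
      unfolding gf by (simp only: ac_simps)
    finally have "zeta n r * h ^ p * h ^ (n - 1) = gam * (kappa * pderiv f)"
      unfolding rho_kappa by (simp only: ac_simps)
    then show ?thesis
      by (simp only: w_pol_gam)
  qed
  have "z * (w * (pol (zeta n r) * Y (n - 1))) = w * (pol (zeta n r) * (z * Y (n - 1)))"
    using z_central[OF pol_in_Weyl] by (simp add: z_w flip: mult.assoc) (simp add: mult.assoc)
  also have "z * Y (n - 1) = pol (h ^ p * h ^ (n - 1)) * yy ^ (p + (n - 1))"
    using z_power_Y[of 1 "n - 1"] by (simp add: Y_def power_add)
  also have "w * (pol (zeta n r) * \<dots>) = w * pol (zeta n r * h ^ p * h ^ (n - 1)) * yy ^ (p + (n - 1))"
    by (simp add: pol_mult mult.assoc)
  also have "\<dots> = ?t 0"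
    unfolding kf using n p_pos by (simp add: coef_1[simplified])
  finally have lead: "z * (w * (pol (zeta n r) * Y (n - 1))) = ?t 0" .
  have base: "h ^ n dvd h * pderiv f"
  proof -
    obtain g where g: "pderiv h = gam * g"
      using gam_dvd_pderiv by (rule dvdE)
    have "gam * (h * pderiv f) = (rho * zeta n r) * h ^ n"
      unfolding hn using gf by (simp add: algebra_simps)
    also have "\<dots> = gam * (h ^ n * (delta0 h r + of_nat n * r * g))"
      unfolding rho_zeta g by (simp only: algebra_simps)
    finally show ?thesis
      using gam_nz by simp
  qed
  \<comment> \<open>the factor \<open>rho\<close> appears with the second derivative and persists\<close>
  have gain: "h ^ n * rho dvd h ^ Suc (Suc j) * (pderiv ^^ Suc (Suc j)) f" for j
  proof (induction j)
    case 0
    show ?case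
      using dvd_pderiv_gain[OF rho_dvd rho_dvd_pderiv base] by (simp add: power2_eq_square)
  next
    case (Suc j)
    then show ?case
      using dvd_pderiv_step[OF pderiv_rho, of h n "Suc (Suc j)"] by (simp del: power_Suc)
  qed
  have "?t (Suc j) \<in> A" if "j < p - 2" for j
    using that by (intro Weyl_closed(10)[OF coef_in monom_in_Weyl[OF power_dvd_kappa_mult[OF gain]]]) auto
  then have "(\<Sum>j<p - 2. ?t (Suc j)) + pol (kappa * s) * yy ^ n \<in> A"
    using power_dvd_kappa[OF n(2)] by (intro Weyl_closed(9) Weyl_closed(7) monom_in_Weyl dvd_mult2) auto
  then show ?thesis
    unfolding split lead by simp
qed

end

context weyl_char_p
begin

section \<open>Central elements and the derivation $\breve E_x$\<close>

lemma E_xx_power_p: "\<exists>c. E (pol ([:0, 1:] ^ p)) = pol c"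
proof -
  have "(pderiv ^^ Suc j) ([:0, 1:] ^ p :: 'a poly) = 0" for j
    by (simp only: funpow_Suc_right o_apply pderiv_power_p iterate_pderiv_0)
  then show ?thesis
    using E_pol[of "[:0, 1:] ^ p"] by (simp del: funpow.simps)
qed

text \<open>By the Leibniz rule and additivity of the Frobenius map, $f \mapsto E_x(f^p)$ is a derivation
  along the Frobenius map; it is determined by its value \<open>c\<close> at \<open>x\<close>.\<close>
lemma E_power_p: "\<exists>c. \<forall>f. E (pol (f ^ p)) = pol (c * pderiv f ^ p)"
proof -
  obtain c where c: "E (pol ([:0, 1:] ^ p)) = pol c"
    using E_xx_power_p by blast
  have "E (pol (f ^ p)) = pol (c * pderiv f ^ p)" for f
  proof (induction f)
    case 0
    then show ?case
      using p_pos E_scal[of 0] by (simp add: power_0_left)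
  next
    case (pCons a f)
    have fresh: "(u + v) ^ p = u ^ p + v ^ p" for u v :: "'a poly"
      using prime_p by (intro freshmans_dream) (simp_all add: char)
    have "pCons a f = [:a:] + [:0, 1:] * f"
      by simp
    then have "pCons a f ^ p = [:a:] ^ p + [:0, 1:] ^ p * f ^ p"
      by (simp only: fresh power_mult_distrib)
    also have "[:a:] ^ p = [:a ^ p:]"
      by (simp add: poly_const_pow)
    finally have "E (pol (pCons a f ^ p)) = pol c * pol (f ^ p) + pol ([:0, 1:] ^ p) * E (pol (f ^ p))"
      by (simp add: pol_add pol_mult E_D E_scal[unfolded scal_def] c pol_in_Weyl1 Weyl1_closed)
    also have "\<dots> = pol (c * f ^ p + [:0, 1:] ^ p * (c * pderiv f ^ p))"
      by (simp only: pCons.IH pol_add pol_mult)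
    also have "c * f ^ p + [:0, 1:] ^ p * (c * pderiv f ^ p) = c * (f + [:0, 1:] * pderiv f) ^ p"
      unfolding fresh power_mult_distrib by (simp only: distrib_left ac_simps)
    finally show ?case
      by (simp add: pderiv_pCons)
  qed
  then show ?thesis
    by blast
qed

text \<open>The value of $\breve E_x$ at $\mathsf z_h$ is $h^p c (h')^p \varrho_h^{-1} y^p$ with $c \in \mathbb F[x]$. Of the
  factors $h'$, at least two in number, one is divisible by \<open>gam\<close> and compensates for \<open>w\<close>,
  and another one is divisible by $\varrho_h$.\<close>
lemma Eb_z: "Eb z \<in> A" "w * Eb z \<in> A" "a \<in> A \<Longrightarrow> Eb z * a = a * Eb z"
proof -
  obtain c where c: "\<And>f. E (pol (f ^ p)) = pol (c * pderiv f ^ p)"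
    using E_power_p by blast
  let ?f = "kappa * (c * pderiv h ^ p)"
  have Ez: "Eb z = pol ?f * yy ^ p"
    unfolding Eb_eq[OF z_in] unfolding z_eq
    by (simp add: E_D pol_in_Weyl1 yy_in_Weyl1 Weyl1_closed E_yy_power c pol_mult[of kappa] mult.assoc)
  show "Eb z \<in> A"
    using z_in Eb_Der by (rule W_Der_D(1)[rotated])
  show "Eb z * a = a * Eb z" if "a \<in> A"
  proof -
    have "Eb z * a + z * Eb a = Eb a * z + a * Eb z"
      using W_Der_D(5)[OF Eb_Der z_in that] W_Der_D(5)[OF Eb_Der that z_in] z_central[OF that] by simp
    then show ?thesis
      using z_central[OF W_Der_D(1)[OF Eb_Der that]] by simp
  qed
  obtain g where g: "pderiv h = gam * g"
    using gam_dvd_pderiv by (rule dvdE)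
  obtain g' where g': "pderiv h = rho * g'"
    using rho_dvd_pderiv by (rule dvdE)
  have "pderiv h ^ p = pderiv h * pderiv h * pderiv h ^ (p - 2)"
    using p_ge_2 by (metis le_add_diff_inverse power2_eq_square power_add)
  then have eq: "?f = gam * ((rho * kappa) * (g * c * g' * pderiv h ^ (p - 2)))"
    by (simp add: g) (simp add: g' flip: g)
  have "w * Eb z = w * pol ?f * yy ^ p"
    by (simp only: Ez mult.assoc)
  then have "w * Eb z = pol (h ^ p * (g * c * g' * pderiv h ^ (p - 2))) * yy ^ p"
    by (simp only: eq w_pol_gam rho_kappa)
  then show "w * Eb z \<in> A"
    by (simp add: monom_in_Weyl)
qed

lemma Eb_z_power: "Eb (z ^ K) \<in> A" "w * Eb (z ^ K) \<in> A" "a \<in> A \<Longrightarrow> Eb (z ^ K) * a = a * Eb (z ^ K)"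
proof -
  have zK: "z ^ K \<in> A" for K
    by (intro Weyl_closed z_in)
  show "Eb (z ^ K) \<in> A"
    using W_Der_D(1)[OF Eb_Der zK] .
  show "Eb (z ^ K) * a = a * Eb (z ^ K)" if "a \<in> A"
  proof -
    have "Eb (z ^ K) * a + z ^ K * Eb a = Eb a * z ^ K + a * Eb (z ^ K)"
      using W_Der_D(5)[OF Eb_Der zK that] W_Der_D(5)[OF Eb_Der that zK] z_power_central[OF that] by simp
    then show ?thesis
      using z_power_central[OF W_Der_D(1)[OF Eb_Der that]] by simp
  qed
  show "w * Eb (z ^ K) \<in> A"
  proof (induction K)
    case 0
    show ?case
      by (simp add: W_Der_1[OF Eb_Der] Weyl_closed)
  next
    case (Suc K)
    have "w * Eb (z ^ Suc K) = w * Eb z * z ^ K + z * (w * Eb (z ^ K))"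
      using W_Der_D(5)[OF Eb_Der z_in zK] by (simp add: distrib_left z_w flip: mult.assoc)
    also have "\<dots> \<in> A"
      by (intro Weyl_closed(9) Weyl_closed(10)[OF Eb_z(2) zK] Weyl_closed(10)[OF z_in Suc])
    finally show ?case .
  qed
qed

lemma zK_ad:
  assumes "u = w * x" "x \<in> A"
  shows "a \<in> A \<Longrightarrow> ad A (z ^ K * u) a = z ^ K * ad A u a"
  using z_power_central[of a K] by (simp add: ad_def right_diff_distrib mult.assoc) (simp flip: mult.assoc)

lemma pol_a_z:
  assumes "m = K * p + n"
  shows "pol r * a_elt h (int m) = z ^ K * (w * (pol r * Y n))"
proof -
  have "pol r * (z ^ K * Y n) = z ^ K * (pol r * Y n)"
    using z_power_central[OF pol_in_Weyl, of K r] by (simp flip: mult.assoc)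
  then show ?thesis
    unfolding pol_a_elt_nat assms z_power_Y[symmetric]
    using z_power_w[of K] by (simp flip: mult.assoc)
qed

text \<open>The difference of the two sides is $\breve E_x(\mathsf z_h^K)\,\mathrm{ad}_{ra_n}$. It is inner, because the central
  element in front moves \<open>w\<close> into \<open>A\<close>.\<close>
lemma lie_Eb_ad_reduce:
  assumes "m = K * p + n"
  shows "HH1_eq A (lie Eb (ad A (pol r * a_elt h (int m))))
           (lmul (z ^ K) (lie Eb (ad A (pol r * a_elt h (int n)))))"
proof -
  let ?x = "pol r * Y n"
  let ?u = "w * ?x"
  have x: "?x \<in> A"
    by (intro Weyl_closed pol_in_Weyl Y_in)
  have zK: "z ^ K \<in> A"
    by (intro Weyl_closed z_in)
  have in_A: "pol r * Y m \<in> A"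
    by (intro Weyl_closed pol_in_Weyl Y_in)
  note vc = Eb_z_power(3)[of _ K]
  show ?thesis
    unfolding pol_a_elt_nat[of r n]
  proof (rule W_HH1_eq_I)
    show "lie Eb (ad A (pol r * a_elt h (int m))) \<in> Der A"
      unfolding pol_a_elt_nat by (intro W_Der_lie Eb_Der ad_wA_Der in_A)
    show "lmul (z ^ K) (lie Eb (ad A ?u)) \<in> Der A"
      by (intro W_Der_lmul W_Der_lie Eb_Der ad_wA_Der x zK z_power_central)
    show v: "(w * Eb (z ^ K)) * ?x \<in> A"
      by (intro Weyl_closed(10)[OF Eb_z_power(2) x])
    fix a assume a: "a \<in> A"
    have ua: "?u * a - a * ?u \<in> A"
      using x a by (rule wA_normalizes)
    have Ea: "Eb a \<in> A"
      using W_Der_D(1)[OF Eb_Der a] .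
    have vw: "Eb (z ^ K) * w = w * Eb (z ^ K)"
      by (intro commutes_with_w vc pol_in_Weyl)
    have "lie Eb (ad A (z ^ K * ?u)) a = Eb (z ^ K * (?u * a - a * ?u)) - z ^ K * (?u * Eb a - Eb a * ?u)"
      using a Ea zK_ad[OF refl x a, of K] zK_ad[OF refl x Ea, of K] by (simp add: lie_def ad_def)
    also have "\<dots> = z ^ K * (Eb (?u * a - a * ?u) - (?u * Eb a - Eb a * ?u)) + Eb (z ^ K) * (?u * a - a * ?u)"
      using W_Der_D(5)[OF Eb_Der zK ua] by (simp add: right_diff_distrib)
    also have "Eb (z ^ K) * (?u * a - a * ?u) = (w * Eb (z ^ K)) * ?x * a - a * ((w * Eb (z ^ K)) * ?x)"
    proof -
      have "Eb (z ^ K) * (?u * a) = (Eb (z ^ K) * w) * ?x * a" "Eb (z ^ K) * (a * ?u) = (Eb (z ^ K) * a) * ?u"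
        by (simp_all only: mult.assoc)
      moreover have "a * Eb (z ^ K) * ?u = a * ((Eb (z ^ K) * w) * ?x)"
        by (simp only: mult.assoc)
      ultimately show ?thesis
        by (simp only: right_diff_distrib vw vc[OF a])
    qed
    finally show "lie Eb (ad A (pol r * a_elt h (int m))) a
        = lmul (z ^ K) (lie Eb (ad A ?u)) a + ((w * Eb (z ^ K)) * ?x * a - a * ((w * Eb (z ^ K)) * ?x))"
      unfolding pol_a_z[OF assms] using a Ea by (simp add: lmul_def lie_def ad_def)
  qed
qed

lemma lie_Eb_ad_pos:
  assumes n: "1 \<le> n" "n < p"
  shows "HH1_eq A (lmul (z ^ K) (lie Eb (ad A (pol r * a_elt h (int n)))))
           (lmul (z ^ (K + 1)) (ad A (pol (zeta n r) * a_elt h (int n - 1))))"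
proof -
  let ?u = "w * (pol r * Y n)"
  let ?y = "w * (pol (zeta n r) * Y (n - 1))"
  define c where "c = pol kappa * E ?u - z * ?y"
  have c: "c \<in> A"
    unfolding c_def by (rule kappa_E_a[OF n])
  have x: "pol s * Y i \<in> A" for s i
    by (intro Weyl_closed pol_in_Weyl Y_in)
  have zK: "z ^ K \<in> A" for K
    by (intro Weyl_closed z_in)
  have a1: "pol (zeta n r) * a_elt h (int n - 1) = ?y"
    using pol_a_elt_nat[of "zeta n r" "n - 1"] n by (simp add: of_nat_diff)
  have u1: "?u \<in> Weyl1"
    unfolding w_Y_eq_monom[OF n(1)] by (intro Weyl1_closed pol_in_Weyl1 yy_in_Weyl1)
  have lie: "lie Eb (ad A ?u) = ad A (pol kappa * E ?u)"
    using u1 wA_normalizes[OF x] by (rule lie_Eb_ad)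
  show ?thesis
    unfolding a1 pol_a_elt_nat[of r n]
  proof (rule W_HH1_eq_I)
    show "lmul (z ^ K) (lie Eb (ad A ?u)) \<in> Der A"
      by (intro W_Der_lmul W_Der_lie Eb_Der ad_wA_Der x zK z_power_central)
    show "lmul (z ^ (K + 1)) (ad A ?y) \<in> Der A"
      by (intro W_Der_lmul ad_wA_Der x zK z_power_central)
    show "z ^ K * c \<in> A"
      by (intro Weyl_closed(10) zK c)
    fix a assume a: "a \<in> A"
    have "lmul (z ^ K) (lie Eb (ad A ?u)) a = z ^ K * ((z * ?y + c) * a - a * (z * ?y + c))"
      unfolding lie using a by (simp add: lmul_def ad_def c_def)
    also have "\<dots> = z ^ K * (z * (?y * a - a * ?y)) + (z ^ K * c * a - z ^ K * a * c)"
    proof -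
      have "a * (z * ?y) = z * (a * ?y)"
        using z_central[OF a] by (simp flip: mult.assoc)
      then show ?thesis
        by (simp add: distrib_left distrib_right right_diff_distrib mult.assoc)
    qed
    also have "z ^ K * (z * (?y * a - a * ?y)) = lmul (z ^ (K + 1)) (ad A ?y) a"
      using a by (simp add: lmul_def ad_def mult.assoc power_commutes flip: mult.assoc[of "z ^ K" z])
    finally show "lmul (z ^ K) (lie Eb (ad A ?u)) a = lmul (z ^ (K + 1)) (ad A ?y) a + (z ^ K * c * a - a * (z ^ K * c))"
      using z_power_central[OF a, of K] by (simp add: mult.assoc)
  qed
qed

lemma lie_Eb_ad_0:
  "lie Eb (ad A (pol r * a_elt h (int 0))) = lie (D_der h (pol (delta0 h r))) Eb"
proof
  fix a
  let ?D = "D_der h (pol (delta0 h r))"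
  have "pol r * a_elt h (int 0) = pol r * w"
    unfolding pol_a_elt_nat by (simp add: Y_0 pol_w)
  then have ad: "ad A (pol r * a_elt h (int 0)) = - ?D"
    by (simp only: ad_w_eq)
  show "lie Eb (ad A (pol r * a_elt h (int 0))) a = lie ?D Eb a"
  proof (cases "a \<in> A")
    case True
    then show ?thesis
      unfolding ad by (simp add: lie_def W_Der_D[OF D_der_Der] W_Der_minus[OF Eb_Der])
  next
    case False
    then show ?thesis
      unfolding ad by (simp add: lie_def W_Der_D[OF D_der_Der] W_Der_D[OF Eb_Der] W_Der_0[OF Eb_Der] W_Der_0[OF D_der_Der])
  qed
qed

lemma HH1_eq_refl: "D \<in> Der B \<Longrightarrow> HH1_eq B D D"
  by (simp add: HH1_eq_def)

section \<open>The bracket of $D_g$ with $\breve E_x$\<close>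

text \<open>Formally $D_g$ maps \<open>y\<close> to $g/h$ and annihilates $\mathbb F(x)$. The induction along \<open>Y_Suc\<close> stays inside \<open>A\<close>.\<close>
lemma D_der_Y: "D_der h (pol g) (Y n) = pol (h ^ n) * y_power_der (to_fract g / to_fract h) n"
proof (induction n)
  case 0
  then show ?case
    by (simp add: Y_0 W_Der_1[OF D_der_Der])
next
  case (Suc n)
  let ?D = "D_der h (pol g)"
  let ?u = "to_fract g / to_fract h"
  let ?T = "y_power_der ?u n"
  have gu: "pol g = pol h * cf ?u"
    using h_nz by (simp add: pol_def flip: cf_mult)
  have g: "pol g * Y n = pol (h ^ Suc n) * cf ?u * yy ^ n"
    unfolding gu by (simp add: Y_def pol_mult mult.assoc cf_pol_commute flip: mult.assoc[of "cf ?u"])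
  have y: "yhat h * pol (h ^ n) = pol (h ^ Suc n) * yy + pol (of_nat (Suc n) * pderiv h * h ^ n)"
  proof -
    have "yhat h * pol (h ^ n) = pol h * pol (h ^ n) * yy + (pol (h * pderiv (h ^ n)) + pol (pderiv h * h ^ n))"
      by (simp add: yhat_eq distrib_right mult.assoc yy_pol distrib_left pol_mult)
    then show ?thesis
      unfolding mult_pderiv_power by (simp add: algebra_simps flip: pol_add pol_mult)
  qed
  have "?D (Y (Suc n)) = pol g * Y n + yhat h * ?D (Y n) - pol (of_nat (Suc n) * pderiv h) * ?D (Y n)"
    unfolding Y_Suc
    by (simp only: W_Der_diff[OF D_der_Der] W_Der_D[OF D_der_Der] D_der_yhat D_der_pol Weyl_closed Y_in
        pol_in_Weyl yhat_in_Weyl mult_zero_left add_0_left)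
  also have "\<dots> = pol (h ^ Suc n) * cf ?u * yy ^ n + pol (h ^ Suc n) * yy * ?T"
    unfolding Suc g
    by (simp only: mult.assoc[of "yhat h", symmetric] y mult.assoc[of "pol (of_nat (Suc n) * pderiv h)", symmetric]
       distrib_right pol_mult[of "of_nat (Suc n) * pderiv h" "h ^ n"] add_diff_eq[symmetric] diff_self add_0_right)
  finally show ?case
    by (simp add: distrib_left mult.assoc del: power_Suc)
qed

text \<open>With $u = g/h$ one has $h^2u' = g'h - gh'$, which $\varrho_h$ divides; as $\varrho_h' = 0$, differentiating
  $h^{i+2}u^{(i+1)}$ preserves this factor.\<close>
lemma rho_dvd_iterate:
  "\<exists>s. to_fract (h ^ (i + 2)) * (fract_deriv ^^ Suc i) (to_fract g / to_fract h) = to_fract (rho * s)"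
proof (induction i)
  case 0
  have "fract_deriv (to_fract g / to_fract h) = Fract (pderiv g * h - g * pderiv h) (h * h)"
    using fract_deriv_Fract[OF h_nz, of g] by (simp only: Fract_conv_to_fract)
  then have "to_fract (h ^ (0 + 2)) * (fract_deriv ^^ Suc 0) (to_fract g / to_fract h) = to_fract (pderiv g * h - g * pderiv h)"
    using h_nz by (simp add: Fract_conv_to_fract power2_eq_square)
  moreover have "rho dvd pderiv g * h - g * pderiv h"
    using rho_dvd rho_dvd_pderiv by (intro dvd_diff dvd_mult)
  ultimately show ?case
    by (metis dvdE)
next
  case (Suc i)
  let ?u = "\<lambda>i. (fract_deriv ^^ i) (to_fract g / to_fract h)"
  obtain s where s: "to_fract (h ^ (i + 2)) * ?u (Suc i) = to_fract (rho * s)"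
    using Suc by blast
  have "to_fract (h * pderiv (rho * s)) = to_fract h * fract_deriv (to_fract (h ^ (i + 2)) * ?u (Suc i))"
    unfolding s by (simp only: to_fract_mult[of h] fract_deriv_to_fract)
  also have "\<dots> = to_fract (h * pderiv (h ^ (i + 2))) * ?u (Suc i) + to_fract (h ^ (Suc i + 2)) * ?u (Suc (Suc i))"
    by (simp only: fract_deriv_mult fract_deriv_to_fract distrib_left to_fract_mult add_Suc power_Suc
      funpow.simps(2) o_apply mult.assoc)
  also have "to_fract (h * pderiv (h ^ (i + 2))) * ?u (Suc i) = to_fract (of_nat (i + 2) * pderiv h * (rho * s))"
    unfolding mult_pderiv_power to_fract_mult[of "of_nat (i + 2) * pderiv h"] s[symmetric] by (simp only: mult.assoc)
  finally have "to_fract (h ^ (Suc i + 2)) * ?u (Suc (Suc i))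
      = to_fract (h * pderiv (rho * s) - of_nat (i + 2) * pderiv h * (rho * s))"
    by (simp only: to_fract_diff) (simp only: add_diff_cancel_left')
  also have "h * pderiv (rho * s) - of_nat (i + 2) * pderiv h * (rho * s) = rho * (h * pderiv s - of_nat (i + 2) * pderiv h * s)"
    by (simp add: pderiv_mult pderiv_rho algebra_simps)
  finally show ?case
    by blast
qed

context
  fixes g :: "'a poly"
begin

definition b1 :: "'a rat_weyl" where
  "b1 = cf (to_fract (g * h ^ (p - 1)) / to_fract rho) * yy ^ (p - 1)"

definition b2_term :: "nat \<Rightarrow> 'a rat_weyl" where
  "b2_term j = cf ((- 1) ^ j * ((fract_deriv ^^ (j - 1)) (to_fract g * inverse (to_fract h))
      * to_fract (h ^ p) / to_fract rho)) * (scal (1 / of_nat (p - j)) * yy ^ (p - j))"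

lemma b1_eq: "b1 = w * (pol ((gam div rho) * g) * Y (p - 1))"
proof -
  have "to_fract gam = to_fract rho * to_fract (gam div rho)"
    using rho_gam by (simp flip: to_fract_mult)
  then have "to_fract (g * h ^ (p - 1)) / to_fract rho = (1 / to_fract gam) * to_fract ((gam div rho) * g * h ^ (p - 1))"
  proof -
    have "to_fract (gam div rho) \<noteq> 0"
      using \<open>to_fract gam = _\<close> gam_nz by auto
    then show ?thesis
      using \<open>to_fract gam = _\<close> rho_nz by (simp only: to_fract_mult) (simp add: field_simps)
  qed
  then have "b1 = w * pol ((gam div rho) * g * h ^ (p - 1)) * yy ^ (p - 1)"
    by (simp only: b1_def w_def w_alt pol_def cf_mult)
  then show ?thesis
    by (simp add: Y_def pol_mult mult.assoc)
qed

lemma b1_in_Weyl1: "b1 \<in> Weyl1"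
  unfolding b1_eq using p_ge_2 by (subst w_Y_eq_monom) (auto intro!: Weyl1_closed pol_in_Weyl1 yy_in_Weyl1)

lemma b1_normalizes: "a \<in> A \<Longrightarrow> b1 * a - a * b1 \<in> A"
  unfolding b1_eq by (intro wA_normalizes Weyl_closed(10) pol_in_Weyl Y_in)

lemma b1_normalizer: "b1 \<in> normalizer h"
  by (simp add: normalizer_def b1_in_Weyl1 b1_normalizes)

lemma b2_term_in:
  assumes "2 \<le> j" "j < p"
  shows "b2_term j \<in> A"
proof -
  obtain i where i: "j = i + 2"
    using assms(1) by (metis le_Suc_ex add.commute)
  obtain s where s: "to_fract (h ^ (i + 2)) * (fract_deriv ^^ Suc i) (to_fract g / to_fract h) = to_fract (rho * s)"
    using rho_dvd_iterate by blast
  have "p - j + (i + 2) = p"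
    using assms i by simp
  then have "h ^ p = h ^ (p - j) * h ^ (i + 2)"
    by (simp only: power_add[symmetric])
  then have "(fract_deriv ^^ (j - 1)) (to_fract g * inverse (to_fract h)) * to_fract (h ^ p) / to_fract rho
      = to_fract (h ^ (p - j)) * (to_fract (h ^ (i + 2)) * (fract_deriv ^^ Suc i) (to_fract g / to_fract h)) / to_fract rho"
    by (simp only: to_fract_mult) (simp add: i divide_inverse mult_ac del: funpow.simps)
  also have "\<dots> = to_fract (h ^ (p - j) * s)"
    unfolding s using rho_nz by simp
  also have "(- 1) ^ j * to_fract (h ^ (p - j) * s) = to_fract (h ^ (p - j) * ((- 1) ^ j * s))"
    by (simp add: to_fract_power)
  finally have "b2_term j = scal (1 / of_nat (p - j)) * (pol (h ^ (p - j) * ((- 1) ^ j * s)) * yy ^ (p - j))"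
    by (simp add: b2_term_def scal_cf_commute pol_def)
  then show ?thesis
    by (simp add: Weyl_closed monom_in_Weyl)
qed

lemma yy_power_xx_commutator: "cf f * (yy ^ n) * xx - xx * (cf f * yy ^ n) = of_nat n * (cf f * yy ^ (n - 1))"
proof -
  have "cf f * yy ^ n * xx = xx * (cf f * yy ^ n) + cf f * (of_nat n * yy ^ (n - 1))"
    by (simp add: mult.assoc yy_power_xx distrib_left) (simp add: cf_xx_commute flip: mult.assoc)
  then show ?thesis
    by (simp add: of_nat_left)
qed

text \<open>Commuting with \<open>x\<close> lowers $y^{p-j}$ to $(p-j)y^{p-j-1}$, which cancels the denominators in $b_2$. The element $b_1$
  contributes the summand \<open>j = 1\<close> of the same form, since \<open>p - 1\<close> is \<open>- 1\<close> in $\mathbb F$.\<close>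
lemma b_xx:
  "(b1 + (\<Sum>j=2..p - 1. b2_term j)) * xx - xx * (b1 + (\<Sum>j=2..p - 1. b2_term j))
    = pol kappa * y_power_der (to_fract g / to_fract h) (p - 1)"
proof -
  let ?u = "\<lambda>j. (fract_deriv ^^ j) (to_fract g / to_fract h)"
  let ?t = "\<lambda>j. (- 1) ^ Suc j * (cf (to_fract kappa * ?u j) * yy ^ (p - 1 - Suc j)) :: 'a rat_weyl"
  have kf: "to_fract (h ^ p) / to_fract rho = to_fract kappa"
    using rho_nz by (simp flip: rho_kappa)
  have "to_fract (g * h ^ (p - 1)) / to_fract rho = to_fract kappa * ?u 0"
  proof -
    have "h ^ p = h * h ^ (p - 1)"
      using p_pos by (cases p) auto
    then show ?thesis
      unfolding kf[symmetric] using h_nz by simp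
  qed
  then have "b1 * xx - xx * b1 = of_nat (p - 1) * (cf (to_fract kappa * ?u 0) * yy ^ (p - 1 - 1))"
    unfolding b1_def by (simp only: yy_power_xx_commutator)
  also have "of_nat (p - 1) = (- 1 :: 'a rat_weyl)"
    using p_pos of_nat_p_rw by (simp add: of_nat_diff)
  finally have 1: "b1 * xx - xx * b1 = ?t 0"
    by simp
  have 2: "b2_term (Suc j) * xx - xx * b2_term (Suc j) = ?t j" if "1 \<le> j" "Suc j < p" for j
  proof -
    let ?c = "(- 1) ^ Suc j * (?u j * to_fract (h ^ p) / to_fract rho)"
    let ?m = "p - Suc j"
    have "b2_term (Suc j) = scal (1 / of_nat ?m) * (cf ?c * yy ^ ?m)"
      by (simp add: b2_term_def scal_cf_commute divide_inverse del: power_Suc of_nat_diff)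
    then have "b2_term (Suc j) * xx - xx * b2_term (Suc j) = scal (1 / of_nat ?m) * (cf ?c * yy ^ ?m * xx - xx * (cf ?c * yy ^ ?m))"
      by (simp only: scal_left[of xx] right_diff_distrib mult.assoc)
    also have "\<dots> = (scal (1 / of_nat ?m) * of_nat ?m) * (cf ?c * yy ^ (?m - 1))"
      unfolding yy_power_xx_commutator by (simp only: mult.assoc)
    also have "scal (1 / of_nat ?m) * of_nat ?m = (1 :: 'a rat_weyl)"
      using of_nat_nonzero[of ?m] that unfolding of_nat_scal Wh.i_mult[symmetric] by (simp add: Wh.i_1 del: of_nat_diff)
    also have "?c = (- 1) ^ Suc j * (to_fract kappa * ?u j)"
      unfolding kf[symmetric] by simp
    also have "cf \<dots> = (- 1) ^ Suc j * cf (to_fract kappa * ?u j)"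
    proof -
      have "cf ((- 1) ^ n) = (- 1 :: 'a rat_weyl) ^ n" for n
        by (induction n) (simp_all add: cf_1 cf_minus)
      then show ?thesis
        by (simp only: cf_mult)
    qed
    finally show ?thesis
      by (simp add: mult.assoc)
  qed
  have "pol kappa * y_power_der (to_fract g / to_fract h) (p - 1) = (\<Sum>j<p - 1. ?t j)"
  proof -
    have "pol kappa * ((- 1) ^ i * x) = (- 1) ^ i * (pol kappa * x)" for i x
      using scal_left[of "pol kappa" "(- 1) ^ i" x] by (simp add: scal_minus_1_power)
    then show ?thesis
      unfolding y_power_der_p_minus_1 sum_distrib_left
      by (simp only: cf_mult mult.assoc pol_def[of kappa, symmetric])
  qed
  also have "\<dots> = ?t 0 + (\<Sum>j\<in>{1..<p - 1}. ?t j)"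
    using p_ge_2 by (simp add: sum.atLeast_Suc_lessThan lessThan_atLeast0)
  also have "(\<Sum>j\<in>{1..<p - 1}. ?t j) = (\<Sum>j\<in>{1..<p - 1}. b2_term (Suc j) * xx - xx * b2_term (Suc j))"
    by (intro sum.cong refl 2[symmetric]) auto
  also have "\<dots> = (\<Sum>j\<in>{2..p - 1}. b2_term j * xx - xx * b2_term j)"
  proof -
    have "{2..p - 1} = {Suc 1..<Suc (p - 1)}"
      by auto
    then show ?thesis
      by (simp only: sum.shift_bounds_Suc_ivl)
  qed
  finally show ?thesis
    unfolding 1[symmetric]
    by (simp add: sum_subtractf sum_distrib_left sum_distrib_right algebra_simps)
qed

text \<open>The difference of the bracket and $\mathrm{ad}_b$ is a derivation annihilating \<open>x\<close>. Applied to $[\hat y, x] = h$ it shows that its value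
  at $\hat y$ commutes with \<open>x\<close>.\<close>
lemma lie_D_Eb:
  defines "b \<equiv> b1 + (\<Sum>j=2..p - 1. b2_term j)"
  defines "e \<equiv> (lie (D_der h (pol g)) Eb - ad A b) (yhat h)"
  shows "b1 \<in> normalizer h" "(\<Sum>j=2..p - 1. b2_term j) \<in> A" "e \<in> centralizer_x h"
    "lie (D_der h (pol g)) Eb = D_der h e + ad A b"
proof -
  let ?D = "D_der h (pol g)"
  let ?L = "lie ?D Eb"
  let ?X = "?L - ad A b"
  show "b1 \<in> normalizer h"
    by (rule b1_normalizer)
  show b2: "(\<Sum>j=2..p - 1. b2_term j) \<in> A"
    by (rule Weyl_closed(7), rule b2_term_in) (use p_pos in auto)
  have L: "?L \<in> Der A"
    by (intro W_Der_lie D_der_Der Eb_Der)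
  have "b * a - a * b \<in> A" if "a \<in> A" for a
  proof -
    let ?b2 = "\<Sum>j=2..p - 1. b2_term j"
    have "b * a - a * b = (b1 * a - a * b1) + (?b2 * a - a * ?b2)"
      unfolding b_def by (simp add: distrib_left distrib_right)
    also have "\<dots> \<in> A"
      using that b2 by (intro Weyl_closed(9) b1_normalizes Weyl_closed(4) Weyl_closed(10))
    finally show ?thesis .
  qed
  then have ad: "ad A b \<in> Der A"
    by (rule W_Der_ad)
  have X: "?X \<in> Der A"
    by (rule W_Der_I)
      (use L ad in \<open>simp_all add: W_Der_D W_Der_scal Weyl_closed algebra_simps\<close>)
  have kappa: "kappa = (h div rho) * h ^ (p - 1)"
    by (subst kappa_eq) (rule mult.commute)
  have "Eb xx = pol kappa * yy ^ (p - 1)"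
    by (simp add: Eb_eq xx_in_Weyl E_xx)
  also have "\<dots> = pol (h div rho) * Y (p - 1)"
    by (simp only: kappa Y_def pol_mult mult.assoc)
  finally have "?L xx = pol (h div rho) * (pol (h ^ (p - 1)) * y_power_der (to_fract g / to_fract h) (p - 1))"
    by (simp add: lie_def D_der_xx W_Der_0[OF Eb_Der] W_Der_D[OF D_der_Der] pol_in_Weyl Y_in D_der_pol D_der_Y)
  also have "\<dots> = pol kappa * y_power_der (to_fract g / to_fract h) (p - 1)"
    by (simp only: kappa pol_mult mult.assoc)
  finally have X0: "?X xx = 0"
    using b_xx by (simp add: ad_def xx_in_Weyl b_def)
  have e: "e = ?X (yhat h)"
    by (simp add: e_def)
  have "?X (yhat h * xx - xx * yhat h) = e * xx - xx * e"
    by (simp only: W_Der_diff[OF X] W_Der_D[OF X] Weyl_closed xx_in_Weyl yhat_in_Weyl X0 e[symmetric]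
      mult_zero_right mult_zero_left add_0_left add_0_right)
  moreover have "yhat h * xx - xx * yhat h = pol h"
    using Wh.rel[of h] by (simp add: pol_eq)
  ultimately have "e * xx = xx * e"
    using Der_pol_0[OF X X0] by simp
  then show "e \<in> centralizer_x h"
    using W_Der_D(1)[OF X yhat_in_Weyl] by (simp add: centralizer_x_def e)
  have "D_der h e = ?X"
    using X X0 e[symmetric] by (rule D_der_unique)
  then show "?L = D_der h e + ad A b"
    by simp
qed

end

end

theorem proposition6p34:
  fixes h :: "'a::field poly" and p :: nat
  assumes "CHAR('a) = p" and "p > 0" and "h \<noteq> 0"
  shows
    "(\<forall>f g. lie (D_der h (pol f)) (D_der h (pol g)) = 0)

     \<and> (\<forall>g r n. let c = (g * r) mod (h div pi_poly h) in
          HH1_eq (Weyl h) (lie (D_der h (pol g)) (ad (Weyl h) (pol r * a_elt h (int n))))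
            (lmul (of_nat n) (ad (Weyl h) (pol (g * r) * a_elt h (int n - 1))))
        \<and> HH1_eq (Weyl h) (lmul (of_nat n) (ad (Weyl h) (pol (g * r) * a_elt h (int n - 1))))
            (lmul (of_nat n) (ad (Weyl h) (pol c * a_elt h (int n - 1)))))

     \<and> (\<forall>r s m n. let q = of_nat m * r * delta0 h s - of_nat n * s * delta0 h r;
                     d = q mod (h div pi_poly h) in
          HH1_eq (Weyl h)
            (lie (ad (Weyl h) (pol r * a_elt h (int m))) (ad (Weyl h) (pol s * a_elt h (int n))))
            (ad (Weyl h) (pol q * a_elt h (int m + int n - 1)))
        \<and> HH1_eq (Weyl h) (ad (Weyl h) (pol q * a_elt h (int m + int n - 1)))
            (ad (Weyl h) (pol d * a_elt h (int m + int n - 1))))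

     \<and> (\<forall>r m k n. m = k * p + n \<and> n < p \<longrightarrow>
         (let \<zeta> = cf (to_fract h / to_fract (pi_poly h * rho_poly h) * to_fract (delta0 h r)
                      + of_nat n * to_fract r * (to_fract (pderiv h) / to_fract (rho_poly h))) in
          HH1_eq (Weyl h) (lie (E_breve h) (ad (Weyl h) (pol r * a_elt h (int m))))
            (lmul (z_elt h ^ k) (lie (E_breve h) (ad (Weyl h) (pol r * a_elt h (int n)))))
        \<and> HH1_eq (Weyl h)
            (lmul (z_elt h ^ k) (lie (E_breve h) (ad (Weyl h) (pol r * a_elt h (int n)))))
            (if 1 \<le> n
             then lmul (z_elt h ^ (k + 1)) (ad (Weyl h) (\<zeta> * a_elt h (int n - 1)))
             else lmul (z_elt h ^ k) (lie (D_der h (pol (delta0 h r))) (E_breve h)))))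

     \<and> (\<forall>g. let b1 = cf (to_fract (g * h ^ (p - 1)) / to_fract (rho_poly h)) * yy ^ (p - 1);
               b2 = (\<Sum>k = 2..p - 1.
                       cf ((- 1) ^ k * ((fract_deriv ^^ (k - 1)) (to_fract g * inverse (to_fract h))
                                        * to_fract (h ^ p) / to_fract (rho_poly h)))
                       * (scal (1 / of_nat (p - k)) * yy ^ (p - k)));
               b = b1 + b2;
               e = (lie (D_der h (pol g)) (E_breve h) - ad (Weyl h) b) (yhat h) in
          b1 \<in> normalizer h \<and> b2 \<in> Weyl h \<and> e \<in> centralizer_x h
        \<and> lie (D_der h (pol g)) (E_breve h) = D_der h e + ad (Weyl h) b)"
proof -
  interpret weyl_char_p h p
    by standard (use assms in auto)
  have a: "\<forall>f g. lie (D_der h (pol f)) (D_der h (pol g)) = 0"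
    by (intro allI lie_D_D)
  show ?thesis
  proof (intro conjI[OF a] conjI allI impI, goal_cases)
    case (1 g r n)
    show ?case
      unfolding Let_def by (intro conjI lie_D_ad_a)
  next
    case (2 r s m n)
    show ?case
      unfolding Let_def by (intro conjI lie_ad_a_ad_a)
  next
    case (3 r m K n)
    then have m: "m = K * p + n" and n: "n < p"
      by auto
    have zK: "z ^ K \<in> A"
      by (intro Weyl_closed z_in)
    have "HH1_eq A (lmul (z ^ K) (lie Eb (ad A (pol r * a_elt h (int n)))))
      (if 1 \<le> n then lmul (z ^ (K + 1)) (ad A (pol (zeta n r) * a_elt h (int n - 1)))
       else lmul (z ^ K) (lie (D_der h (pol (delta0 h r))) Eb))"
    proof (cases "1 \<le> n")
      case True
      then show ?thesis
        using lie_Eb_ad_pos[OF True n] by simp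
    next
      case False
      then have "n = 0"
        by simp
      moreover have "lmul (z ^ K) (lie (D_der h (pol (delta0 h r))) Eb) \<in> Der A"
        by (intro W_Der_lmul W_Der_lie D_der_Der Eb_Der zK z_power_central)
      ultimately show ?thesis
        using lie_Eb_ad_0 by (simp add: HH1_eq_refl)
    qed
    then show ?case
      unfolding Let_def cf_zeta using lie_Eb_ad_reduce[OF m] by (intro conjI)
  next
    case (4 g)
    show ?case
      unfolding Let_def b1_def[of g, symmetric] b2_term_def[of g, symmetric]
      by (intro conjI lie_D_Eb)
  qed
qed

end
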